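(* Let $\alpha,K>0$, $\beta\in(0,1]$, and let $p^\star=e^{-u+a}$ be an $(\alpha,\beta,K)$-weakly log-concave probability density on $\mathbb R^d$. Let $f,\sigma\in C^1_{\text{a.e.}}([0,1],[0,1])$ with $f$ increasing, $f_0=0$, $f_1=1$, and $\sigma$ decreasing, $\sigma_0=1$, $\sigma_1=0$, and assume there exists $\gamma\in(0,1)$ with $\gamma\le\sigma_{1/2}\wedge f_{1/2}$ and $f_{1-\gamma}^2\ge\sigma_{1-\gamma}$. Let $Y\sim p^\star$ and $\xi\sim\mathcal N(0,I_d)$ be independent, $X_t=f_tY+\sigma_t\xi$, and $v_t(x)=\mathbb E[f_t'Y+\sigma_t'\xi\mid X_t=x]$. Assume in addition that there exist $p>0$, $t_0\in(0,1)$ and $A\ge1$ such that: (1) $f,\sigma\in C^2_{\text{a.e.}}(0,1)$ and $\sigma_t>0$ for all $t\in(0,1)$; (2) there exists $\ell\in C^2([t_0,1))$ such that for all $t\in[t_0,1)$: $\sigma_t=(1-t)^p\ell(t)$, $0<A^{-1}\le\ell(t)\le A$, and $\|\ell'\|_{L^\infty([t_0,1))}+\|\ell''\|_{L^\infty([t_0,1))}\le A$; (3) $\|f'\|_{L^\infty([t_0,1))}+\|f''\|_{L^\infty([t_0,1))}+\|\arg\min u\|\,d^{-1/2}\le A$; (4) for a.e. $t\in(0,t_0]$, $\sigma_t^{-1}+|\sigma_t'|+|\sigma_t''|+|f_t'|+|f_t''|\le A$. Then there is a constant $C>0$ depending only on $A,\alpha,\beta,K,\gamma,f_{t_0},p$,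 and independent of the dimension $d$, such that for a.e. $t\in(0,1)$ and all $x\in\mathbb R^d$, $$\|\partial_tv_t(x)\|\le\frac{C}{(1-t)^2}\big(\sqrt d+\|x\|\big).$$
   Context: Weak log-concavity. For $\alpha,K>0$ and $\beta\in(0,1]$, a probability density $p$ on $\mathbb R^d$ is $(\alpha,\beta,K)$-weakly log-concave if $p=\exp(-u+a)$ where (1) $u:\mathbb R^d\to\mathbb R\cup\{+\infty\}$ is convex, $C^2$ on the interior of the support, with $\nabla^2u\succeq\alpha\,\mathrm{Id}$ there; (2) $|a(x)-a(y)|\le K\|x-y\|^\beta$ for all $x,y\in\mathbb R^d$. In the claim, $u$ is the convex part of the given decomposition of $p^\star$ and $\arg\min u\in\mathbb R^d$ is its minimizer. Primes denote time derivatives. $C^1_{\text{a.e.}}([0,1],[0,1])$ denotes absolutely continuous functions $[0,1]\to[0,1]$ that are continuously differentiable outside a closed Lebesgue-null set; $C^2_{\text{a.e.}}(0,1)$ denotes $C^1$ functions on $(0,1)$ whose derivative is locally absolutely continuous and which are $C^2$ outside a closed Lebesgue-null set. Increasing and decreasing are understood strictly. *)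

theory Defs
  imports "HOL-Probability.Probability"
begin

text \<open>
  The constant of the theorem must not depend on the dimension, so the dimension \<open>d\<close> has to be
  a number that can be quantified inside the statement. Points of \<open>d\<close>-dimensional space are
  therefore extensional functions on \<open>{..<d}\<close>: the common carrier of the library's product
  measures and product topologies over that index set.
\<close>

type_synonym vec = "nat \<Rightarrow> real"

abbreviation Rd :: "nat \<Rightarrow> vec set" where
  "Rd d \<equiv> {..<d} \<rightarrow>\<^sub>E UNIV"

abbreviation Rd_top :: "nat \<Rightarrow> vec topology" where
  "Rd_top d \<equiv> product_topology (\<lambda>_. euclideanreal) {..<d}"

abbreviation Rd_lborel :: "nat \<Rightarrow> vec measure" where
  "Rd_lborel d \<equiv> Pi\<^sub>M {..<d} (\<lambda>_. lborel)"

abbreviation Rd_norm :: "nat \<Rightarrow> vec \<Rightarrow> real" where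
  "Rd_norm d x \<equiv> L2_set x {..<d}"

definition lincomb :: "nat \<Rightarrow> real \<Rightarrow> vec \<Rightarrow> real \<Rightarrow> vec \<Rightarrow> vec" where
  "lincomb d r x s y = (\<lambda>i\<in>{..<d}. r * x i + s * y i)"

definition std_gaussian :: "nat \<Rightarrow> vec measure" where
  "std_gaussian d = Pi\<^sub>M {..<d} (\<lambda>_. density lborel (\<lambda>x. ennreal (std_normal_density x)))"

definition convex_ereal :: "nat \<Rightarrow> (vec \<Rightarrow> ereal) \<Rightarrow> bool" where
  "convex_ereal d u \<longleftrightarrow>
     (\<forall>x\<in>Rd d. u x \<noteq> -\<infinity>) \<and>
     (\<forall>x\<in>Rd d. \<forall>y\<in>Rd d. \<forall>s\<in>{0<..<1}.
        u (lincomb d (1 - s) x s y) \<le> ereal (1 - s) * u x + ereal s * u y)"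

definition Rd_support :: "nat \<Rightarrow> (vec \<Rightarrow> real) \<Rightarrow> vec set" where
  "Rd_support d p = Rd_top d closure_of {x \<in> Rd d. p x \<noteq> 0}"

definition has_partial :: "(vec \<Rightarrow> real) \<Rightarrow> real \<Rightarrow> nat \<Rightarrow> vec \<Rightarrow> bool" where
  "has_partial g D i x \<longleftrightarrow> ((\<lambda>s. g (x(i := s))) has_real_derivative D) (at (x i))"

text \<open>\<open>G i\<close> and \<open>H i j\<close> are the first and second partial derivatives; \<open>S\<close> is meant to be open.\<close>

definition C2_with :: "nat \<Rightarrow> vec set \<Rightarrow> (vec \<Rightarrow> real) \<Rightarrow> (nat \<Rightarrow> vec \<Rightarrow> real)
    \<Rightarrow> (nat \<Rightarrow> nat \<Rightarrow> vec \<Rightarrow> real) \<Rightarrow> bool" where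
  "C2_with d S g G H \<longleftrightarrow>
     continuous_map (subtopology (Rd_top d) S) euclideanreal g \<and>
     (\<forall>i<d. (\<forall>x\<in>S. has_partial g (G i x) i x) \<and>
        continuous_map (subtopology (Rd_top d) S) euclideanreal (G i) \<and>
        (\<forall>j<d. (\<forall>x\<in>S. has_partial (G i) (H i j x) j x) \<and>
           continuous_map (subtopology (Rd_top d) S) euclideanreal (H i j)))"

definition weakly_log_concave_decomp ::
  "nat \<Rightarrow> real \<Rightarrow> real \<Rightarrow> real \<Rightarrow> (vec \<Rightarrow> real) \<Rightarrow> (vec \<Rightarrow> ereal) \<Rightarrow> (vec \<Rightarrow> real) \<Rightarrow> bool" where
  "weakly_log_concave_decomp d \<alpha> \<beta> K p u a \<longleftrightarrow>
     p \<in> borel_measurable (Rd_lborel d) \<and>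
     prob_space (density (Rd_lborel d) (\<lambda>x. ennreal (p x))) \<and>
     (\<forall>x\<in>Rd d. p x = (if u x = \<infinity> then 0 else exp (- real_of_ereal (u x) + a x))) \<and>
     convex_ereal d u \<and>
     (\<exists>G H. C2_with d (Rd_top d interior_of Rd_support d p) (\<lambda>x. real_of_ereal (u x)) G H \<and>
        (\<forall>x \<in> Rd_top d interior_of Rd_support d p. \<forall>w::vec.
           (\<Sum>i<d. \<Sum>j<d. H i j x * w i * w j) \<ge> \<alpha> * (\<Sum>i<d. (w i)\<^sup>2))) \<and>
     (\<forall>x\<in>Rd d. \<forall>y\<in>Rd d. \<bar>a x - a y\<bar> \<le> K * (Rd_norm d (\<lambda>i. x i - y i)) powr \<beta>)"

definition abs_continuous_on_Icc :: "real \<Rightarrow> real \<Rightarrow> (real \<Rightarrow> real) \<Rightarrow> bool" where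
  "abs_continuous_on_Icc a b g \<longleftrightarrow>
     (\<forall>\<epsilon>>0. \<exists>\<delta>>0. \<forall>(n::nat) l r.
        (\<forall>k<n. a \<le> l k \<and> l k \<le> r k \<and> r k \<le> b) \<and>
        disjoint_family_on (\<lambda>k. {l k<..<r k}) {..<n} \<and>
        (\<Sum>k<n. r k - l k) < \<delta> \<longrightarrow>
        (\<Sum>k<n. \<bar>g (r k) - g (l k)\<bar>) < \<epsilon>)"

definition C1_ae :: "(real \<Rightarrow> real) \<Rightarrow> bool" where
  "C1_ae g \<longleftrightarrow>
     g ` {0..1} \<subseteq> {0..1} \<and> abs_continuous_on_Icc 0 1 g \<and>
     (\<exists>N g'. closed N \<and> N \<in> null_sets lborel \<and>
        (\<forall>t\<in>{0..1} - N. (g has_real_derivative g' t) (at t within {0..1})) \<and>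
        continuous_on ({0..1} - N) g')"

definition C2_ae :: "(real \<Rightarrow> real) \<Rightarrow> bool" where
  "C2_ae g \<longleftrightarrow>
     (\<forall>t\<in>{0<..<1}. g differentiable at t) \<and> continuous_on {0<..<1} (deriv g) \<and>
     (\<forall>a b. 0 < a \<and> a \<le> b \<and> b < 1 \<longrightarrow> abs_continuous_on_Icc a b (deriv g)) \<and>
     (\<exists>N. closed N \<and> N \<in> null_sets lborel \<and>
        (\<forall>t\<in>{0<..<1} - N. deriv g differentiable at t) \<and>
        continuous_on ({0<..<1} - N) (deriv (deriv g)))"

text \<open>Derivatives are taken within \<open>S\<close>, hence one-sided at an endpoint belonging to \<open>S\<close>.\<close>

definition C2_on_with ::
  "real set \<Rightarrow> (real \<Rightarrow> real) \<Rightarrow> (real \<Rightarrow> real) \<Rightarrow> (real \<Rightarrow> real) \<Rightarrow> bool" where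
  "C2_on_with S g g' g'' \<longleftrightarrow>
     (\<forall>t\<in>S. (g has_real_derivative g' t) (at t within S)) \<and>
     (\<forall>t\<in>S. (g' has_real_derivative g'' t) (at t within S)) \<and>
     continuous_on S g''"

definition Linf_norm :: "real set \<Rightarrow> (real \<Rightarrow> real) \<Rightarrow> ereal" where
  "Linf_norm S g = esssup (lebesgue_on S) (\<lambda>t. ereal \<bar>g t\<bar>)"

text \<open>
  \<open>g x = E[Z | X = x]\<close> componentwise. A conditional expectation only determines \<open>g\<close> up to null
  sets of the law of \<open>X\<close>; requiring continuity selects the pointwise-defined version, which is
  unique as soon as the law of \<open>X\<close> charges every nonempty open set.
\<close>

definition cond_exp_given ::
  "nat \<Rightarrow> 'w measure \<Rightarrow> ('w \<Rightarrow> vec) \<Rightarrow> ('w \<Rightarrow> vec) \<Rightarrow> (vec \<Rightarrow> vec) \<Rightarrow> bool" where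
  "cond_exp_given d M Z X g \<longleftrightarrow>
     continuous_map (Rd_top d) (Rd_top d) g \<and>
     (\<forall>i<d. AE \<omega> in M.
        real_cond_exp M (vimage_algebra (space M) X (Rd_lborel d)) (\<lambda>\<omega>. Z \<omega> i) \<omega> = g (X \<omega>) i)"

text \<open>
  Here \<open>X\<^sub>t = f\<^sub>t Y + \<sigma>\<^sub>t \<xi>\<close>. The velocity depends on the probability space only through the joint
  law of \<open>(Y, \<xi>)\<close>, and all such laws, for every \<open>d\<close>, occur on the sample type \<open>vec \<times> vec\<close>.
\<close>

definition velocity_field ::
  "nat \<Rightarrow> 'w measure \<Rightarrow> ('w \<Rightarrow> vec) \<Rightarrow> ('w \<Rightarrow> vec) \<Rightarrow> (real \<Rightarrow> real) \<Rightarrow> (real \<Rightarrow> real)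
    \<Rightarrow> (real \<Rightarrow> vec \<Rightarrow> vec) \<Rightarrow> bool" where
  "velocity_field d M Y \<xi> f \<sigma> v \<longleftrightarrow>
     (\<forall>t\<in>{0<..<1}. cond_exp_given d M
        (\<lambda>\<omega>. lincomb d (deriv f t) (Y \<omega>) (deriv \<sigma> t) (\<xi> \<omega>))
        (\<lambda>\<omega>. lincomb d (f t) (Y \<omega>) (\<sigma> t) (\<xi> \<omega>)) (v t))"

end

(* Given X_t = x, the signal Y has a density proportional to p(y) exp(-|x - f y|^2 / (2 sigma^2)), and with
   g = sigma' / sigma, m_t(x) = E[Y | X_t = x] one has v_t(x) = g x + (f' - f g) m_t(x).  The time derivative of
   m_t is the covariance of Y with the time derivative of the log-likelihood, a quadratic polynomial in y.

   The posterior is an (L, K)-weakly log-concave density with L = alpha + f^2 / sigma^2.  Applying the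
   Prekopa-Leindler inequality to P e^F and P e^(-F) bounds E[e^F] E[e^(-F)] for every Lipschitz F,
   independently of the dimension; linear functionals and the distance to the mean therefore have variance
   O(1 / L), and the quadratic polynomial has a covariance with Y of order sqrt d + |x|.  Comparing P with its
   contraction by 1/2 towards a near-minimizer of u locates the mean.  The factor 1 / (sigma^2 L) stays
   bounded: by 1 / (alpha sigma^2) for t <= t0 and by 1 / f^2 for t > t0.  So the blow-up comes only from
   g = O(1 / (1 - t)) and g' = O(1 / (1 - t)^2). *)

theory Submission
  imports Defs
begin

section \<open>The Prekopa-Leindler inequality\<close>

text \<open>Since \<open>a\<close> is merely Hoelder continuous, the posterior has no Hessian bound
  for a Brascamp-Lieb or Bakry-Emery argument, and \<open>a\<close> cannot be treated as a bounded
  perturbation. What survives is an inequality between the density at two points and at their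
  midpoint, with a gain \<open>L * r^2 / 4\<close> against a loss that is linear in the distance
  \<open>r\<close>. Prekopa-Leindler takes exactly such input, and the loss costs a factor in
  \<open>K\<close> and \<open>L\<close> but not in \<open>d\<close>. The second obstacle is the
  factor 1 / sigma^2 in the time derivative of the log-likelihood. Only the decay 1 / L of the
  posterior covariance compensates it, so every estimate has to carry the full curvature
  \<open>L\<close> of the posterior instead of \<alpha>. The third is the order sqrt d: the squared
  distance to the mean is itself of order d / L, and only its fluctuation is small enough, so
  constants must drop out of the covariance before Cauchy-Schwarz is applied.\<close>

lemma emeasure_affine_vimage_half:
  fixes H :: "real set"
  assumes [measurable]: "H \<in> sets borel"
  shows "emeasure lborel {x. (x + b) / 2 \<in> H} = 2 * emeasure lborel H"
proof -
  have eq: "(\<lambda>x. indicator H ((x + b) / 2) :: ennreal) = (\<lambda>x. indicator H (b / 2 + (1/2) * x))"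
    by (auto simp: field_simps fun_eq_iff)
  have "emeasure lborel {x. (x + b) / 2 \<in> H} = (\<integral>\<^sup>+x. indicator {x. (x + b) / 2 \<in> H} x \<partial>lborel)"
    by (rule nn_integral_indicator[symmetric]) measurable
  also have "\<dots> = (\<integral>\<^sup>+x. indicator H (b / 2 + (1/2) * x) \<partial>lborel)"
    unfolding eq[symmetric] by (intro nn_integral_cong) (auto simp: indicator_def)
  finally have *: "emeasure lborel {x. (x + b) / 2 \<in> H}
      = (\<integral>\<^sup>+x. indicator H (b / 2 + (1/2) * x) \<partial>lborel)" .
  have "emeasure lborel H = (\<integral>\<^sup>+x. indicator H x \<partial>lborel)" by simp
  also have "\<dots> = ennreal (1/2) * (\<integral>\<^sup>+x. indicator H (b / 2 + (1/2) * x) \<partial>lborel)"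
    by (subst nn_integral_real_affine[where c="1/2" and t="b/2"]) auto
  finally have "2 * emeasure lborel H = (2 * ennreal (1/2)) * emeasure lborel {x. (x + b) / 2 \<in> H}"
    by (simp add: * mult.assoc)
  also have "2 * ennreal (1/2) = 1"
    by (metis ennreal_1 ennreal_mult' ennreal_numeral mult_2 field_sum_of_halves numeral_One one_add_one
        zero_le_numeral mult.commute)
  finally show ?thesis by simp
qed

text \<open>Choose \<open>a0\<close> in \<open>A\<close> near its supremum and \<open>b0\<close> in
  \<open>B\<close> near its infimum. Midpoints of \<open>b0\<close> with points of \<open>A\<close>
  below \<open>a0\<close> lie to the left of \<open>m\<close>, midpoints of \<open>a0\<close> with
  points of \<open>B\<close> from \<open>b0\<close> on lie to the right; both families are in
  \<open>H\<close>, and halving costs the factor 2. A measurable superset \<open>H\<close> of the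
  midpoints avoids asking whether the set of midpoints is measurable.\<close>

lemma brunn_minkowski_1d_bounded:
  fixes A B H :: "real set"
  assumes [measurable]: "A \<in> sets borel" "B \<in> sets borel" "H \<in> sets borel"
    and ne: "A \<noteq> {}" "B \<noteq> {}" and bdd: "bdd_above A" "bdd_below B"
    and mid: "\<And>a b. a \<in> A \<Longrightarrow> b \<in> B \<Longrightarrow> (a + b) / 2 \<in> H"
  shows "emeasure lborel A + emeasure lborel B \<le> 2 * emeasure lborel H"
proof (rule ennreal_le_epsilon)
  fix e :: real assume e: "0 < e"
  obtain a0 where a0: "a0 \<in> A" "Sup A - e / 2 < a0"
    using less_cSup_iff[OF ne(1) bdd(1), of "Sup A - e / 2"] e by auto
  obtain b0 where b0: "b0 \<in> B" "b0 < Inf B + e / 2"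
    using cInf_less_iff[OF ne(2) bdd(2), of "Inf B + e / 2"] e by auto
  define m where "m = (a0 + b0) / 2"
  let ?A = "A \<inter> {..<a0}" and ?B = "B \<inter> {b0..}"
  have A: "emeasure lborel A \<le> emeasure lborel ?A + ennreal (e / 2)"
  proof -
    have sub: "A \<subseteq> ?A \<union> {a0..Sup A}" using cSup_upper[OF _ bdd(1)] by force
    have "emeasure lborel A \<le> emeasure lborel (?A \<union> {a0..Sup A})" by (rule emeasure_mono[OF sub]) simp
    also have "\<dots> \<le> emeasure lborel ?A + emeasure lborel {a0..Sup A}" by (rule emeasure_subadditive) auto
    also have "emeasure lborel {a0..Sup A} \<le> ennreal (e / 2)"
      using a0 cSup_upper[OF a0(1) bdd(1)] by (simp add: ennreal_leI)
    finally show ?thesis by simp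
  qed
  have B: "emeasure lborel B \<le> emeasure lborel ?B + ennreal (e / 2)"
  proof -
    have sub: "B \<subseteq> ?B \<union> {Inf B..b0}" using cInf_lower[OF _ bdd(2)] by force
    have "emeasure lborel B \<le> emeasure lborel (?B \<union> {Inf B..b0})" by (rule emeasure_mono[OF sub]) simp
    also have "\<dots> \<le> emeasure lborel ?B + emeasure lborel {Inf B..b0}" by (rule emeasure_subadditive) auto
    also have "emeasure lborel {Inf B..b0} \<le> ennreal (e / 2)"
      using b0 cInf_lower[OF b0(1) bdd(2)] by (simp add: ennreal_leI)
    finally show ?thesis by simp
  qed
  have "emeasure lborel ?A \<le> emeasure lborel {x. (x + b0) / 2 \<in> H \<inter> {..<m}}"
    by (rule emeasure_mono) (auto intro: mid b0 simp: m_def)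
  also have "\<dots> = 2 * emeasure lborel (H \<inter> {..<m})" by (rule emeasure_affine_vimage_half) simp
  finally have hA: "emeasure lborel ?A \<le> 2 * emeasure lborel (H \<inter> {..<m})" .
  have "emeasure lborel ?B \<le> emeasure lborel {x. (x + a0) / 2 \<in> H \<inter> {m..}}"
    by (rule emeasure_mono) (use mid[OF a0(1)] in \<open>auto simp: m_def add.commute\<close>)
  also have "\<dots> = 2 * emeasure lborel (H \<inter> {m..})" by (rule emeasure_affine_vimage_half) simp
  finally have hB: "emeasure lborel ?B \<le> 2 * emeasure lborel (H \<inter> {m..})" .
  have "emeasure lborel (H \<inter> {..<m}) + emeasure lborel (H \<inter> {m..}) = emeasure lborel H"
    by (subst plus_emeasure) (auto intro!: arg_cong2[where f=emeasure])
  then have "emeasure lborel ?A + emeasure lborel ?B \<le> 2 * emeasure lborel H"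
    using add_mono[OF hA hB] by (simp add: distrib_left[symmetric])
  moreover have "ennreal (e / 2) + ennreal (e / 2) = ennreal e"
    using e by (simp flip: ennreal_plus)
  ultimately show "emeasure lborel A + emeasure lborel B \<le> 2 * emeasure lborel H + ennreal e"
    using add_mono[OF A B]
    by (smt (verit, ccfv_threshold) add.assoc add.commute add_mono dual_order.trans order_refl)
qed

lemma brunn_minkowski_1d:
  fixes A B H :: "real set"
  assumes [measurable]: "A \<in> sets borel" "B \<in> sets borel" "H \<in> sets borel"
    and ne: "A \<noteq> {}" "B \<noteq> {}"
    and mid: "\<And>a b. a \<in> A \<Longrightarrow> b \<in> B \<Longrightarrow> (a + b) / 2 \<in> H"
  shows "emeasure lborel A + emeasure lborel B \<le> 2 * emeasure lborel H"
proof -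
  have exh: "(\<lambda>n. emeasure lborel (C \<inter> {- real n..real n})) \<longlonglongrightarrow> emeasure lborel C"
    if [measurable]: "C \<in> sets borel" for C
  proof -
    have "(\<Union>n. C \<inter> {- real n..real n}) = C"
    proof safe
      fix x assume "x \<in> C"
      obtain n where "\<bar>x\<bar> \<le> real n" using real_arch_simple by blast
      with \<open>x \<in> C\<close> show "x \<in> (\<Union>n. C \<inter> {- real n..real n})" by (auto intro!: exI[of _ n])
    qed
    moreover have "(\<lambda>n. emeasure lborel (C \<inter> {- real n..real n})) \<longlonglongrightarrow>
        emeasure lborel (\<Union>n. C \<inter> {- real n..real n})"
      by (rule Lim_emeasure_incseq) (auto simp: incseq_def)
    ultimately show ?thesis by simp
  qed
  obtain a b where ab: "a \<in> A" "b \<in> B" using ne by auto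
  \<comment> \<open>The truncated sets must stay nonempty, so the interval has to contain one point
    of each set.\<close>
  obtain N where N: "\<bar>a\<bar> + \<bar>b\<bar> \<le> real N" using real_arch_simple by blast
  show ?thesis
  proof (rule LIMSEQ_le_const2[OF tendsto_add[OF exh exh]])
    show "\<exists>N. \<forall>n\<ge>N. emeasure lborel (A \<inter> {- real n..real n}) + emeasure lborel (B \<inter> {- real n..real n})
        \<le> 2 * emeasure lborel H"
    proof (intro exI allI impI)
      fix n assume n: "N \<le> n"
      have le: "\<bar>a\<bar> + \<bar>b\<bar> \<le> real n" using n N by (meson of_nat_mono order_trans)
      then have "a \<in> A \<inter> {- real n..real n}" "b \<in> B \<inter> {- real n..real n}" using ab by auto
      then show "emeasure lborel (A \<inter> {- real n..real n}) + emeasure lborel (B \<inter> {- real n..real n})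
        \<le> 2 * emeasure lborel H"
        by (intro brunn_minkowski_1d_bounded) (auto intro: mid bdd_aboveI[of _ "real n"] bdd_belowI[of _ "- real n"])
    qed
  qed fact+
qed

lemma nn_integral_indicator_below:
  fixes c :: ennreal
  shows "(\<integral>\<^sup>+s. indicator {s. 0 < s \<and> s < 1 \<and> ennreal s < c} s \<partial>lborel) = min c 1"
proof -
  have "{s. 0 < s \<and> s < 1 \<and> ennreal s < c} = {0<..<enn2real (min c 1)}"
  proof (cases "c \<le> 1")
    case True
    then obtain r where "0 \<le> r" "c = ennreal r" "r \<le> 1" 
      by (metis enn2real_leI enn2real_nonneg ennreal_1 ennreal_enn2real ennreal_one_less_top leD le_less_trans
          top.not_eq_extremum zero_less_one_class.zero_le_one)
    then show ?thesis by (auto simp: min_def ennreal_less_iff)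
  next
    case False
    then have "1 \<le> c" by simp
    then have "\<And>s. s < 1 \<Longrightarrow> ennreal s < c"
      by (metis ennreal_1 ennreal_lessI less_le_trans zero_less_one)
    then show ?thesis using False by (auto simp: min_def)
  qed
  moreover have "min c 1 = ennreal (enn2real (min c 1))"
    by (metis ennreal_enn2real ennreal_one_less_top min_less_iff_disj)
  ultimately show ?thesis
    by (metis (no_types, lifting) emeasure_lborel_Ioo enn2real_nonneg diff_zero nn_integral_indicator sets_lborel
        borel_open open_greaterThanLessThan)
qed

text \<open>Levels stop at 1 because, after normalization of the suprema, exactly the levels below 1
  have the nonempty superlevel sets that Brunn-Minkowski needs. For \<open>h\<close> the truncation
  only loses mass, which is the harmless direction.\<close>

lemma layer_cake_min:
  fixes f :: "real \<Rightarrow> ennreal"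
  assumes [measurable]: "f \<in> borel_measurable borel"
  shows "(\<integral>\<^sup>+x. min (f x) 1 \<partial>lborel)
     = (\<integral>\<^sup>+s. indicator {0<..<1} s * emeasure lborel {x. ennreal s < f x} \<partial>lborel)"
proof -
  interpret pair_sigma_finite lborel lborel ..
  have "(\<integral>\<^sup>+x. min (f x) 1 \<partial>lborel)
      = (\<integral>\<^sup>+x. (\<integral>\<^sup>+s. indicator {s. 0 < s \<and> s < 1 \<and> ennreal s < f x} s \<partial>lborel) \<partial>lborel)"
    by (simp add: nn_integral_indicator_below)
  also have "\<dots> = (\<integral>\<^sup>+x. (\<integral>\<^sup>+s. indicator {0<..<1} s * indicator {x. ennreal s < f x} x \<partial>lborel) \<partial>lborel)"
    by (intro nn_integral_cong) (auto simp: indicator_def)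
  also have "\<dots> = (\<integral>\<^sup>+s. (\<integral>\<^sup>+x. indicator {0<..<1} s * indicator {x. ennreal s < f x} x \<partial>lborel) \<partial>lborel)"
    by (rule pair_sigma_finite.Fubini'[OF pair_sigma_finite.intro[OF lborel.sigma_finite_measure_axioms lborel.sigma_finite_measure_axioms]]) (simp add: indicator_def)
  also have "\<dots> = (\<integral>\<^sup>+s. indicator {0<..<1} s * emeasure lborel {x. ennreal s < f x} \<partial>lborel)"
    by (intro nn_integral_cong) (simp add: nn_integral_cmult)
  finally show ?thesis .
qed

text \<open>At each level in (0, 1), midpoints of the superlevel sets of \<open>f\<close> and
  \<open>g\<close> lie in that of \<open>h\<close>, so Brunn-Minkowski applies level by level. Equal
  suprema are what give the arithmetic mean here, which is stronger than the geometric one.\<close>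

lemma prekopa_leindler_1d_normalized:
  fixes f g h :: "real \<Rightarrow> ennreal"
  assumes [measurable]: "f \<in> borel_measurable borel" "g \<in> borel_measurable borel" "h \<in> borel_measurable borel"
    and le1: "\<And>x. f x \<le> 1" "\<And>x. g x \<le> 1"
    and sup: "\<And>s. s < 1 \<Longrightarrow> \<exists>x. s < f x" "\<And>s. s < 1 \<Longrightarrow> \<exists>x. s < g x"
    and mid: "\<And>x y. f x * g y \<le> (h ((x + y) / 2))\<^sup>2"
  shows "(\<integral>\<^sup>+x. f x \<partial>lborel) + (\<integral>\<^sup>+x. g x \<partial>lborel) \<le> 2 * (\<integral>\<^sup>+x. h x \<partial>lborel)"
proof -
  let ?m = "\<lambda>f s. emeasure lborel {x. ennreal s < f x}"
  have "(\<integral>\<^sup>+x. f x \<partial>lborel) + (\<integral>\<^sup>+x. g x \<partial>lborel)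
      = (\<integral>\<^sup>+x. min (f x) 1 \<partial>lborel) + (\<integral>\<^sup>+x. min (g x) 1 \<partial>lborel)"
    using le1 by (simp add: min_absorb1)
  also have "\<dots> = (\<integral>\<^sup>+s. indicator {0<..<1} s * ?m f s + indicator {0<..<1} s * ?m g s \<partial>lborel)"
    unfolding layer_cake_min[OF assms(1)] layer_cake_min[OF assms(2)]
    by (rule nn_integral_add[symmetric]) measurable
  also have "\<dots> \<le> (\<integral>\<^sup>+s. 2 * (indicator {0<..<1} s * ?m h s) \<partial>lborel)"
  proof (intro nn_integral_mono)
    fix s :: real
    show "indicator {0<..<1} s * ?m f s + indicator {0<..<1} s * ?m g s \<le> 2 * (indicator {0<..<1} s * ?m h s)"
    proof (cases "s \<in> {0<..<1}")
      case True
      then have s: "0 < s" "ennreal s < 1" by (auto simp: ennreal_less_one_iff)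
      have "?m f s + ?m g s \<le> 2 * ?m h s"
      proof (rule brunn_minkowski_1d)
        fix x y assume "x \<in> {x. ennreal s < f x}" "y \<in> {x. ennreal s < g x}"
        then have xy: "ennreal s < f x" "ennreal s < g y" by auto
        have "(ennreal s)\<^sup>2 < f x * g y"
          proof -
          have "(ennreal s)\<^sup>2 < ennreal s * f x"
            unfolding power2_eq_square using xy s by (intro ennreal_mult_strict_left_mono) auto
          also have "\<dots> \<le> f x * g y"
            using mult_left_mono[OF less_imp_le[OF xy(2)], of "f x"] by (simp add: mult.commute)
          finally show ?thesis .
        qed
        also have "\<dots> \<le> (h ((x + y) / 2))\<^sup>2" by (rule mid)
        finally show "(x + y) / 2 \<in> {x. ennreal s < h x}"
          using power_mono[of "h ((x + y) / 2)" "ennreal s" 2] by (auto simp: not_less[symmetric])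
      qed (use sup[OF s(2)] in auto)
      then show ?thesis using True by simp
    qed simp
  qed
  also have "\<dots> = 2 * (\<integral>\<^sup>+x. min (h x) 1 \<partial>lborel)"
    unfolding layer_cake_min[OF assms(3)] by (rule nn_integral_cmult) measurable
  also have "\<dots> \<le> 2 * (\<integral>\<^sup>+x. h x \<partial>lborel)"
    by (intro mult_left_mono nn_integral_mono) auto
  finally show ?thesis .
qed

lemma four_mult_le: "4 * (x * y) \<le> (x + y)\<^sup>2" for x y :: real
  using zero_le_power2[of "x - y"] by (simp add: power2_eq_square algebra_simps)

text \<open>Dividing \<open>f\<close> and \<open>g\<close> by their suprema \<open>F\<close> and
  \<open>G\<close>, and \<open>h\<close> by \<open>sqrt (F * G)\<close>, preserves the midpoint
  hypothesis; the inequality between arithmetic and geometric mean then undoes the scaling.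
  Boundedness makes \<open>F\<close> and \<open>G\<close> finite.\<close>

lemma prekopa_leindler_1d_bounded:
  fixes f g h :: "real \<Rightarrow> ennreal"
  assumes m[measurable]: "f \<in> borel_measurable borel" "g \<in> borel_measurable borel" "h \<in> borel_measurable borel"
    and bdd: "\<And>x. f x \<le> of_nat n" "\<And>x. g x \<le> of_nat k"
    and mid: "\<And>x y. f x * g y \<le> (h ((x + y) / 2))\<^sup>2"
  shows "(\<integral>\<^sup>+x. f x \<partial>lborel) * (\<integral>\<^sup>+x. g x \<partial>lborel) \<le> (\<integral>\<^sup>+x. h x \<partial>lborel)\<^sup>2"
proof (cases "(\<forall>x. f x = 0) \<or> (\<forall>x. g x = 0) \<or> (\<integral>\<^sup>+x. h x \<partial>lborel) = \<infinity>")
  case True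
  then show ?thesis by (auto simp: power2_eq_square ennreal_mult_top)
next
  case False
  obtain F where F: "(SUP x. f x) = ennreal F" "0 \<le> F"
    using SUP_least[of UNIV f "of_nat n"] bdd(1) 
    by (metis ennreal_cases ennreal_less_top ennreal_of_nat_eq_real_of_nat leD top.not_eq_extremum)
  obtain G where G: "(SUP x. g x) = ennreal G" "0 \<le> G"
    using SUP_least[of UNIV g "of_nat k"] bdd(2) 
    by (metis ennreal_cases ennreal_less_top ennreal_of_nat_eq_real_of_nat leD top.not_eq_extremum)
  have "F > 0"
    using False F by (metis SUP_upper UNIV_I ennreal_0 le_zero_eq order_le_less)
  have "G > 0"
    using False G by (metis SUP_upper UNIV_I ennreal_0 le_zero_eq order_le_less)
  define S where "S = sqrt (F * G)"
  have "S > 0" using \<open>F > 0\<close> \<open>G > 0\<close> by (simp add: S_def)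
  have SS: "S\<^sup>2 = F * G" using \<open>F > 0\<close> \<open>G > 0\<close> by (simp add: S_def)
  have cancel: "ennreal (1 / c) * (ennreal c * z) = z" if "c > 0" for c z
    using that by (simp add: mult.assoc[symmetric] flip: ennreal_mult)
  have "(\<integral>\<^sup>+x. ennreal (1/F) * f x \<partial>lborel) + (\<integral>\<^sup>+x. ennreal (1/G) * g x \<partial>lborel)
      \<le> 2 * (\<integral>\<^sup>+x. ennreal (1/S) * h x \<partial>lborel)"
  proof (rule prekopa_leindler_1d_normalized)
    show "ennreal (1 / F) * f x \<le> 1" for x
      using mult_left_mono[OF SUP_upper[of x UNIV f], of "ennreal (1/F)"] cancel[OF \<open>F>0\<close>, of 1] F(1) by simp
    show "ennreal (1 / G) * g x \<le> 1" for x
      using mult_left_mono[OF SUP_upper[of x UNIV g], of "ennreal (1/G)"] cancel[OF \<open>G>0\<close>, of 1] G(1) by simp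
    show "\<exists>x. s < ennreal (1 / F) * f x" if "s < 1" for s
    proof -
      have "ennreal F * s < ennreal F * 1" using that \<open>F > 0\<close> by (intro ennreal_mult_strict_left_mono) auto
      then obtain x where "ennreal F * s < f x" unfolding F(1)[symmetric] mult_1_right by (auto simp: less_SUP_iff)
      then have "ennreal (1/F) * (ennreal F * s) < ennreal (1/F) * f x"
        using \<open>F > 0\<close> by (intro ennreal_mult_strict_left_mono) auto
      then show ?thesis using cancel[OF \<open>F>0\<close>] by auto
    qed
    show "\<exists>x. s < ennreal (1 / G) * g x" if "s < 1" for s
    proof -
      have "ennreal G * s < ennreal G * 1" using that \<open>G > 0\<close> by (intro ennreal_mult_strict_left_mono) auto
      then obtain x where "ennreal G * s < g x" unfolding G(1)[symmetric] mult_1_right by (auto simp: less_SUP_iff)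
      then have "ennreal (1/G) * (ennreal G * s) < ennreal (1/G) * g x"
        using \<open>G > 0\<close> by (intro ennreal_mult_strict_left_mono) auto
      then show ?thesis using cancel[OF \<open>G>0\<close>] by auto
    qed
    show "ennreal (1 / F) * f x * (ennreal (1 / G) * g y) \<le> (ennreal (1 / S) * h ((x + y) / 2))\<^sup>2" for x y
    proof -
      have "ennreal (1 / F) * f x * (ennreal (1 / G) * g y) = ennreal (1/F) * ennreal (1/G) * (f x * g y)"
        by (simp add: mult_ac)
      also have "ennreal (1/F) * ennreal (1/G) = (ennreal (1/S))\<^sup>2"
        using \<open>F > 0\<close> \<open>G > 0\<close> \<open>S > 0\<close> SS by (simp add: power_one_over ennreal_power flip: ennreal_mult)
      finally show ?thesis using mid[of x y] by (simp add: power_mult_distrib mult_left_mono)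
    qed
  qed measurable
  then have le: "ennreal (1/F) * (\<integral>\<^sup>+x. f x \<partial>lborel) + ennreal (1/G) * (\<integral>\<^sup>+x. g x \<partial>lborel)
      \<le> 2 * (ennreal (1/S) * (\<integral>\<^sup>+x. h x \<partial>lborel))"
    by (simp add: nn_integral_cmult)
  obtain c where c: "(\<integral>\<^sup>+x. h x \<partial>lborel) = ennreal c" "0 \<le> c" using False by (metis ennreal_cases infinity_ennreal_def)
  have fin: "2 * (ennreal (1/S) * (\<integral>\<^sup>+x. h x \<partial>lborel)) = ennreal (2 * (c / S))"
    using c \<open>S>0\<close> ennreal_mult'[of 2 "c / S"] by (simp flip: ennreal_mult)
  have "(\<integral>\<^sup>+x. f x \<partial>lborel) \<noteq> \<infinity>" 
    using le fin \<open>F > 0\<close> by (auto simp: ennreal_mult_top top_unique)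
  then obtain a where a: "(\<integral>\<^sup>+x. f x \<partial>lborel) = ennreal a" "0 \<le> a" by (metis ennreal_cases infinity_ennreal_def)
  have "(\<integral>\<^sup>+x. g x \<partial>lborel) \<noteq> \<infinity>" 
    using le fin \<open>G > 0\<close> by (auto simp: ennreal_mult_top top_unique)
  then obtain b where b: "(\<integral>\<^sup>+x. g x \<partial>lborel) = ennreal b" "0 \<le> b" by (metis ennreal_cases infinity_ennreal_def)
  have "ennreal (a / F + b / G) \<le> ennreal (2 * (c / S))"
    using le a b \<open>F > 0\<close> \<open>G > 0\<close> unfolding fin by (simp flip: ennreal_mult ennreal_plus)
  then have r: "a / F + b / G \<le> 2 * (c / S)"
    using c \<open>S > 0\<close> by (subst (asm) ennreal_le_iff) auto
  have "4 * ((a / F) * (b / G)) \<le> (a / F + b / G)\<^sup>2"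
    using four_mult_le[of "a / F" "b / G"] .
  also have "\<dots> \<le> (2 * (c / S))\<^sup>2" using r a b \<open>F > 0\<close> \<open>G > 0\<close> by (intro power_mono) auto
  also have "\<dots> = 4 * (c\<^sup>2 / (F * G))" by (simp add: power_divide power_mult_distrib SS)
  finally have "a * b \<le> c\<^sup>2" using \<open>F > 0\<close> \<open>G > 0\<close> by (simp add: field_simps)
  then show ?thesis unfolding a b c using a b c by (simp add: ennreal_power flip: ennreal_mult)
qed

lemma nn_integral_SUP_min_of_nat:
  fixes f :: "real \<Rightarrow> ennreal"
  assumes [measurable]: "f \<in> borel_measurable borel"
  shows "(\<integral>\<^sup>+x. f x \<partial>lborel) = (SUP n. \<integral>\<^sup>+x. min (f x) (of_nat n) \<partial>lborel)"
proof -
  have "f x = (SUP n. min (f x) (of_nat n))" for x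
  proof (rule antisym[OF _ SUP_least])
    show "f x \<le> (SUP n. min (f x) (of_nat n))"
    proof (cases "f x = \<infinity>")
      case True
      then show ?thesis by (simp add: ennreal_SUP_of_nat_eq_top)
    next
      case False
      then obtain n where "f x \<le> of_nat n" 
        by (metis ennreal_Ex_less_of_nat infinity_ennreal_def less_imp_le top.not_eq_extremum)
      then show ?thesis by (intro SUP_upper2[of n]) auto
    qed
  qed auto
  then have "(\<integral>\<^sup>+x. f x \<partial>lborel) = (\<integral>\<^sup>+x. (SUP n. min (f x) (of_nat n)) \<partial>lborel)" by simp
  also have "\<dots> = (SUP n. \<integral>\<^sup>+x. min (f x) (of_nat n) \<partial>lborel)"
    by (intro nn_integral_monotone_convergence_SUP)
       (auto simp: incseq_def le_fun_def intro: min.coboundedI2)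
  finally show ?thesis .
qed

lemma prekopa_leindler_1d:
  fixes f g h :: "real \<Rightarrow> ennreal"
  assumes m[measurable]: "f \<in> borel_measurable borel" "g \<in> borel_measurable borel" "h \<in> borel_measurable borel"
    and mid: "\<And>x y. f x * g y \<le> (h ((x + y) / 2))\<^sup>2"
  shows "(\<integral>\<^sup>+x. f x \<partial>lborel) * (\<integral>\<^sup>+x. g x \<partial>lborel) \<le> (\<integral>\<^sup>+x. h x \<partial>lborel)\<^sup>2"
proof -
  have "(\<integral>\<^sup>+x. min (f x) (of_nat n) \<partial>lborel) * (\<integral>\<^sup>+x. min (g x) (of_nat k) \<partial>lborel)
      \<le> (\<integral>\<^sup>+x. h x \<partial>lborel)\<^sup>2" for n k
    by (rule prekopa_leindler_1d_bounded[where n=n and k=k])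
       (auto intro!: order_trans[OF mult_mono mid])
  then show ?thesis
    unfolding nn_integral_SUP_min_of_nat[OF m(1)] nn_integral_SUP_min_of_nat[OF m(2)]
    by (simp add: SUP_mult_left_ennreal SUP_mult_right_ennreal) (intro SUP_least, simp)
qed

text \<open>Induction on the coordinates: slices of \<open>f\<close> and \<open>g\<close> at values
  \<open>s\<close> and \<open>r\<close> of the new coordinate, together with the slice of
  \<open>h\<close> at \<open>(s + r) / 2\<close>, satisfy the hypothesis in the lower dimension.
  Their integrals therefore satisfy it on the line. The square on the right avoids square roots in
  \<open>ennreal\<close>.\<close>

theorem prekopa_leindler:
  fixes f g h :: "('i \<Rightarrow> real) \<Rightarrow> ennreal"
  assumes "finite I"
    and "f \<in> borel_measurable (Pi\<^sub>M I (\<lambda>_. lborel))" "g \<in> borel_measurable (Pi\<^sub>M I (\<lambda>_. lborel))"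
      "h \<in> borel_measurable (Pi\<^sub>M I (\<lambda>_. lborel))"
    and "\<And>x y. x \<in> I \<rightarrow>\<^sub>E UNIV \<Longrightarrow> y \<in> I \<rightarrow>\<^sub>E UNIV \<Longrightarrow> f x * g y \<le> (h (\<lambda>i\<in>I. (x i + y i) / 2))\<^sup>2"
  shows "(\<integral>\<^sup>+x. f x \<partial>Pi\<^sub>M I (\<lambda>_. lborel)) * (\<integral>\<^sup>+x. g x \<partial>Pi\<^sub>M I (\<lambda>_. lborel))
    \<le> (\<integral>\<^sup>+x. h x \<partial>Pi\<^sub>M I (\<lambda>_. lborel))\<^sup>2"
  using assms
proof (induction I arbitrary: f g h rule: finite_induct)
  case empty
  interpret product_sigma_finite "\<lambda>_::'i. lborel :: real measure" ..
  have "f (\<lambda>_. undefined) * g (\<lambda>_. undefined) \<le> (h (\<lambda>_. undefined))\<^sup>2"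
    using empty.prems(4)[of "\<lambda>_. undefined" "\<lambda>_. undefined"] by (simp add: restrict_def)
  then show ?case by (simp add: nn_integral_empty)
next
  case (insert i I)
  interpret product_sigma_finite "\<lambda>_::'i. lborel :: real measure" ..
  note m = insert.prems(1-3)
  have up: "(\<lambda>x. F (x(i := s))) \<in> borel_measurable (Pi\<^sub>M I (\<lambda>_. lborel))"
    if "F \<in> borel_measurable (Pi\<^sub>M (insert i I) (\<lambda>_. lborel))" for F :: "('i \<Rightarrow> real) \<Rightarrow> ennreal" and s :: real
    by (rule measurable_compose[OF measurable_fun_upd that]) auto
  have sl: "(\<lambda>s. \<integral>\<^sup>+x. F (x(i := s)) \<partial>Pi\<^sub>M I (\<lambda>_. lborel)) \<in> borel_measurable borel"
    if [measurable]: "F \<in> borel_measurable (Pi\<^sub>M (insert i I) (\<lambda>_. lborel))" for F :: "('i \<Rightarrow> real) \<Rightarrow> ennreal"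
  proof -
    interpret sigma_finite_measure "Pi\<^sub>M I (\<lambda>_::'i. lborel :: real measure)" by (rule sigma_finite[OF insert(1)])
    have "(\<lambda>(s, x). F (x(i := s))) \<in> borel_measurable (lborel \<Otimes>\<^sub>M Pi\<^sub>M I (\<lambda>_. lborel))"
      unfolding split_beta' by (rule measurable_compose[OF _ that]) (rule measurable_fun_upd[of _ I], auto)
    then show ?thesis using borel_measurable_nn_integral by simp
  qed
  show ?case
    unfolding product_nn_integral_insert_rev[OF insert(1,2) m(1)] product_nn_integral_insert_rev[OF insert(1,2) m(2)]
      product_nn_integral_insert_rev[OF insert(1,2) m(3)]
  proof (rule prekopa_leindler_1d)
    fix s r :: real
    show "(\<integral>\<^sup>+x. f (x(i := s)) \<partial>Pi\<^sub>M I (\<lambda>_. lborel)) * (\<integral>\<^sup>+x. g (x(i := r)) \<partial>Pi\<^sub>M I (\<lambda>_. lborel))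
        \<le> (\<integral>\<^sup>+x. h (x(i := (s + r) / 2)) \<partial>Pi\<^sub>M I (\<lambda>_. lborel))\<^sup>2"
    proof (rule insert.IH)
      fix x y :: "'i \<Rightarrow> real" assume xy: "x \<in> I \<rightarrow>\<^sub>E UNIV" "y \<in> I \<rightarrow>\<^sub>E UNIV"
      have "(\<lambda>j\<in>insert i I. ((x(i := s)) j + (y(i := r)) j) / 2) = (\<lambda>j\<in>I. (x j + y j) / 2)(i := (s + r) / 2)"
        using insert(2) by (auto simp: fun_eq_iff restrict_def)
      moreover have "x(i := s) \<in> insert i I \<rightarrow>\<^sub>E UNIV" "y(i := r) \<in> insert i I \<rightarrow>\<^sub>E UNIV"
        using xy by (auto simp: PiE_def extensional_def)
      ultimately show "f (x(i := s)) * g (y(i := r)) \<le> (h ((\<lambda>j\<in>I. (x j + y j) / 2)(i := (s + r) / 2)))\<^sup>2"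
        using insert.prems(4)[of "x(i := s)" "y(i := r)"] by (simp only: fun_upd_same)
    qed (rule up, fact m)+
  qed (use sl m in auto)
qed

section \<open>Euclidean distance and affine maps on product spaces\<close>

text \<open>Only coordinates below \<open>d\<close> count, so arguments need not be extensional; the
  zero function and \<open>\<lambda>i. f * y i\<close> are used as points.\<close>

definition rdist :: "nat \<Rightarrow> vec \<Rightarrow> vec \<Rightarrow> real" where
  "rdist d x y = Rd_norm d (\<lambda>i. x i - y i)"

lemma rdist_nonneg [simp]: "0 \<le> rdist d x y"
  by (simp add: rdist_def)

lemma rdist_commute: "rdist d x y = rdist d y x"
  by (simp add: rdist_def L2_set_def power2_commute)

lemma rdist_triangle: "rdist d x z \<le> rdist d x y + rdist d y z"
  using L2_set_triangle_ineq[of "\<lambda>i. x i - y i" "\<lambda>i. y i - z i" "{..<d}"] by (simp add: rdist_def)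

lemma rdist_lipschitz: "\<bar>rdist d x z - rdist d y z\<bar> \<le> rdist d x y"
  using rdist_triangle[of d x z y] rdist_triangle[of d y z x] rdist_commute[of d x y] by (auto simp: abs_if)

lemma rdist_sq: "(rdist d x y)\<^sup>2 = (\<Sum>i<d. (x i - y i)\<^sup>2)"
  by (simp add: rdist_def L2_set_def sum_nonneg)

lemma rdist_zero: "rdist d x (\<lambda>_. 0) = Rd_norm d x"
  by (simp add: rdist_def)

lemma Rd_norm_sq: "(Rd_norm d x)\<^sup>2 = (\<Sum>i<d. (x i)\<^sup>2)"
  by (simp add: L2_set_def sum_nonneg)

lemma Rd_norm_le_rdist: "Rd_norm d x \<le> rdist d x y + Rd_norm d y"
  using rdist_triangle[of d x "\<lambda>_. 0" y] by (simp add: rdist_zero)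

lemma abs_component_le_norm: "i < d \<Longrightarrow> \<bar>x i\<bar> \<le> Rd_norm d x"
  using member_le_L2_set[of "{..<d}" i "\<lambda>i. \<bar>x i\<bar>"] by (simp add: L2_set_def)

lemma inner_le_norm: "\<bar>\<Sum>i<d. e i * x i\<bar> \<le> Rd_norm d e * Rd_norm d x"
  by (rule order_trans[OF sum_abs]) (simp add: abs_mult L2_set_mult_ineq)

lemma inner_lipschitz: "\<bar>(\<Sum>i<d. e i * x i) - (\<Sum>i<d. e i * y i)\<bar> \<le> Rd_norm d e * rdist d x y"
  using inner_le_norm[of e "\<lambda>i. x i - y i" d] by (simp add: rdist_def sum_subtractf[symmetric] right_diff_distrib)

lemma measurable_rdist [measurable]: "(\<lambda>y. rdist d y c) \<in> borel_measurable (Rd_lborel d)"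
  unfolding rdist_def L2_set_def by measurable

lemma measurable_Rd_norm [measurable]: "(\<lambda>y. Rd_norm d y) \<in> borel_measurable (Rd_lborel d)"
  unfolding L2_set_def by measurable

definition midpt :: "nat \<Rightarrow> vec \<Rightarrow> vec \<Rightarrow> vec" where
  "midpt d x y = (\<lambda>i\<in>{..<d}. (x i + y i) / 2)"

lemma midpt_in_Rd [simp]: "midpt d x y \<in> Rd d"
  by (simp add: midpt_def)

lemma rdist_midpt: "rdist d (midpt d x y) x = rdist d x y / 2" "rdist d (midpt d x y) y = rdist d x y / 2"
proof -
  have "(rdist d (midpt d x y) x)\<^sup>2 = (rdist d x y / 2)\<^sup>2" "(rdist d (midpt d x y) y)\<^sup>2 = (rdist d x y / 2)\<^sup>2"
    unfolding power_divide rdist_sq sum_divide_distrib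
    by (intro sum.cong; simp add: midpt_def power2_eq_square field_simps)+
  then show "rdist d (midpt d x y) x = rdist d x y / 2" "rdist d (midpt d x y) y = rdist d x y / 2"
    by (simp_all add: power2_eq_iff_nonneg)
qed

text \<open>Each coordinate contributes one factor \<open>s\<close>. It serves the contraction that
  locates the mean, dilations of a convex set about an interior point, and the passage from the
  noise to the observation.\<close>

lemma nn_integral_PiM_affine:
  fixes f :: "('i \<Rightarrow> real) \<Rightarrow> ennreal" and c :: "'i \<Rightarrow> real"
  assumes "finite I" and "s > 0" and "f \<in> borel_measurable (Pi\<^sub>M I (\<lambda>_. lborel))"
  shows "(\<integral>\<^sup>+x. f x \<partial>Pi\<^sub>M I (\<lambda>_. lborel))
    = ennreal (s ^ card I) * (\<integral>\<^sup>+x. f (\<lambda>i\<in>I. c i + s * x i) \<partial>Pi\<^sub>M I (\<lambda>_. lborel))"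
  using assms(1,3)
proof (induction I arbitrary: f rule: finite_induct)
  case empty
  interpret product_sigma_finite "\<lambda>_::'i. lborel :: real measure" ..
  show ?case by (simp add: PiM_empty restrict_def nn_integral_count_space_finite)
next
  case (insert i I)
  interpret product_sigma_finite "\<lambda>_::'i. lborel :: real measure" ..
  interpret sf: sigma_finite_measure "Pi\<^sub>M I (\<lambda>_::'i. lborel :: real measure)" by (rule sigma_finite[OF insert(1)])
  note [measurable] = insert.prems
  define T where "T x = (\<lambda>j\<in>I. c j + s * x j)" for x
  have T[measurable]: "T \<in> measurable (Pi\<^sub>M I (\<lambda>_. lborel)) (Pi\<^sub>M I (\<lambda>_. lborel))"
    unfolding T_def by (rule measurable_restrict) simp
  have up: "(\<lambda>(y, x). F (x(i := y))) \<in> borel_measurable (lborel \<Otimes>\<^sub>M Pi\<^sub>M I (\<lambda>_. lborel))"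
    if "F \<in> borel_measurable (Pi\<^sub>M (insert i I) (\<lambda>_. lborel))" for F :: "('i \<Rightarrow> real) \<Rightarrow> ennreal"
    unfolding split_beta' by (rule measurable_compose[OF _ that]) (rule measurable_fun_upd[of _ I], auto)
  have upc: "(\<lambda>x. f (x(i := y))) \<in> borel_measurable (Pi\<^sub>M I (\<lambda>_. lborel))" for y
    by (rule measurable_compose[OF measurable_fun_upd insert.prems]) auto
  have upT: "(\<lambda>(y, x). f ((T x)(i := y))) \<in> borel_measurable (borel \<Otimes>\<^sub>M Pi\<^sub>M I (\<lambda>_. lborel))"
    using measurable_compose[OF _ up[OF insert.prems], of "\<lambda>(y, x). (y, T x)" "borel \<Otimes>\<^sub>M Pi\<^sub>M I (\<lambda>_. lborel)"]
    by (simp add: split_beta')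
  have F: "(\<lambda>y. \<integral>\<^sup>+x. f ((T x)(i := y)) \<partial>Pi\<^sub>M I (\<lambda>_. lborel)) \<in> borel_measurable borel"
    using sf.borel_measurable_nn_integral[OF upT] by simp
  have "(\<integral>\<^sup>+x. f x \<partial>Pi\<^sub>M (insert i I) (\<lambda>_. lborel))
      = (\<integral>\<^sup>+y. (\<integral>\<^sup>+x. f (x(i := y)) \<partial>Pi\<^sub>M I (\<lambda>_. lborel)) \<partial>lborel)"
    by (rule product_nn_integral_insert_rev[OF insert(1,2) insert.prems])
  also have "\<dots> = (\<integral>\<^sup>+y. ennreal (s ^ card I) * (\<integral>\<^sup>+x. f ((T x)(i := y)) \<partial>Pi\<^sub>M I (\<lambda>_. lborel)) \<partial>lborel)"
    unfolding T_def by (intro nn_integral_cong insert.IH upc)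
  also have "\<dots> = ennreal (s ^ card I) * (\<integral>\<^sup>+y. (\<integral>\<^sup>+x. f ((T x)(i := y)) \<partial>Pi\<^sub>M I (\<lambda>_. lborel)) \<partial>lborel)"
    using F by (intro nn_integral_cmult) simp
  also have "(\<integral>\<^sup>+y. (\<integral>\<^sup>+x. f ((T x)(i := y)) \<partial>Pi\<^sub>M I (\<lambda>_. lborel)) \<partial>lborel)
      = ennreal s * (\<integral>\<^sup>+y. (\<integral>\<^sup>+x. f ((T x)(i := c i + s * y)) \<partial>Pi\<^sub>M I (\<lambda>_. lborel)) \<partial>lborel)"
    using \<open>s > 0\<close> by (subst nn_integral_real_affine[OF F, where c=s and t="c i"]) auto
  also have "ennreal (s ^ card I) * (ennreal s * (\<integral>\<^sup>+y. (\<integral>\<^sup>+x. f ((T x)(i := c i + s * y)) \<partial>Pi\<^sub>M I (\<lambda>_. lborel)) \<partial>lborel))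
     = ennreal (s ^ card (insert i I)) * (\<integral>\<^sup>+y. (\<integral>\<^sup>+x. f ((T x)(i := c i + s * y)) \<partial>Pi\<^sub>M I (\<lambda>_. lborel)) \<partial>lborel)"
    using insert(1,2) \<open>s > 0\<close> by (simp add: mult.assoc[symmetric] mult.commute flip: ennreal_mult)
  also have "(\<lambda>y. \<integral>\<^sup>+x. f ((T x)(i := c i + s * y)) \<partial>Pi\<^sub>M I (\<lambda>_. lborel))
      = (\<lambda>y. \<integral>\<^sup>+x. f (\<lambda>j\<in>insert i I. c j + s * (x(i := y)) j) \<partial>Pi\<^sub>M I (\<lambda>_. lborel))"
    using insert(2) unfolding T_def
    by (intro ext nn_integral_cong arg_cong[where f=f]) (auto simp: fun_eq_iff restrict_def)
  also have "(\<integral>\<^sup>+y. (\<integral>\<^sup>+x. f (\<lambda>j\<in>insert i I. c j + s * (x(i := y)) j) \<partial>Pi\<^sub>M I (\<lambda>_. lborel)) \<partial>lborel)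
      = (\<integral>\<^sup>+x. f (\<lambda>j\<in>insert i I. c j + s * x j) \<partial>Pi\<^sub>M (insert i I) (\<lambda>_. lborel))"
    by (rule product_nn_integral_insert_rev[OF insert(1,2), symmetric]) measurable
  finally show ?case .
qed

section \<open>Concentration for weakly log-concave densities\<close>

text \<open>Rests on \<open>(1 + z / n) ^ n \<le> exp z\<close>, applied to the absolute value. The
  constants 4 = 2^2 and 256 = 4^4 of the two special cases become the 8 and 512 of the moment
  bounds.\<close>

lemma even_power_le_exp:
  fixes z :: real
  assumes "even n" "0 < n"
  shows "z ^ n \<le> real n ^ n * (exp z + exp (- z))"
proof -
  have "\<bar>z\<bar> ^ n = real n ^ n * (\<bar>z\<bar> / n) ^ n" using assms by (simp add: power_divide)
  also have "\<dots> \<le> real n ^ n * (1 + \<bar>z\<bar> / n) ^ n" by (intro mult_left_mono power_mono) auto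
  also have "\<dots> \<le> real n ^ n * exp \<bar>z\<bar>"
    using exp_ge_one_plus_x_over_n_power_n[of n "\<bar>z\<bar>"] assms by (intro mult_left_mono) auto
  also have "\<dots> \<le> real n ^ n * (exp z + exp (- z))"
    by (intro mult_left_mono) (auto simp: abs_if)
  finally show ?thesis using assms by (simp add: power_even_abs)
qed

lemma power2_le_exp: "z\<^sup>2 \<le> 4 * (exp z + exp (- z))" for z :: real
  using even_power_le_exp[of 2 z] by simp

lemma power4_le_exp: "z ^ 4 \<le> 256 * (exp z + exp (- z))" for z :: real
  using even_power_le_exp[of 4 z] by simp

lemma one_plus_power_le_exp:
  fixes N :: real assumes "0 \<le> N" "0 < k"
  shows "(1 + N) ^ k \<le> real k ^ k * exp N"
proof -
  have "(1 + N) ^ k \<le> (real k * (1 + N / real k)) ^ k"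
    using assms by (intro power_mono) (auto simp: field_simps)
  also have "\<dots> = real k ^ k * (1 + N / real k) ^ k" by (simp add: power_mult_distrib)
  also have "\<dots> \<le> real k ^ k * exp N"
    using exp_ge_one_plus_x_over_n_power_n[of k N] assms by (intro mult_left_mono) auto
  finally show ?thesis .
qed

lemma linear_quadratic_le: "b * r - L * r\<^sup>2 / 4 \<le> b\<^sup>2 / L" if "L > 0" for b r L :: real
proof -
  have "0 \<le> (L * r / 2 - b)\<^sup>2" by simp
  then have "L * (b * r) - L * (L * r\<^sup>2 / 4) \<le> b\<^sup>2" by (simp add: power2_eq_square algebra_simps)
  then show ?thesis using that by (simp add: field_simps power2_eq_square)
qed

lemma integrable_square_product:
  fixes X Y :: "'a \<Rightarrow> real"
  assumes [measurable]: "X \<in> borel_measurable M" "Y \<in> borel_measurable M"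
    and "integrable M (\<lambda>x. (X x)\<^sup>2)" "integrable M (\<lambda>x. (Y x)\<^sup>2)"
  shows "integrable M (\<lambda>x. X x * Y x)"
proof (rule Bochner_Integration.integrable_bound)
  show "integrable M (\<lambda>x. (X x)\<^sup>2 + (Y x)\<^sup>2)" using assms by simp
  show "AE x in M. norm (X x * Y x) \<le> norm ((X x)\<^sup>2 + (Y x)\<^sup>2)"
  proof (rule AE_I2)
    fix x
    have "2 * (\<bar>X x\<bar> * \<bar>Y x\<bar>) \<le> (X x)\<^sup>2 + (Y x)\<^sup>2"
      using zero_le_power2[of "\<bar>X x\<bar> - \<bar>Y x\<bar>"] by (simp add: power2_eq_square algebra_simps)
    then show "norm (X x * Y x) \<le> norm ((X x)\<^sup>2 + (Y x)\<^sup>2)" 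
      using mult_nonneg_nonneg[of "\<bar>X x\<bar>" "\<bar>Y x\<bar>"] unfolding real_norm_def abs_mult by linarith
  qed
qed simp

lemma integral_product_le_of_squares:
  fixes X Y :: "'a \<Rightarrow> real"
  assumes [measurable]: "X \<in> borel_measurable M" "Y \<in> borel_measurable M"
    and int: "integrable M (\<lambda>x. (X x)\<^sup>2)" "integrable M (\<lambda>x. (Y x)\<^sup>2)"
    and le: "(\<integral>x. (X x)\<^sup>2 \<partial>M) \<le> a\<^sup>2" "(\<integral>x. (Y x)\<^sup>2 \<partial>M) \<le> b\<^sup>2" and ab: "0 \<le> a" "0 \<le> b"
  shows "\<bar>\<integral>x. X x * Y x \<partial>M\<bar> \<le> a * b"
proof -
  have iXY: "integrable M (\<lambda>x. X x * Y x)" by (rule integrable_square_product) fact+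
  have "(ennreal \<bar>\<integral>x. X x * Y x \<partial>M\<bar>)\<^sup>2 \<le> (\<integral>\<^sup>+x. ennreal \<bar>X x\<bar> * ennreal \<bar>Y x\<bar> \<partial>M)\<^sup>2"
  proof (rule power_mono)
    have "ennreal \<bar>\<integral>x. X x * Y x \<partial>M\<bar> \<le> ennreal (\<integral>x. \<bar>X x * Y x\<bar> \<partial>M)"
      using integral_norm_bound[of M "\<lambda>x. X x * Y x"] by (simp add: ennreal_leI)
    also have "\<dots> = (\<integral>\<^sup>+x. ennreal \<bar>X x * Y x\<bar> \<partial>M)"
      by (rule nn_integral_eq_integral[symmetric]) (use iXY in auto)
    finally show "ennreal \<bar>\<integral>x. X x * Y x \<partial>M\<bar> \<le> (\<integral>\<^sup>+x. ennreal \<bar>X x\<bar> * ennreal \<bar>Y x\<bar> \<partial>M)"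
      by (simp add: abs_mult ennreal_mult)
  qed simp
  also have "\<dots> \<le> (\<integral>\<^sup>+x. (ennreal \<bar>X x\<bar>)\<^sup>2 \<partial>M) * (\<integral>\<^sup>+x. (ennreal \<bar>Y x\<bar>)\<^sup>2 \<partial>M)"
    by (rule Cauchy_Schwarz_nn_integral) measurable
  also have "(\<integral>\<^sup>+x. (ennreal \<bar>X x\<bar>)\<^sup>2 \<partial>M) = ennreal (\<integral>x. (X x)\<^sup>2 \<partial>M)"
    using int(1) by (simp add: ennreal_power nn_integral_eq_integral)
  also have "(\<integral>\<^sup>+x. (ennreal \<bar>Y x\<bar>)\<^sup>2 \<partial>M) = ennreal (\<integral>x. (Y x)\<^sup>2 \<partial>M)"
    using int(2) by (simp add: ennreal_power nn_integral_eq_integral)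
  also have "ennreal (\<integral>x. (X x)\<^sup>2 \<partial>M) * ennreal (\<integral>x. (Y x)\<^sup>2 \<partial>M) \<le> ennreal (a\<^sup>2) * ennreal (b\<^sup>2)"
    using le by (intro mult_mono ennreal_leI) auto
  also have "\<dots> = ennreal ((a * b)\<^sup>2)" by (simp add: power_mult_distrib flip: ennreal_mult)
  finally have "\<bar>\<integral>x. X x * Y x \<partial>M\<bar>\<^sup>2 \<le> (a * b)\<^sup>2" by (simp add: ennreal_power)
  then show ?thesis by (rule power2_le_imp_le) (use ab in simp)
qed

text \<open>Strong convexity of \<open>u\<close> together with \<open>\<bar>a x - a y\<bar> \<le> K * (1 + \<parallel>x - y\<parallel>)\<close> gives the midpoint condition
  below. It survives multiplication by a Gaussian weight (with a larger \<open>L\<close>), and it is the only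
  information on the density that the concentration estimates use.\<close>

locale wlc_density =
  fixes d :: nat and L K :: real and P :: "vec \<Rightarrow> real"
  assumes L_pos: "0 < L" and K_nonneg: "0 \<le> K"
    and measurable_P [measurable]: "P \<in> borel_measurable (Rd_lborel d)"
    and P_nonneg: "\<And>x. 0 \<le> P x"
    and P_midpt: "\<And>x y. x \<in> Rd d \<Longrightarrow> y \<in> Rd d \<Longrightarrow>
      P x * P y * exp (L * (rdist d x y)\<^sup>2 / 4) \<le> exp (2 * K + K * rdist d x y) * (P (midpt d x y))\<^sup>2"
    and P_int: "(\<integral>\<^sup>+x. ennreal (P x) \<partial>Rd_lborel d) = 1"
begin

definition \<nu> :: "vec measure" where
  "\<nu> = density (Rd_lborel d) (\<lambda>x. ennreal (P x))"

lemma sets_\<nu> [simp, measurable_cong]: "sets \<nu> = sets (Rd_lborel d)"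
  by (simp add: \<nu>_def)

lemma space_\<nu> [simp]: "space \<nu> = Rd d"
  by (simp add: \<nu>_def space_PiM)

sublocale prob_space \<nu>
  by (rule prob_spaceI) (simp add: \<nu>_def emeasure_density P_int cong: nn_integral_cong)

lemma prob_Rd [simp]: "prob (Rd d) = 1"
  using prob_space by simp

text \<open>Prekopa-Leindler with a multiple of \<open>P\<close> itself as third function: the two
  weights are inverse to each other, so only \<open>F x - F y\<close> remains. The exponent
  \<open>(K + b)^2 / L\<close> is the maximum over \<open>r\<close> of the linear loss
  \<open>(K + b) * r\<close> minus the convexity gain \<open>L * r^2 / 4\<close>.\<close>

lemma exp_product_bound:
  assumes [measurable]: "F \<in> borel_measurable (Rd_lborel d)" and b: "0 \<le> b"
    and lip: "\<And>x y. x \<in> Rd d \<Longrightarrow> y \<in> Rd d \<Longrightarrow> \<bar>F x - F y\<bar> \<le> b * rdist d x y"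
  shows "(\<integral>\<^sup>+x. ennreal (exp (F x)) \<partial>\<nu>) * (\<integral>\<^sup>+x. ennreal (exp (- F x)) \<partial>\<nu>)
    \<le> ennreal (exp (2 * K + (K + b)\<^sup>2 / L))"
proof -
  let ?c = "exp (K + (K + b)\<^sup>2 / (2 * L))"
  have "(\<integral>\<^sup>+x. ennreal (P x * exp (F x)) \<partial>Rd_lborel d) * (\<integral>\<^sup>+x. ennreal (P x * exp (- F x)) \<partial>Rd_lborel d)
      \<le> (\<integral>\<^sup>+x. ennreal (?c * P x) \<partial>Rd_lborel d)\<^sup>2"
  proof (rule prekopa_leindler)
    fix x y :: vec assume xy: "x \<in> Rd d" "y \<in> Rd d"
    let ?r = "rdist d x y"
    have "P x * exp (F x) * (P y * exp (- F y)) = P x * P y * exp (F x - F y)"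
      by (simp add: mult_exp_exp exp_diff exp_minus field_simps)
    also have "\<dots> \<le> P x * P y * exp (b * ?r)"
      using lip[OF xy] by (intro mult_left_mono mult_nonneg_nonneg P_nonneg) auto
    also have "\<dots> = P x * P y * exp (L * ?r\<^sup>2 / 4) * exp (b * ?r - L * ?r\<^sup>2 / 4)"
      by (simp add: mult_exp_exp mult.assoc)
    also have "\<dots> \<le> exp (2 * K + K * ?r) * (P (midpt d x y))\<^sup>2 * exp (b * ?r - L * ?r\<^sup>2 / 4)"
      by (intro mult_right_mono P_midpt xy) auto
    also have "\<dots> = (P (midpt d x y))\<^sup>2 * exp (2 * K + ((K + b) * ?r - L * ?r\<^sup>2 / 4))"
      by (simp add: exp_add[symmetric] distrib_right algebra_simps)
    also have "\<dots> \<le> (P (midpt d x y))\<^sup>2 * exp (2 * K + (K + b)\<^sup>2 / L)"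
      using linear_quadratic_le[OF L_pos, of "K + b" ?r] by (intro mult_left_mono) auto
    also have "\<dots> = (?c * P (midpt d x y))\<^sup>2"
      by (simp add: power_mult_distrib exp_double[symmetric] algebra_simps)
    finally have "P x * exp (F x) * (P y * exp (- F y)) \<le> (?c * P (midpt d x y))\<^sup>2" .
    then show "ennreal (P x * exp (F x)) * ennreal (P y * exp (- F y))
        \<le> (ennreal (?c * P (\<lambda>i\<in>{..<d}. (x i + y i) / 2)))\<^sup>2"
      by (simp add: ennreal_power P_nonneg midpt_def ennreal_leI flip: ennreal_mult)
  qed auto
  also have "(\<integral>\<^sup>+x. ennreal (?c * P x) \<partial>Rd_lborel d) = ennreal ?c"
    by (simp add: ennreal_mult P_nonneg nn_integral_cmult P_int)
  also have "(ennreal ?c)\<^sup>2 = ennreal (exp (2 * K + (K + b)\<^sup>2 / L))"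
    by (simp add: ennreal_power exp_double[symmetric] algebra_simps)
  finally show ?thesis
    by (simp add: \<nu>_def nn_integral_density ennreal_mult P_nonneg)
qed

text \<open>The product of both exponential moments is finite. Because zero times infinity is zero
  in \<open>ennreal\<close>, the moment of \<open>- F\<close> must be seen to be nonzero before the
  moment of \<open>F\<close> is known to be finite.\<close>

lemma integrable_exp_lipschitz:
  assumes [measurable]: "F \<in> borel_measurable (Rd_lborel d)" and b: "0 \<le> b"
    and lip: "\<And>x y. x \<in> Rd d \<Longrightarrow> y \<in> Rd d \<Longrightarrow> \<bar>F x - F y\<bar> \<le> b * rdist d x y"
  shows "integrable \<nu> (\<lambda>x. exp (F x))"
proof -
  have "(\<integral>\<^sup>+x. ennreal (exp (- F x)) \<partial>\<nu>) \<noteq> 0"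
  proof
    assume "(\<integral>\<^sup>+x. ennreal (exp (- F x)) \<partial>\<nu>) = 0"
    then have "AE x in \<nu>. False" by (subst (asm) nn_integral_0_iff_AE) auto
    then show False by simp
  qed
  then have "(\<integral>\<^sup>+x. ennreal (exp (F x)) \<partial>\<nu>) \<noteq> \<infinity>"
    using exp_product_bound[OF assms] by (auto simp: ennreal_top_mult top_unique)
  then show ?thesis by (intro integrableI_nonneg) (auto simp: top.not_eq_extremum)
qed

text \<open>The norm is 1-Lipschitz and hence has an exponential moment, which dominates every
  polynomial. \<open>Suc k\<close> covers the exponent zero, excluded in
  \<open>one_plus_power_le_exp\<close>.\<close>

lemma integrable_poly:
  assumes [measurable]: "h \<in> borel_measurable (Rd_lborel d)"
    and "\<And>y. y \<in> Rd d \<Longrightarrow> \<bar>h y\<bar> \<le> C * (1 + Rd_norm d y) ^ k"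
  shows "integrable \<nu> h"
proof (rule Bochner_Integration.integrable_bound)
  have "integrable \<nu> (\<lambda>y. exp (Rd_norm d y))"
    by (rule integrable_exp_lipschitz[where b=1])
       (use rdist_lipschitz[of d _ "\<lambda>_. 0"] in \<open>auto simp: rdist_zero\<close>)
  then show "integrable \<nu> (\<lambda>y. \<bar>C\<bar> * (real (Suc k) ^ Suc k * exp (Rd_norm d y)))" by simp
  show "AE y in \<nu>. norm (h y) \<le> norm (\<bar>C\<bar> * (real (Suc k) ^ Suc k * exp (Rd_norm d y)))"
  proof (rule AE_I2)
    fix y assume "y \<in> space \<nu>"
    then have "\<bar>h y\<bar> \<le> C * (1 + Rd_norm d y) ^ k" using assms(2) by simp
    also have "\<dots> \<le> \<bar>C\<bar> * (1 + Rd_norm d y) ^ k" by (intro mult_right_mono) auto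
    also have "\<dots> \<le> \<bar>C\<bar> * (1 + Rd_norm d y) ^ Suc k"
      by (intro mult_left_mono power_increasing) auto
    also have "\<dots> \<le> \<bar>C\<bar> * (real (Suc k) ^ Suc k * exp (Rd_norm d y))"
      by (intro mult_left_mono one_plus_power_le_exp) auto
    finally show "norm (h y) \<le> norm (\<bar>C\<bar> * (real (Suc k) ^ Suc k * exp (Rd_norm d y)))"
      by (auto simp: abs_mult)
  qed
qed simp

text \<open>The bound of \<open>exp_product_bound\<close> at Lipschitz constant
  \<open>sqrt L\<close>, the scale at which a 1-Lipschitz function has fluctuations of order one. It
  stays bounded as \<open>L\<close> grows, which matters because the curvature of the posterior may
  be arbitrarily large.\<close>

definition c1 :: real where "c1 = exp (2 * K + (K + sqrt L)\<^sup>2 / L)"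

lemma c1_ge_1: "1 \<le> c1"
  using K_nonneg L_pos by (simp add: c1_def)

text \<open>After scaling by \<open>sqrt L\<close> and centering, both exponential moments are at
  least 1 by Jensen, so the bound \<open>c1\<close> on their product bounds each one. Powers are
  dominated by \<open>exp z + exp (- z)\<close>, whose expectation is at most
  \<open>2 * c1\<close>.\<close>

lemma lipschitz_moments:
  assumes [measurable]: "F \<in> borel_measurable (Rd_lborel d)"
    and lip: "\<And>x y. x \<in> Rd d \<Longrightarrow> y \<in> Rd d \<Longrightarrow> \<bar>F x - F y\<bar> \<le> rdist d x y"
  shows "integrable \<nu> F" "integrable \<nu> (\<lambda>x. (F x - expectation F)\<^sup>2)"
    "integrable \<nu> (\<lambda>x. (F x - expectation F) ^ 4)"
    "expectation (\<lambda>x. (F x - expectation F)\<^sup>2) \<le> 8 * c1 / L"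
    "expectation (\<lambda>x. (F x - expectation F) ^ 4) \<le> 512 * c1 / L\<^sup>2"
proof -
  \<comment> \<open>The integral is a total function, so \<open>z\<close> is defined and Lipschitz
    before \<open>F\<close> is known to be integrable. That \<open>z\<close> is centered is first
    used in \<open>z0\<close>, after integrability has been derived from the exponential
    moments.\<close>
  define z where "z x = sqrt L * (F x - expectation F)" for x
  have zm[measurable]: "z \<in> borel_measurable (Rd_lborel d)" unfolding z_def by measurable
  have zlip: "\<bar>z x - z y\<bar> \<le> sqrt L * rdist d x y" if "x \<in> Rd d" "y \<in> Rd d" for x y
    using mult_left_mono[OF lip[OF that], of "sqrt L"] L_pos by (simp add: z_def right_diff_distrib[symmetric] abs_mult)
  have zlip': "\<bar>- z x - - z y\<bar> \<le> sqrt L * rdist d x y" if "x \<in> Rd d" "y \<in> Rd d" for x y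
    using zlip[OF that] by simp
  have L0: "0 \<le> sqrt L" using L_pos by simp
  have ie: "integrable \<nu> (\<lambda>x. exp (z x))" "integrable \<nu> (\<lambda>x. exp (- z x))"
    by (rule integrable_exp_lipschitz[OF _ L0 zlip] integrable_exp_lipschitz[OF _ L0 zlip'], simp_all)+
  have isum: "integrable \<nu> (\<lambda>x. exp (z x) + exp (- z x))" using ie by simp
  have iz2: "integrable \<nu> (\<lambda>x. (z x)\<^sup>2)"
    by (rule Bochner_Integration.integrable_bound[OF integrable_mult_right[OF isum, of 4]])
       (use power2_le_exp in \<open>auto simp: abs_of_nonneg add_nonneg_nonneg\<close>)
  have iz4: "integrable \<nu> (\<lambda>x. (z x) ^ 4)"
    by (rule Bochner_Integration.integrable_bound[OF integrable_mult_right[OF isum, of 256]])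
       (use power4_le_exp in \<open>auto simp: abs_of_nonneg add_nonneg_nonneg\<close>)
  have iz: "integrable \<nu> z" by (rule square_integrable_imp_integrable[OF _ iz2]) simp
  have Feq: "F x = z x / sqrt L + expectation F" for x using L_pos by (simp add: z_def)
  have "integrable \<nu> (\<lambda>x. z x / sqrt L + expectation F)" using iz by simp
  then show iF: "integrable \<nu> F" by (simp flip: Feq)
  have z0: "expectation z = 0" unfolding z_def using iF by (simp add: prob_space)
  have ge1: "1 \<le> expectation (\<lambda>x. exp (z x))" "1 \<le> expectation (\<lambda>x. exp (- z x))"
  proof -
    have "expectation (\<lambda>x. 1 + z x) \<le> expectation (\<lambda>x. exp (z x))"
      by (rule integral_mono) (use iz ie in simp_all)
    then show "1 \<le> expectation (\<lambda>x. exp (z x))" using iz z0 by (simp add: prob_space)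
    have "expectation (\<lambda>x. 1 + - z x) \<le> expectation (\<lambda>x. exp (- z x))"
      by (rule integral_mono) (use iz ie exp_ge_add_one_self[of "- z _"] in simp_all)
    then show "1 \<le> expectation (\<lambda>x. exp (- z x))" using iz z0 by (simp add: prob_space)
  qed
  have "ennreal (expectation (\<lambda>x. exp (z x)) * expectation (\<lambda>x. exp (- z x))) \<le> ennreal c1"
    using exp_product_bound[OF zm L0 zlip] ie
    by (simp add: nn_integral_eq_integral c1_def ennreal_mult)
  then have pr: "expectation (\<lambda>x. exp (z x)) * expectation (\<lambda>x. exp (- z x)) \<le> c1"
    using c1_ge_1 by simp
  have "expectation (\<lambda>x. exp (z x)) \<le> c1" "expectation (\<lambda>x. exp (- z x)) \<le> c1"
    using mult_left_mono[OF ge1(2), of "expectation (\<lambda>x. exp (z x))"]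
      mult_right_mono[OF ge1(1), of "expectation (\<lambda>x. exp (- z x))"] ge1 pr by linarith+
  then have E: "expectation (\<lambda>x. exp (z x) + exp (- z x)) \<le> 2 * c1" using ie by simp
  have e2: "expectation (\<lambda>x. (z x)\<^sup>2) \<le> 4 * expectation (\<lambda>x. exp (z x) + exp (- z x))"
    unfolding Bochner_Integration.integral_mult_right_zero[symmetric]
    by (intro integral_mono integrable_mult_right isum iz2 power2_le_exp)
  have e4: "expectation (\<lambda>x. (z x) ^ 4) \<le> 256 * expectation (\<lambda>x. exp (z x) + exp (- z x))"
    unfolding Bochner_Integration.integral_mult_right_zero[symmetric]
    by (intro integral_mono integrable_mult_right isum iz4 power4_le_exp)
  have z2: "(z x)\<^sup>2 = L * (F x - expectation F)\<^sup>2" for x using L_pos by (simp add: z_def power_mult_distrib)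
  have s4: "sqrt L ^ 4 = L\<^sup>2" using L_pos 
    by (metis order_less_imp_le real_sqrt_pow2 power_mult numeral_Bit0 mult_2)
  have z4: "(z x) ^ 4 = L\<^sup>2 * (F x - expectation F) ^ 4" for x by (simp add: z_def power_mult_distrib s4)
  show "integrable \<nu> (\<lambda>x. (F x - expectation F)\<^sup>2)" using iz2 L_pos unfolding z2 by simp
  show "integrable \<nu> (\<lambda>x. (F x - expectation F) ^ 4)" using iz4 L_pos unfolding z4 by simp
  show "expectation (\<lambda>x. (F x - expectation F)\<^sup>2) \<le> 8 * c1 / L"
    using e2 E L_pos unfolding z2 by (simp add: field_simps)
  show "expectation (\<lambda>x. (F x - expectation F) ^ 4) \<le> 512 * c1 / L\<^sup>2"
    using e4 E L_pos unfolding z4 by (simp add: field_simps)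
qed

end

section \<open>Dimension-free covariances and the location of the mean\<close>

lemma power2_add_le: "(a + b)\<^sup>2 \<le> 2 * a\<^sup>2 + 2 * b\<^sup>2" for a b :: real
  using zero_le_power2[of "a - b"] by (simp add: power2_eq_square algebra_simps)

lemma cancel_exp_factor: "(e * a) * b * (c * f * e') = a * b * c * f" if "e * e' = 1" for a b c e e' f :: real
proof -
  have "(e * a) * b * (c * f * e') = (e * e') * (a * b * c * f)" by (simp only: mult_ac)
  then show ?thesis using that by simp
qed

context wlc_density
begin

definition mean :: vec where
  "mean = (\<lambda>i\<in>{..<d}. expectation (\<lambda>y. y i))"

lemma integrable_component: "i < d \<Longrightarrow> integrable \<nu> (\<lambda>y. y i)"
  by (rule integrable_poly[where C=1 and k=1]) (auto intro: order_trans[OF abs_component_le_norm])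

lemma expectation_inner:
  "integrable \<nu> (\<lambda>y. \<Sum>i<d. e i * y i)" "expectation (\<lambda>y. \<Sum>i<d. e i * y i) = (\<Sum>i<d. e i * mean i)"
proof -
  have i: "\<And>i. i \<in> {..<d} \<Longrightarrow> integrable \<nu> (\<lambda>y. e i * y i)" using integrable_component by auto
  show "integrable \<nu> (\<lambda>y. \<Sum>i<d. e i * y i)" by (rule Bochner_Integration.integrable_sum[OF i])
  show "expectation (\<lambda>y. \<Sum>i<d. e i * y i) = (\<Sum>i<d. e i * mean i)"
    by (subst Bochner_Integration.integral_sum[OF i]) (auto simp: mean_def)
qed

text \<open>Normalizing \<open>e\<close> makes the functional 1-Lipschitz. In other words, the
  covariance matrix has operator norm at most \<open>8 * c1 / L\<close>.\<close>

lemma variance_inner: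
  shows "integrable \<nu> (\<lambda>y. (\<Sum>i<d. e i * (y i - mean i))\<^sup>2)"
    and "expectation (\<lambda>y. (\<Sum>i<d. e i * (y i - mean i))\<^sup>2) \<le> 8 * c1 / L * (Rd_norm d e)\<^sup>2"
proof -
  have "integrable \<nu> (\<lambda>y. (\<Sum>i<d. e i * (y i - mean i))\<^sup>2) \<and>
     expectation (\<lambda>y. (\<Sum>i<d. e i * (y i - mean i))\<^sup>2) \<le> 8 * c1 / L * (Rd_norm d e)\<^sup>2"
  proof (cases "Rd_norm d e = 0")
    case True
    then have "\<forall>i\<in>{..<d}. e i = 0" by (simp add: L2_set_eq_0_iff)
    then have "(\<Sum>i<d. e i * (y i - mean i)) = 0" for y by simp
    then show ?thesis using True by simp
  next
    case False
    define N where "N = Rd_norm d e"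
    have N: "N > 0" using False by (simp add: N_def less_le)
    define F where "F y = (\<Sum>i<d. (e i / N) * y i)" for y
    have [measurable]: "F \<in> borel_measurable (Rd_lborel d)" unfolding F_def by measurable
    have "Rd_norm d (\<lambda>i. e i / N) = 1"
      using L2_set_right_distrib[of "1 / N" e "{..<d}"] N by (simp add: N_def)
    then have lip: "\<bar>F x - F y\<bar> \<le> rdist d x y" for x y
      using inner_lipschitz[of "\<lambda>i. e i / N" x d y] by (simp add: F_def)
    have EF: "expectation F = (\<Sum>i<d. e i / N * mean i)"
      unfolding F_def by (rule expectation_inner)
    have eq: "(\<Sum>i<d. e i * (y i - mean i))\<^sup>2 = N\<^sup>2 * (F y - expectation F)\<^sup>2" for y
    proof -
      have "N * (F y - expectation F) = (\<Sum>i<d. e i * (y i - mean i))"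
        unfolding EF F_def using N
        by (simp add: sum_subtractf[symmetric] sum_distrib_left right_diff_distrib)
      then show ?thesis by (metis power_mult_distrib)
    qed
    have "expectation (\<lambda>y. (F y - expectation F)\<^sup>2) \<le> 8 * c1 / L"
      by (rule lipschitz_moments) (auto intro: lip)
    then have "N\<^sup>2 * expectation (\<lambda>y. (F y - expectation F)\<^sup>2) \<le> N\<^sup>2 * (8 * c1 / L)"
      by (rule mult_left_mono) simp
    moreover have "integrable \<nu> (\<lambda>y. (F y - expectation F)\<^sup>2)"
      by (rule lipschitz_moments(2)) (auto intro: lip)
    ultimately show ?thesis unfolding eq N_def[symmetric] by (simp add: mult.commute)
  qed
  then show "integrable \<nu> (\<lambda>y. (\<Sum>i<d. e i * (y i - mean i))\<^sup>2)"
    "expectation (\<lambda>y. (\<Sum>i<d. e i * (y i - mean i))\<^sup>2) \<le> 8 * c1 / L * (Rd_norm d e)\<^sup>2" by auto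
qed

lemma variance_component:
  assumes "i < d"
  shows "integrable \<nu> (\<lambda>y. (y i - mean i)\<^sup>2)" "expectation (\<lambda>y. (y i - mean i)\<^sup>2) \<le> 8 * c1 / L"
proof -
  let ?e = "\<lambda>j. if j = i then 1 else 0 :: real"
  have eq: "(\<Sum>j<d. ?e j * (y j - mean j)) = y i - mean i" for y
    using assms by (simp add: if_distrib[of "\<lambda>z. z * _"] cong: if_cong)
  have "(\<Sum>j<d. (?e j)\<^sup>2) = 1" using assms by (simp add: if_distrib[of "\<lambda>z. z\<^sup>2"] cong: if_cong)
  then have "Rd_norm d ?e = 1" by (simp add: L2_set_def)
  then show "integrable \<nu> (\<lambda>y. (y i - mean i)\<^sup>2)" "expectation (\<lambda>y. (y i - mean i)\<^sup>2) \<le> 8 * c1 / L"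
    using variance_inner[of ?e] unfolding eq by simp_all
qed

lemma expectation_rdist_mean:
  "integrable \<nu> (\<lambda>y. (rdist d y mean)\<^sup>2)" "expectation (\<lambda>y. (rdist d y mean)\<^sup>2) \<le> 8 * c1 / L * d"
proof -
  show "integrable \<nu> (\<lambda>y. (rdist d y mean)\<^sup>2)"
    unfolding rdist_sq by (intro Bochner_Integration.integrable_sum variance_component) simp
  have "expectation (\<lambda>y. (rdist d y mean)\<^sup>2) = (\<Sum>i<d. expectation (\<lambda>y. (y i - mean i)\<^sup>2))"
    unfolding rdist_sq by (intro Bochner_Integration.integral_sum variance_component) simp
  also have "\<dots> \<le> (\<Sum>i<d. 8 * c1 / L)" by (intro sum_mono variance_component) simp
  finally show "expectation (\<lambda>y. (rdist d y mean)\<^sup>2) \<le> 8 * c1 / L * d" by (simp add: mult.commute)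
qed

text \<open>The distance to the mean is 1-Lipschitz, so it fluctuates by a dimension-free amount around its
  expectation, which is of order \<open>sqrt (d / L)\<close>; hence the squared distance has standard deviation of
  order \<open>sqrt d / L\<close> instead of the trivial \<open>d / L\<close>.\<close>

lemma rdist_sq_fluctuation:
  assumes d: "1 \<le> d"
  obtains q where "integrable \<nu> (\<lambda>y. ((rdist d y mean)\<^sup>2 - q)\<^sup>2)"
    "expectation (\<lambda>y. ((rdist d y mean)\<^sup>2 - q)\<^sup>2) \<le> 1536 * c1\<^sup>2 * d / L\<^sup>2"
proof -
  define R where "R y = rdist d y mean" for y
  have [measurable]: "R \<in> borel_measurable (Rd_lborel d)" unfolding R_def by measurable
  have lip: "\<bar>R x - R y\<bar> \<le> rdist d x y" for x y unfolding R_def by (rule rdist_lipschitz)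
  define r where "r = expectation R"
  have R: "integrable \<nu> R" "integrable \<nu> (\<lambda>x. (R x - r)\<^sup>2)" "integrable \<nu> (\<lambda>x. (R x - r) ^ 4)"
    "expectation (\<lambda>x. (R x - r)\<^sup>2) \<le> 8 * c1 / L" "expectation (\<lambda>x. (R x - r) ^ 4) \<le> 512 * c1 / L\<^sup>2"
    unfolding r_def using lipschitz_moments[of R] lip by simp_all
  \<comment> \<open>A variance is nonnegative, so the mean distance \<open>r\<close> is at most the
    root mean square distance.\<close>
  have "0 \<le> expectation (\<lambda>x. (R x - r)\<^sup>2)" by simp
  also have "\<dots> = expectation (\<lambda>x. (R x)\<^sup>2) - r\<^sup>2"
    unfolding r_def using R(1) expectation_rdist_mean(1) unfolding R_def by (rule variance_eq)
  finally have r2: "r\<^sup>2 \<le> 8 * c1 / L * d" using expectation_rdist_mean(2) by (simp add: R_def)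
  \<comment> \<open>Centering at \<open>r^2\<close> instead of the expectation of \<open>R^2\<close>
    suffices: the covariance bound multiplies the centering constant by a function of mean zero. The
    factorization of \<open>R^2 - r^2\<close> then involves only the fluctuation
    \<open>R - r\<close>.\<close>
  define S where "S y = (R y)\<^sup>2 - r\<^sup>2" for y
  have [measurable]: "S \<in> borel_measurable (Rd_lborel d)" unfolding S_def by measurable
  have S_le: "(S y)\<^sup>2 \<le> 2 * (R y - r) ^ 4 + 8 * r\<^sup>2 * (R y - r)\<^sup>2" for y
  proof -
    have "S y = (R y - r)\<^sup>2 + 2 * r * (R y - r)" by (simp add: S_def power2_eq_square algebra_simps)
    then have "(S y)\<^sup>2 \<le> 2 * ((R y - r)\<^sup>2)\<^sup>2 + 2 * (2 * r * (R y - r))\<^sup>2"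
      using power2_add_le by (metis (no_types))
    then show ?thesis by (simp add: power_mult_distrib)
  qed
  have iB: "integrable \<nu> (\<lambda>y. 2 * (R y - r) ^ 4 + 8 * r\<^sup>2 * (R y - r)\<^sup>2)" using R by simp
  have iS: "integrable \<nu> (\<lambda>y. (S y)\<^sup>2)"
    by (rule Bochner_Integration.integrable_bound[OF iB]) (use S_le in \<open>auto simp: abs_of_nonneg\<close>)
  have "expectation (\<lambda>y. (S y)\<^sup>2) \<le> expectation (\<lambda>y. 2 * (R y - r) ^ 4 + 8 * r\<^sup>2 * (R y - r)\<^sup>2)"
    by (rule integral_mono[OF iS iB]) (rule S_le)
  also have "\<dots> = 2 * expectation (\<lambda>y. (R y - r) ^ 4) + 8 * r\<^sup>2 * expectation (\<lambda>y. (R y - r)\<^sup>2)"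
    using R by simp
  also have "\<dots> \<le> 2 * (512 * c1 / L\<^sup>2) + 8 * (8 * c1 / L * d) * (8 * c1 / L)"
    using R r2 by (intro add_mono mult_mono mult_left_mono) (use c1_ge_1 L_pos in auto)
  also have "\<dots> = (1024 * c1 + 512 * c1\<^sup>2 * d) / L\<^sup>2"
    using L_pos by (simp add: field_simps power2_eq_square)
  also have "\<dots> \<le> 1536 * c1\<^sup>2 * d / L\<^sup>2"
  proof (rule divide_right_mono)
    have "c1 * 1 \<le> c1 * (c1 * d)"
      using c1_ge_1 d mult_mono[of 1 c1 1 "real d"] by (intro mult_left_mono) auto
    then show "1024 * c1 + 512 * c1\<^sup>2 * d \<le> 1536 * c1\<^sup>2 * d" by (simp add: power2_eq_square mult_ac)
  qed simp
  finally show ?thesis using that[of "r\<^sup>2"] iS by (simp add: S_def R_def)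
qed

text \<open>The linear functional has mean zero, so \<open>k0\<close> and the centering
  \<open>k2 * q\<close> drop out. Cauchy-Schwarz pairs what remains: the functional has size
  \<open>1 / sqrt L\<close>, the centered squared distance \<open>sqrt d / L\<close>, the other
  functional again \<open>1 / sqrt L\<close>.\<close>

lemma quadratic_covariance_bound:
  assumes d: "1 \<le> d"
    and \<psi>: "\<And>y. y \<in> Rd d \<Longrightarrow> \<psi> y = k0 + k2 * (rdist d y mean)\<^sup>2 + (\<Sum>i<d. w i * (y i - mean i))"
  shows "\<bar>expectation (\<lambda>y. (\<Sum>i<d. e i * (y i - mean i)) * \<psi> y)\<bar>
    \<le> Rd_norm d e * (\<bar>k2\<bar> * (111 * c1\<^sup>2 * sqrt d / (L * sqrt L)) + 8 * c1 / L * Rd_norm d w)"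
proof -
  obtain q where q: "integrable \<nu> (\<lambda>y. ((rdist d y mean)\<^sup>2 - q)\<^sup>2)"
    "expectation (\<lambda>y. ((rdist d y mean)\<^sup>2 - q)\<^sup>2) \<le> 1536 * c1\<^sup>2 * d / L\<^sup>2"
    using rdist_sq_fluctuation[OF d] .
  define l where "l e y = (\<Sum>i<d. e i * (y i - mean i))" for e y :: vec
  have [measurable]: "l e \<in> borel_measurable (Rd_lborel d)" for e unfolding l_def by measurable
  define S where "S y = (rdist d y mean)\<^sup>2 - q" for y
  have [measurable]: "S \<in> borel_measurable (Rd_lborel d)" unfolding S_def by measurable
  have l0: "integrable \<nu> (l e)" "expectation (l e) = 0" for e
  proof -
    have eq: "l e = (\<lambda>y. (\<Sum>i<d. e i * y i) - (\<Sum>i<d. e i * mean i))"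
      by (auto simp: l_def right_diff_distrib sum_subtractf)
    show "integrable \<nu> (l e)" unfolding eq using expectation_inner[of e] by simp
    show "expectation (l e) = 0" unfolding eq using expectation_inner[of e] by (simp add: prob_space)
  qed
  have l2: "integrable \<nu> (\<lambda>y. (l e y)\<^sup>2)" "expectation (\<lambda>y. (l e y)\<^sup>2) \<le> (sqrt (8 * c1 / L) * Rd_norm d e)\<^sup>2" for e
    using variance_inner[of e] L_pos c1_ge_1 by (simp_all add: l_def power_mult_distrib)
  have S2: "integrable \<nu> (\<lambda>y. (S y)\<^sup>2)" "expectation (\<lambda>y. (S y)\<^sup>2) \<le> (sqrt (1536 * c1\<^sup>2 * d / L\<^sup>2))\<^sup>2"
    using q by (simp_all add: S_def)
  have ilS: "integrable \<nu> (\<lambda>y. l e y * S y)" "integrable \<nu> (\<lambda>y. l e y * l w y)"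
    by (rule integrable_square_product; use l2 S2 in simp)+
  have "expectation (\<lambda>y. l e y * \<psi> y)
      = expectation (\<lambda>y. (k0 + k2 * q) * l e y + k2 * (l e y * S y) + l e y * l w y)"
    by (intro Bochner_Integration.integral_cong refl) (auto simp: \<psi> S_def l_def[of w] algebra_simps)
  also have "\<dots> = k2 * expectation (\<lambda>y. l e y * S y) + expectation (\<lambda>y. l e y * l w y)"
    using ilS l0 by simp
  finally have "\<bar>expectation (\<lambda>y. l e y * \<psi> y)\<bar>
      \<le> \<bar>k2\<bar> * \<bar>expectation (\<lambda>y. l e y * S y)\<bar> + \<bar>expectation (\<lambda>y. l e y * l w y)\<bar>"
    using abs_triangle_ineq[of "k2 * expectation (\<lambda>y. l e y * S y)"] by (simp add: abs_mult)
  also have "\<dots> \<le> \<bar>k2\<bar> * (sqrt (8 * c1 / L) * Rd_norm d e * sqrt (1536 * c1\<^sup>2 * d / L\<^sup>2))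
      + sqrt (8 * c1 / L) * Rd_norm d e * (sqrt (8 * c1 / L) * Rd_norm d w)"
    using l2 S2 L_pos c1_ge_1
    by (intro add_mono mult_left_mono integral_product_le_of_squares) auto
  also have "\<dots> = Rd_norm d e * (\<bar>k2\<bar> * (sqrt (8 * c1 / L) * sqrt (1536 * c1\<^sup>2 * d / L\<^sup>2))
      + (sqrt (8 * c1 / L))\<^sup>2 * Rd_norm d w)"
    by (simp add: algebra_simps power2_eq_square)
  also have "(sqrt (8 * c1 / L))\<^sup>2 = 8 * c1 / L" using L_pos c1_ge_1 by simp
  also have "sqrt (8 * c1 / L) * sqrt (1536 * c1\<^sup>2 * d / L\<^sup>2) \<le> 111 * c1\<^sup>2 * sqrt d / (L * sqrt L)"
  proof -
    \<comment> \<open>The product of the two constants is \<open>8 * 1536 = 12288\<close>, just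
      below \<open>111^2 = 12321\<close>.\<close>
    have "8 * c1 / L * (1536 * c1\<^sup>2 * d / L\<^sup>2) \<le> 12321 * c1 ^ 4 * d / L ^ 3"
    proof -
      have "12288 * (c1 ^ 3 * d) \<le> 12321 * (c1 ^ 4 * d)"
        using c1_ge_1 by (intro mult_mono power_increasing) auto
      then show ?thesis using L_pos by (simp add: power2_eq_square power3_eq_cube power4_eq_xxxx divide_right_mono mult_ac)
    qed
    also have "\<dots> = (111 * c1\<^sup>2 * sqrt d / (L * sqrt L))\<^sup>2"
      using L_pos by (simp add: power_divide power_mult_distrib power3_eq_cube power4_eq_xxxx power2_eq_square mult_ac)
    finally show ?thesis
      unfolding real_sqrt_mult[symmetric] using L_pos by (intro real_le_lsqrt) auto
  qed
  finally show ?thesis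
    by (simp add: l_def mult_left_mono add_right_mono)
qed

text \<open>Halving the distance to \<open>c\<close> changes volumes by \<open>2 ^ d\<close> and increases the density by
  \<open>exp (L r\<^sup>2 / 16)\<close> up to a constant; comparing total masses bounds an exponential moment of \<open>r\<^sup>2\<close>.\<close>

lemma second_moment_about_near_maximum:
  assumes c: "c \<in> Rd d" and dom: "\<And>y. y \<in> Rd d \<Longrightarrow> P y \<le> exp (q + K * rdist d y c) * P c"
  shows "integrable \<nu> (\<lambda>y. (rdist d y c)\<^sup>2)"
    "expectation (\<lambda>y. (rdist d y c)\<^sup>2) \<le> 16 / L * (d + 4 * K\<^sup>2 / L + K + q / 2)"
proof -
  \<comment> \<open>Half of the convexity gain \<open>L * r^2 / 4\<close> is kept and becomes
    \<open>2 * z\<close>. The other half absorbs the linear loss \<open>2 * K * r\<close>, one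
    \<open>K * r\<close> from the domination by \<open>P c\<close> and one from the midpoint
    condition, at the price \<open>8 * K^2 / L\<close>. With the constants \<open>2 * K\<close> and
    \<open>q\<close> this is \<open>2 * T\<close>.\<close>
  define T where "T = 4 * K\<^sup>2 / L + K + q / 2"
  define z where "z y = L * (rdist d y c)\<^sup>2 / 16" for y
  have [measurable]: "z \<in> borel_measurable (Rd_lborel d)" unfolding z_def by measurable
  have pt: "P y * exp (z y - T) \<le> P (midpt d c y)" if y: "y \<in> Rd d" for y
  proof (rule power2_le_imp_le)
    let ?r = "rdist d y c"
    have Kr: "2 * K * ?r - L * ?r\<^sup>2 / 8 \<le> 8 * K\<^sup>2 / L"
      using linear_quadratic_le[of "L / 2" "2 * K" ?r] L_pos by (simp add: power_mult_distrib)
    have ex: "exp (2 * z y - 2 * T) \<le> exp (L * ?r\<^sup>2 / 4) * exp (- (2 * K + K * ?r)) * exp (- (q + K * ?r))"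
      unfolding mult_exp_exp using Kr by (simp add: z_def T_def)
    have "(P y * exp (z y - T))\<^sup>2 = P y * P y * exp (2 * z y - 2 * T)"
      by (simp add: power_mult_distrib exp_double[symmetric] power2_eq_square[of "P y"] right_diff_distrib)
    also have "\<dots> \<le> P y * P y * (exp (L * ?r\<^sup>2 / 4) * exp (- (2 * K + K * ?r)) * exp (- (q + K * ?r)))"
      by (intro mult_left_mono ex mult_nonneg_nonneg P_nonneg)
    also have "\<dots> \<le> (exp (q + K * ?r) * P c) * P y * (exp (L * ?r\<^sup>2 / 4) * exp (- (2 * K + K * ?r)) * exp (- (q + K * ?r)))"
      by (intro mult_right_mono dom y P_nonneg mult_nonneg_nonneg) auto
    also have "\<dots> = P c * P y * exp (L * (rdist d c y)\<^sup>2 / 4) * exp (- (2 * K + K * rdist d c y))"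
    proof -
      have "exp (q + K * ?r) * exp (- (q + K * ?r)) = 1" unfolding mult_exp_exp by simp
      then show ?thesis unfolding rdist_commute[of d c y]
        by (subst cancel_exp_factor) auto
    qed
    also have "\<dots> \<le> exp (2 * K + K * rdist d c y) * (P (midpt d c y))\<^sup>2 * exp (- (2 * K + K * rdist d c y))"
      by (intro mult_right_mono P_midpt c y) auto
    also have "\<dots> = (P (midpt d c y))\<^sup>2"
      unfolding mult.commute[of _ "exp (- _)"] mult.assoc[symmetric] mult_exp_exp by simp
    finally show "(P y * exp (z y - T))\<^sup>2 \<le> (P (midpt d c y))\<^sup>2" .
  qed (rule P_nonneg)
  have "(\<integral>\<^sup>+y. ennreal (exp (z y - T)) \<partial>\<nu>) = (\<integral>\<^sup>+y. ennreal (P y * exp (z y - T)) \<partial>Rd_lborel d)"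
    by (simp add: \<nu>_def nn_integral_density ennreal_mult P_nonneg)
  also have "\<dots> \<le> (\<integral>\<^sup>+y. ennreal (P (\<lambda>i\<in>{..<d}. c i / 2 + (1/2) * y i)) \<partial>Rd_lborel d)"
    by (intro nn_integral_mono ennreal_leI)
       (use pt in \<open>simp add: space_PiM midpt_def add_divide_distrib\<close>)
  finally have *: "(\<integral>\<^sup>+y. ennreal (exp (z y - T)) \<partial>\<nu>)
      \<le> (\<integral>\<^sup>+y. ennreal (P (\<lambda>i\<in>{..<d}. c i / 2 + (1/2) * y i)) \<partial>Rd_lborel d)" .
  \<comment> \<open>The map to the midpoint with \<open>c\<close> has Jacobian
    \<open>(1/2) ^ d\<close>, so the total mass of the composed density is
    \<open>2 ^ d\<close>.\<close>
  have "1 = ennreal ((1/2) ^ d) * (\<integral>\<^sup>+y. ennreal (P (\<lambda>i\<in>{..<d}. c i / 2 + (1/2) * y i)) \<partial>Rd_lborel d)"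
    using nn_integral_PiM_affine[of "{..<d}" "1/2" "\<lambda>y. ennreal (P y)" "\<lambda>i. c i / 2"] by (simp add: P_int)
  then have "ennreal (2 ^ d) * 1 = ennreal (2 ^ d) * (ennreal ((1/2) ^ d) * (\<integral>\<^sup>+y. ennreal (P (\<lambda>i\<in>{..<d}. c i / 2 + (1/2) * y i)) \<partial>Rd_lborel d))"
    by simp
  also have "\<dots> = (\<integral>\<^sup>+y. ennreal (P (\<lambda>i\<in>{..<d}. c i / 2 + (1/2) * y i)) \<partial>Rd_lborel d)"
    by (simp add: mult.assoc[symmetric] power_mult_distrib[symmetric] flip: ennreal_mult)
  finally have e: "(\<integral>\<^sup>+y. ennreal (exp (z y - T)) \<partial>\<nu>) \<le> ennreal (2 ^ d)" using * by simp
  have ie: "integrable \<nu> (\<lambda>y. exp (z y - T))"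
    by (rule integrableI_nonneg) (use e in \<open>auto simp: top.not_eq_extremum[symmetric] top_unique\<close>)
  have Ee: "expectation (\<lambda>y. exp (z y - T)) \<le> 2 ^ d"
    using e ie by (simp add: nn_integral_eq_integral)
  show i2: "integrable \<nu> (\<lambda>y. (rdist d y c)\<^sup>2)"
  proof (rule integrable_poly[where k=2 and C="(1 + Rd_norm d c)\<^sup>2"])
    fix y
    have "rdist d y c \<le> Rd_norm d y + Rd_norm d c"
      using rdist_triangle[of d y c "\<lambda>_. 0"] by (simp add: rdist_zero rdist_commute[of d "\<lambda>_. 0" c])
    also have "\<dots> \<le> (1 + Rd_norm d c) * (1 + Rd_norm d y)" by (simp add: algebra_simps)
    finally have "(rdist d y c)\<^sup>2 \<le> ((1 + Rd_norm d c) * (1 + Rd_norm d y))\<^sup>2" by (intro power_mono) auto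
    then show "\<bar>(rdist d y c)\<^sup>2\<bar> \<le> (1 + Rd_norm d c)\<^sup>2 * (1 + Rd_norm d y)\<^sup>2" by (simp add: power_mult_distrib)
  qed simp
  then have iz: "integrable \<nu> z" unfolding z_def by simp
  \<comment> \<open>Jensen in the form \<open>1 + w \<le> exp w\<close>: the volume factor
    \<open>2 ^ d\<close> enters only through its logarithm, so the second moment is linear in
    \<open>d\<close>.\<close>
  have "expectation (\<lambda>y. 1 + (z y - T - d * ln 2)) \<le> expectation (\<lambda>y. exp (z y - T) * (1 / 2 ^ d))"
  proof (rule integral_mono)
    fix y
    have "exp (z y - T) * (1 / 2 ^ d) = exp (z y - T - d * ln 2)"
      by (simp add: exp_diff exp_of_nat_mult)
    then show "1 + (z y - T - d * ln 2) \<le> exp (z y - T) * (1 / 2 ^ d)"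
      using exp_ge_add_one_self by metis
  qed (use iz ie in auto)
  also have "\<dots> \<le> 1" using Ee by simp
  finally have "expectation z \<le> T + d * ln 2" using iz by simp
  also have "\<dots> \<le> d + T" using ln_2_less_1 mult_left_mono[of "ln 2" 1 "real d"] by simp
  finally have "L / 16 * expectation (\<lambda>y. (rdist d y c)\<^sup>2) \<le> d + T" unfolding z_def by simp
  then show "expectation (\<lambda>y. (rdist d y c)\<^sup>2) \<le> 16 / L * (d + 4 * K\<^sup>2 / L + K + q / 2)"
    using L_pos by (simp add: T_def field_simps)
qed

text \<open>Jensen in every coordinate: the mean is no farther from \<open>c\<close> than the root
  mean square distance.\<close>

lemma mean_distance_to_near_maximum:
  assumes c: "c \<in> Rd d" and dom: "\<And>y. y \<in> Rd d \<Longrightarrow> P y \<le> exp (q + K * rdist d y c) * P c"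
  shows "(rdist d mean c)\<^sup>2 \<le> 16 / L * (d + 4 * K\<^sup>2 / L + K + q / 2)"
proof -
  note m = second_moment_about_near_maximum[OF c dom]
  have comp: "(\<lambda>y. y i) \<in> borel_measurable \<nu>" if "i < d" for i
    using integrable_component[OF that] by (rule borel_measurable_integrable)
  have i2: "integrable \<nu> (\<lambda>y. (y i - c i)\<^sup>2)" if i: "i < d" for i
  proof (rule Bochner_Integration.integrable_bound[OF m(1)])
    show "AE y in \<nu>. norm ((y i - c i)\<^sup>2) \<le> norm ((rdist d y c)\<^sup>2)"
      unfolding rdist_sq using i by (auto intro!: AE_I2 member_le_sum simp: abs_of_nonneg sum_nonneg)
  qed (use comp[OF i] in measurable)
  have "(mean i - c i)\<^sup>2 \<le> expectation (\<lambda>y. (y i - c i)\<^sup>2)" if i: "i < d" for i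
  proof -
    have "mean i - c i = expectation (\<lambda>y. y i - c i)"
      using integrable_component[OF i] i by (simp add: mean_def prob_space)
    moreover have "0 \<le> expectation (\<lambda>y. (y i - c i - expectation (\<lambda>y. y i - c i))\<^sup>2)" by simp
    moreover have "expectation (\<lambda>y. (y i - c i - expectation (\<lambda>y. y i - c i))\<^sup>2)
        = expectation (\<lambda>y. (y i - c i)\<^sup>2) - (expectation (\<lambda>y. y i - c i))\<^sup>2"
      using integrable_component[OF i] i2[OF i] by (intro variance_eq) auto
    ultimately show ?thesis by simp
  qed
  then have "(rdist d mean c)\<^sup>2 \<le> (\<Sum>i<d. expectation (\<lambda>y. (y i - c i)\<^sup>2))"
    unfolding rdist_sq by (intro sum_mono) simp
  also have "\<dots> = expectation (\<lambda>y. (rdist d y c)\<^sup>2)"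
    unfolding rdist_sq by (subst Bochner_Integration.integral_sum) (use i2 in auto)
  finally show ?thesis using m(2) by linarith
qed

end

section \<open>Open boxes, convex sets and strong convexity\<close>

text \<open>Open balls of the sup norm: a base of the product topology whose members are product
  sets, so that their measure is a product. For \<open>d = 0\<close> the box is the whole one-point
  space, whatever \<open>r\<close> is.\<close>

definition bx :: "nat \<Rightarrow> vec \<Rightarrow> real \<Rightarrow> vec set" where
  "bx d c r = {x \<in> Rd d. \<forall>i<d. \<bar>x i - c i\<bar> < r}"

lemma bx_center: "c \<in> Rd d \<Longrightarrow> 0 < r \<Longrightarrow> c \<in> bx d c r"
  by (simp add: bx_def)

lemma bx_mono: "r \<le> s \<Longrightarrow> bx d c r \<subseteq> bx d c s"
  by (force simp: bx_def)

lemma bx_eq_PiE: "bx d c r = (\<Pi>\<^sub>E i\<in>{..<d}. {c i - r<..<c i + r})"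
  by (auto simp: bx_def PiE_def Pi_def abs_less_iff)

lemma bx_trans: "x \<in> bx d c r \<Longrightarrow> \<exists>s>0. bx d x s \<subseteq> bx d c r" if "0 < r"
proof -
  assume x: "x \<in> bx d c r"
  define s where "s = Min (insert r ((\<lambda>i. r - \<bar>x i - c i\<bar>) ` {..<d}))"
  have "s > 0" using x that by (auto simp: s_def bx_def)
  moreover have "bx d x s \<subseteq> bx d c r"
  proof
    fix y assume y: "y \<in> bx d x s"
    have "\<bar>y i - c i\<bar> < r" if "i < d" for i
    proof -
      have "s \<le> r - \<bar>x i - c i\<bar>" unfolding s_def using that by (intro Min_le) auto
      moreover have "\<bar>y i - x i\<bar> < s" using y that by (simp add: bx_def)
      ultimately show ?thesis by linarith
    qed
    then show "y \<in> bx d c r" using y by (simp add: bx_def)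
  qed
  ultimately show ?thesis by blast
qed

lemma openin_Rd_iff:
  "openin (Rd_top d) U \<longleftrightarrow> U \<subseteq> Rd d \<and> (\<forall>x\<in>U. \<exists>r>0. bx d x r \<subseteq> U)"
proof (intro iffI conjI ballI)
  assume U: "openin (Rd_top d) U"
  show "U \<subseteq> Rd d" using openin_subset[OF U] by simp
  fix x assume x: "x \<in> U"
  obtain V where V: "\<And>i. i \<in> {..<d} \<Longrightarrow> open (V i)" "x \<in> Pi\<^sub>E {..<d} V" "Pi\<^sub>E {..<d} V \<subseteq> U"
  proof -
    have "\<exists>V. finite {i \<in> {..<d}. V i \<noteq> topspace euclideanreal} \<and>
        (\<forall>i\<in>{..<d}. openin euclideanreal (V i)) \<and> x \<in> Pi\<^sub>E {..<d} V \<and> Pi\<^sub>E {..<d} V \<subseteq> U"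
      using U x unfolding openin_product_topology_alt by blast
    then obtain V where "\<And>i. i \<in> {..<d} \<Longrightarrow> open (V i)" "x \<in> Pi\<^sub>E {..<d} V" "Pi\<^sub>E {..<d} V \<subseteq> U"
      by auto
    then show ?thesis by (rule that)
  qed
  have "\<forall>i\<in>{..<d}. \<exists>e>0. \<forall>y. \<bar>y - x i\<bar> < e \<longrightarrow> y \<in> V i"
  proof
    fix i assume i: "i \<in> {..<d}"
    then have "x i \<in> V i" using V(2) by auto
    then show "\<exists>e>0. \<forall>y. \<bar>y - x i\<bar> < e \<longrightarrow> y \<in> V i"
      using V(1)[OF i] unfolding open_dist by (auto simp: dist_real_def)
  qed
  then obtain e where e: "\<And>i. i \<in> {..<d} \<Longrightarrow> e i > (0::real)"
    "\<And>i y. i \<in> {..<d} \<Longrightarrow> \<bar>y - x i\<bar> < e i \<Longrightarrow> y \<in> V i" by metis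
  \<comment> \<open>Inserting 1 keeps the minimum defined when \<open>d = 0\<close>.\<close>
  define r where "r = Min (insert 1 (e ` {..<d}))"
  have "r > 0" using e(1) by (auto simp: r_def)
  moreover have "bx d x r \<subseteq> Pi\<^sub>E {..<d} V"
  proof
    fix y assume y: "y \<in> bx d x r"
    have "y i \<in> V i" if "i < d" for i
    proof (rule e(2))
      have "r \<le> e i" unfolding r_def using that by (intro Min_le) auto
      then show "\<bar>y i - x i\<bar> < e i" using y that by (force simp: bx_def)
    qed (use that in simp)
    then show "y \<in> Pi\<^sub>E {..<d} V" using y by (auto simp: bx_def PiE_def)
  qed
  ultimately show "\<exists>r>0. bx d x r \<subseteq> U" using V(3) by blast
next
  assume *: "U \<subseteq> Rd d \<and> (\<forall>x\<in>U. \<exists>r>0. bx d x r \<subseteq> U)"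
  show "openin (Rd_top d) U"
    unfolding openin_product_topology_alt
  proof
    fix x assume x: "x \<in> U"
    then obtain r where r: "r > 0" "bx d x r \<subseteq> U" using * by blast
    let ?V = "\<lambda>i. {x i - r<..<x i + r}"
    have "x \<in> bx d x r" using x * r by (intro bx_center) auto
    then show "\<exists>V. finite {i \<in> {..<d}. V i \<noteq> topspace euclideanreal} \<and>
        (\<forall>i\<in>{..<d}. openin euclideanreal (V i)) \<and> x \<in> Pi\<^sub>E {..<d} V \<and> Pi\<^sub>E {..<d} V \<subseteq> U"
      using r by (intro exI[of _ ?V]) (auto simp: bx_eq_PiE)
  qed
qed

lemma openin_bx: "openin (Rd_top d) (bx d c r)"
  unfolding openin_Rd_iff
proof (intro conjI ballI)
  fix x assume x: "x \<in> bx d c r"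
  show "\<exists>s>0. bx d x s \<subseteq> bx d c r"
  proof (cases "0 < r")
    case False
    then have "d = 0" using x by (auto simp: bx_def)
    then show ?thesis using x by (intro exI[of _ 1]) (auto simp: bx_def)
  qed (use bx_trans x in blast)
qed (auto simp: bx_def)

lemma mem_interior_Rd_iff:
  assumes "D \<subseteq> Rd d"
  shows "x \<in> Rd_top d interior_of D \<longleftrightarrow> x \<in> D \<and> (\<exists>r>0. bx d x r \<subseteq> D)"
proof
  assume x: "x \<in> Rd_top d interior_of D"
  then have "x \<in> D" using interior_of_subset[of "Rd_top d" D] by (rule rev_subsetD)
  moreover obtain r where "r > 0" "bx d x r \<subseteq> Rd_top d interior_of D"
    using openin_interior_of[of "Rd_top d" D] x unfolding openin_Rd_iff by blast
  ultimately show "x \<in> D \<and> (\<exists>r>0. bx d x r \<subseteq> D)" using interior_of_subset[of "Rd_top d" D] by (meson subset_trans)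
next
  assume "x \<in> D \<and> (\<exists>r>0. bx d x r \<subseteq> D)"
  then obtain r where r: "x \<in> D" "r > 0" "bx d x r \<subseteq> D" by blast
  then have "x \<in> bx d x r" using assms by (intro bx_center) auto
  then show "x \<in> Rd_top d interior_of D"
    using interior_of_maximal[OF r(3) openin_bx] by (rule rev_subsetD)
qed

lemma continuous_Rd_box:
  assumes g: "continuous_map (subtopology (Rd_top d) S) euclideanreal g"
    and S: "openin (Rd_top d) S" and x: "x \<in> S" and e: "e > (0::real)"
  shows "\<exists>r>0. bx d x r \<subseteq> S \<and> (\<forall>y\<in>bx d x r. \<bar>g y - g x\<bar> < e)"
proof -
  have top: "topspace (subtopology (Rd_top d) S) = S" using openin_subset[OF S] by auto
  have "openin (subtopology (Rd_top d) S) {y \<in> S. g y \<in> ball (g x) e}"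
    using openin_continuous_map_preimage[OF g, of "ball (g x) e"] unfolding top by simp
  then have "openin (Rd_top d) {y \<in> S. g y \<in> ball (g x) e}"
    using S openin_trans_full by blast
  moreover have "x \<in> {y \<in> S. g y \<in> ball (g x) e}" using x e by simp
  ultimately obtain r where "r > 0" "bx d x r \<subseteq> {y \<in> S. g y \<in> ball (g x) e}"
    unfolding openin_Rd_iff by blast
  then show ?thesis by (intro exI[of _ r]) (auto simp: dist_real_def abs_minus_commute)
qed

text \<open>On the space of all functions on \<open>nat\<close>, the product sigma-algebra is the
  Borel one. An open set is therefore pulled back along the restriction to \<open>{..<d}\<close> and
  then along the inclusion, which is measurable because coordinates from \<open>d\<close> on are
  constantly \<open>undefined\<close>.\<close>

lemma open_sets_Rd_lborel:
  assumes U: "openin (Rd_top d) U"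
  shows "U \<in> sets (Rd_lborel d)"
proof -
  have s: "sets (Pi\<^sub>M {..<d} (\<lambda>_. lborel)) = sets (Pi\<^sub>M {..<d} (\<lambda>_. borel :: real measure))"
    by (intro sets_PiM_cong) auto
  have cont: "continuous_map (product_topology (\<lambda>_. euclideanreal) UNIV) (Rd_top d) (\<lambda>x. restrict x {..<d})"
    unfolding continuous_map_componentwise
  proof (intro conjI ballI)
    fix k assume "k \<in> {..<d}"
    then show "continuous_map (product_topology (\<lambda>_. euclideanreal) UNIV) euclideanreal (\<lambda>x. restrict x {..<d} k)"
      by (intro continuous_map_eq[OF continuous_map_product_projection[of k UNIV]]) auto
  qed auto
  have top_eq: "product_topology (\<lambda>_. euclideanreal) UNIV = (euclidean :: vec topology)"
    by (rule euclidean_product_topology)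
  have "openin (product_topology (\<lambda>_. euclideanreal) UNIV) {x. restrict x {..<d} \<in> U}"
    using openin_continuous_map_preimage[OF cont U] by simp
  then have "open {x :: vec. restrict x {..<d} \<in> U}"
    unfolding top_eq by (subst open_openin)
  then have "{x. restrict x {..<d} \<in> U} \<in> sets (Pi\<^sub>M UNIV (\<lambda>_. borel :: real measure))"
    unfolding sets_PiM_equal_borel by (rule borel_open)
  moreover have "(\<lambda>x. x) \<in> measurable (Pi\<^sub>M {..<d} (\<lambda>_. borel)) (Pi\<^sub>M UNIV (\<lambda>_. borel :: real measure))"
  proof (rule measurable_PiM_single')
    fix i :: nat
    show "(\<lambda>x. x i) \<in> measurable (Pi\<^sub>M {..<d} (\<lambda>_. borel)) (borel :: real measure)"
    proof (cases "i < d")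
      case False
      then have "x i = undefined" if "x \<in> space (Pi\<^sub>M {..<d} (\<lambda>_. borel :: real measure))" for x
        using that by (auto simp: space_PiM PiE_def extensional_def)
      then show ?thesis by (subst measurable_cong[where g="\<lambda>_. undefined"]) auto
    qed simp
  qed auto
  ultimately have "(\<lambda>x. x) -` {x. restrict x {..<d} \<in> U} \<inter> space (Pi\<^sub>M {..<d} (\<lambda>_. borel :: real measure))
      \<in> sets (Pi\<^sub>M {..<d} (\<lambda>_. borel :: real measure))"
    by (rule measurable_sets[rotated])
  also have "(\<lambda>x. x) -` {x. restrict x {..<d} \<in> U} \<inter> space (Pi\<^sub>M {..<d} (\<lambda>_. borel :: real measure)) = U"
    using openin_subset[OF U] by (auto simp: space_PiM PiE_restrict)
  finally show ?thesis unfolding s .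
qed

lemma continuous_imp_measurable_Rd:
  assumes g: "continuous_map (Rd_top d) euclideanreal g"
  shows "g \<in> borel_measurable (Rd_lborel d)"
proof (rule borel_measurableI)
  fix S :: "real set" assume "open S"
  then have "openin (Rd_top d) {x \<in> topspace (Rd_top d). g x \<in> S}"
    by (intro openin_continuous_map_preimage[OF g]) simp
  then have "{x \<in> topspace (Rd_top d). g x \<in> S} \<in> sets (Rd_lborel d)" by (rule open_sets_Rd_lborel)
  also have "{x \<in> topspace (Rd_top d). g x \<in> S} = g -` S \<inter> space (Rd_lborel d)"
    by (auto simp: space_PiM)
  finally show "g -` S \<inter> space (Rd_lborel d) \<in> sets (Rd_lborel d)" .
qed

lemma rdist_le_of_bx: "x \<in> bx d c r \<Longrightarrow> rdist d x c \<le> d * r"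
proof -
  assume x: "x \<in> bx d c r"
  have "rdist d x c \<le> (\<Sum>i<d. \<bar>x i - c i\<bar>)" unfolding rdist_def by (rule L2_set_le_sum_abs)
  also have "\<dots> \<le> (\<Sum>i<d. r)" using x by (intro sum_mono) (auto simp: bx_def)
  finally show ?thesis by simp
qed

lemma hoelder_imp_continuous:
  assumes lip: "\<And>x y. x \<in> Rd d \<Longrightarrow> y \<in> Rd d \<Longrightarrow> \<bar>a x - a y\<bar> \<le> K * (rdist d x y) powr \<beta>" and K: "0 < K" and b: "0 < \<beta>"
  shows "continuous_map (Rd_top d) euclideanreal a"
  unfolding continuous_map_def
proof (intro conjI allI impI)
  fix U assume "openin euclideanreal U"
  then have U: "open U" by simp
  show "openin (Rd_top d) {x \<in> topspace (Rd_top d). a x \<in> U}"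
    unfolding openin_Rd_iff
  proof (intro conjI ballI)
    fix x assume x: "x \<in> {x \<in> topspace (Rd_top d). a x \<in> U}"
    then obtain e where e: "e > 0" "\<And>z. \<bar>z - a x\<bar> < e \<Longrightarrow> z \<in> U"
      using U unfolding open_dist by (auto simp: dist_real_def)
    define \<rho> where "\<rho> = (e / (2 * K)) powr (1 / \<beta>)"
    have \<rho>: "\<rho> > 0" using e K by (simp add: \<rho>_def)
    have \<rho>b: "\<rho> powr \<beta> = e / (2 * K)" using e K b by (simp add: \<rho>_def powr_powr)
    define r where "r = \<rho> / (d + 1)"
    have r: "r > 0" "d * r \<le> \<rho>" using \<rho> by (simp_all add: r_def field_simps)
    have "bx d x r \<subseteq> {x \<in> topspace (Rd_top d). a x \<in> U}"
    proof
      fix y assume y: "y \<in> bx d x r"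
      have "rdist d y x \<le> \<rho>" using rdist_le_of_bx[OF y] r by linarith
      then have "(rdist d y x) powr \<beta> \<le> e / (2 * K)" unfolding \<rho>b[symmetric] using b by (intro powr_mono2) auto
      then have "K * (rdist d y x) powr \<beta> \<le> e / 2" using K by (simp add: field_simps)
      moreover have "\<bar>a y - a x\<bar> \<le> K * (rdist d y x) powr \<beta>" using x y by (intro lip) (auto simp: bx_def)
      ultimately have "a y \<in> U" using e by (intro e(2)) linarith
      then show "y \<in> {x \<in> topspace (Rd_top d). a x \<in> U}" using y by (auto simp: bx_def)
    qed
    then show "\<exists>r>0. bx d x r \<subseteq> {x \<in> topspace (Rd_top d). a x \<in> U}" using r by blast
  qed auto
qed auto

section \<open>Convex sets of positive measure: inner boxes and negligible boundary\<close>

definition convex_in :: "nat \<Rightarrow> vec set \<Rightarrow> bool" where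
  "convex_in d D \<longleftrightarrow> (\<forall>x\<in>D. \<forall>y\<in>D. \<forall>s\<in>{0<..<1}. lincomb d (1 - s) x s y \<in> D)"

lemma lincomb_in_Rd [simp]: "lincomb d r x s y \<in> Rd d"
  by (simp add: lincomb_def)

text \<open>The homothety with center \<open>x\<close> and ratio \<open>s\<close> maps the box about
  \<open>c\<close> onto the box about the convex combination; \<open>y\<close> in the proof is the
  preimage of \<open>z\<close>.\<close>

lemma box_toward_interior:
  assumes D: "D \<subseteq> Rd d" "convex_in d D" and x: "x \<in> D" and c: "bx d c r \<subseteq> D" "c \<in> Rd d" "0 < r"
    and s: "0 < s" "s < 1"
  shows "bx d (lincomb d (1 - s) x s c) (s * r) \<subseteq> D"
proof
  fix z assume z: "z \<in> bx d (lincomb d (1 - s) x s c) (s * r)"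
  define y where "y = (\<lambda>i\<in>{..<d}. (z i - (1 - s) * x i) / s)"
  have "y \<in> bx d c r"
  proof -
    have "\<bar>y i - c i\<bar> < r" if "i < d" for i
    proof -
      have "y i - c i = (z i - ((1 - s) * x i + s * c i)) / s" using that s by (simp add: y_def field_simps)
      then show ?thesis using z that s by (simp add: bx_def lincomb_def abs_divide divide_less_eq mult.commute)
    qed
    then show ?thesis by (simp add: bx_def y_def)
  qed
  then have "lincomb d (1 - s) x s y \<in> D" using D(2) x c s unfolding convex_in_def by auto
  moreover have "lincomb d (1 - s) x s y = z"
    using z s by (auto simp: lincomb_def y_def bx_def fun_eq_iff restrict_def PiE_def extensional_def)
  ultimately show "z \<in> D" by simp
qed

lemma lincomb_interior:
  assumes D: "D \<subseteq> Rd d" "convex_in d D" and x: "x \<in> D" and c: "c \<in> Rd_top d interior_of D"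
    and s: "0 < s" "s < 1"
  shows "lincomb d (1 - s) x s c \<in> Rd_top d interior_of D"
proof -
  obtain r where r: "r > 0" "bx d c r \<subseteq> D" "c \<in> D" using c unfolding mem_interior_Rd_iff[OF D(1)] by auto
  have sub: "bx d (lincomb d (1 - s) x s c) (s * r) \<subseteq> D"
    using box_toward_interior[OF D x r(2) _ r(1) s] r D by auto
  then have "lincomb d (1 - s) x s c \<in> D"
    using bx_center[of "lincomb d (1 - s) x s c" d "s * r"] r s by auto
  then show ?thesis unfolding mem_interior_Rd_iff[OF D(1)] using sub r s by (auto intro!: exI[of _ "s * r"])
qed

text \<open>By Fubini the slices of \<open>D\<close> have positive measure at two different heights
  of the last coordinate. Induction gives a box in each of these slices, and the convex hull of two
  boxes at different heights contains a full-dimensional box halfway between them.\<close>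

lemma convex_positive_measure_box:
  assumes "D \<in> sets (Rd_lborel d)" "convex_in d D" "emeasure (Rd_lborel d) D > 0"
  shows "\<exists>c r. c \<in> Rd d \<and> 0 < r \<and> bx d c r \<subseteq> D"
  using assms
proof (induction d arbitrary: D)
  case 0
  then obtain x where "x \<in> D" by fastforce
  moreover have "D \<subseteq> Rd 0" using sets.sets_into_space[OF 0(1)] by (simp add: space_PiM)
  ultimately show ?case by (intro exI[of _ x] exI[of _ 1]) (auto simp: bx_def)
next
  case (Suc d)
  interpret product_sigma_finite "\<lambda>_::nat. lborel :: real measure" ..
  have ins: "{..<Suc d} = insert d {..<d}" by auto
  have DRd: "D \<subseteq> Rd (Suc d)" using sets.sets_into_space[OF Suc.prems(1)] by (simp add: space_PiM)
  define E where "E s = {x \<in> Rd d. x(d := s) \<in> D}" for s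
  have E: "E s \<in> sets (Rd_lborel d)" for s
  proof -
    have "(\<lambda>x. x(d := s)) \<in> measurable (Rd_lborel d) (Rd_lborel (Suc d))"
      unfolding ins by (rule measurable_fun_upd[of _ "{..<d}"]) auto
    from measurable_sets[OF this Suc.prems(1)] show ?thesis
      by (simp add: E_def vimage_def Int_def space_PiM conj_commute)
  qed
  have "emeasure (Rd_lborel (Suc d)) D = (\<integral>\<^sup>+x. indicator D x \<partial>Rd_lborel (Suc d))"
    using Suc.prems by simp
  also have "\<dots> = (\<integral>\<^sup>+s. (\<integral>\<^sup>+x. indicator D (x(d := s)) \<partial>Rd_lborel d) \<partial>lborel)"
    unfolding ins by (rule product_nn_integral_insert_rev) (use Suc.prems(1) ins in auto)
  also have "\<dots> = (\<integral>\<^sup>+s. emeasure (Rd_lborel d) (E s) \<partial>lborel)"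
  proof (rule nn_integral_cong)
    fix s
    have "(\<integral>\<^sup>+x. indicator D (x(d := s)) \<partial>Rd_lborel d) = (\<integral>\<^sup>+x. indicator (E s) x \<partial>Rd_lborel d)"
      by (intro nn_integral_cong) (auto simp: E_def space_PiM indicator_def)
    then show "(\<integral>\<^sup>+x. indicator D (x(d := s)) \<partial>Rd_lborel d) = emeasure (Rd_lborel d) (E s)"
      using E by simp
  qed
  finally have pos: "(\<integral>\<^sup>+s. emeasure (Rd_lborel d) (E s) \<partial>lborel) > 0" using Suc.prems(3) by simp
  obtain s1 where s1: "emeasure (Rd_lborel d) (E s1) > 0"
    using pos by (metis not_gr_zero nn_integral_cong nn_integral_0_iff_AE nn_integral_const mult_zero_left)
  \<comment> \<open>If slices of positive measure occurred at the single height \<open>s1\<close>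
    only, the integral over the heights would vanish.\<close>
  obtain s2 where s2: "emeasure (Rd_lborel d) (E s2) > 0" "s2 \<noteq> s1"
  proof (rule ccontr)
    assume "\<not> thesis"
    with that have z: "\<And>s. s \<noteq> s1 \<Longrightarrow> emeasure (Rd_lborel d) (E s) = 0" by (metis not_gr_zero)
    have "AE s in lborel. emeasure (Rd_lborel d) (E s) = 0"
      using AE_lborel_singleton[of s1] by eventually_elim (rule z)
    then have "(\<integral>\<^sup>+s. emeasure (Rd_lborel d) (E s) \<partial>lborel) = (\<integral>\<^sup>+(s::real). 0 \<partial>lborel)"
      by (rule nn_integral_cong_AE)
    then show False using pos by simp
  qed
  have conv: "convex_in d (E s)" for s
    unfolding convex_in_def
  proof (intro ballI)
    fix x y t assume xy: "x \<in> E s" "y \<in> E s" and t: "t \<in> {0<..<1::real}"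
    have "lincomb (Suc d) (1 - t) (x(d := s)) t (y(d := s)) \<in> D"
      using Suc.prems(2) xy t unfolding convex_in_def E_def by blast
    moreover have "lincomb (Suc d) (1 - t) (x(d := s)) t (y(d := s)) = (lincomb d (1 - t) x t y)(d := s)"
      by (auto simp: lincomb_def fun_eq_iff restrict_def algebra_simps)
    ultimately show "lincomb d (1 - t) x t y \<in> E s" by (simp add: E_def)
  qed
  obtain c1 r1 where c1: "c1 \<in> Rd d" "0 < r1" "bx d c1 r1 \<subseteq> E s1" using Suc.IH[OF E conv s1] by blast
  obtain c2 r2 where c2: "c2 \<in> Rd d" "0 < r2" "bx d c2 r2 \<subseteq> E s2" using Suc.IH[OF E conv s2(1)] by blast
  define \<Delta> where "\<Delta> = s2 - s1"
  define m where "m = (\<Sum>i<d. \<bar>c2 i - c1 i\<bar>)"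
  define r where "r = min r1 r2"
  \<comment> \<open>The bound by half the height difference keeps the weight \<open>\<theta>\<close>
    strictly between 0 and 1. The other bound pays for the tilt: a point off the middle height sees
    the interpolated center moved by at most \<open>\<rho> / \<bar>\<Delta>\<bar> * m\<close> in
    each coordinate.\<close>
  define \<rho> where "\<rho> = min (r / (1 + m / \<bar>\<Delta>\<bar>)) (\<bar>\<Delta>\<bar> / 2)"
  have \<Delta>: "\<bar>\<Delta>\<bar> > 0" using s2 by (simp add: \<Delta>_def)
  have m0: "m \<ge> 0" by (simp add: m_def sum_nonneg)
  have r0: "r > 0" using c1 c2 by (simp add: r_def)
  have mp: "1 + m / \<bar>\<Delta>\<bar> > 0" using m0 \<Delta> by (simp add: add_pos_nonneg)
  have \<rho>0: "\<rho> > 0" using r0 mp \<Delta> by (simp add: \<rho>_def)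
  define c where "c = (midpt d c1 c2)(d := (s1 + s2) / 2)"
  have "c \<in> Rd (Suc d)" by (auto simp: c_def midpt_def PiE_def extensional_def)
  moreover have "bx (Suc d) c \<rho> \<subseteq> D"
  proof
    fix x assume x: "x \<in> bx (Suc d) c \<rho>"
    define \<theta> where "\<theta> = (x d - s1) / \<Delta>"
    have xd: "\<bar>x d - (s1 + s2) / 2\<bar> < \<rho>" using x unfolding bx_def by (metis (mono_tags, lifting) c_def fun_upd_same lessI mem_Collect_eq)
    have th: "\<theta> - 1/2 = (x d - (s1 + s2) / 2) / \<Delta>"
      using \<Delta> by (simp add: \<theta>_def \<Delta>_def field_simps)
    have th': "\<bar>\<theta> - 1/2\<bar> < \<rho> / \<bar>\<Delta>\<bar>" unfolding th abs_divide using xd \<Delta> by (intro divide_strict_right_mono) auto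
    also have "\<dots> \<le> (\<bar>\<Delta>\<bar> / 2) / \<bar>\<Delta>\<bar>" unfolding \<rho>_def by (rule divide_right_mono[OF min.cobounded2]) simp
    also have "\<dots> = 1/2" using \<Delta> by simp
    finally have \<theta>: "0 < \<theta>" "\<theta> < 1" by linarith+
    \<comment> \<open>Offset of \<open>x\<close> from the center interpolated at its own height.
      Adding the same offset to both centers gives points of the two boxes whose convex combination
      with weight \<open>\<theta>\<close> is \<open>x\<close>.\<close>
    define \<delta> where "\<delta> i = x i - ((1 - \<theta>) * c1 i + \<theta> * c2 i)" for i
    have \<delta>: "\<bar>\<delta> i\<bar> < r" if i: "i < d" for i
    proof -
      have "\<delta> i = (x i - (c1 i + c2 i) / 2) - (\<theta> - 1/2) * (c2 i - c1 i)" by (simp add: \<delta>_def field_simps)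
      then have "\<bar>\<delta> i\<bar> \<le> \<bar>x i - (c1 i + c2 i) / 2\<bar> + \<bar>\<theta> - 1/2\<bar> * \<bar>c2 i - c1 i\<bar>"
        by (metis abs_mult abs_triangle_ineq4)
      also have "\<bar>x i - (c1 i + c2 i) / 2\<bar> < \<rho>"
      proof -
        have "\<bar>x i - c i\<bar> < \<rho>" using x i by (simp add: bx_def)
        then show ?thesis using i by (simp add: c_def midpt_def)
      qed
      also have "\<bar>\<theta> - 1/2\<bar> * \<bar>c2 i - c1 i\<bar> \<le> \<rho> / \<bar>\<Delta>\<bar> * m"
      proof (rule mult_mono)
        show "\<bar>c2 i - c1 i\<bar> \<le> m" unfolding m_def using i by (intro member_le_sum) auto
      qed (use th' \<rho>0 in auto)
      also have "\<rho> + \<rho> / \<bar>\<Delta>\<bar> * m = \<rho> * (1 + m / \<bar>\<Delta>\<bar>)" by (simp add: algebra_simps)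
      also have "\<dots> \<le> r / (1 + m / \<bar>\<Delta>\<bar>) * (1 + m / \<bar>\<Delta>\<bar>)" using mp by (intro mult_right_mono) (auto simp: \<rho>_def)
      also have "\<dots> = r" using mp by simp
      finally show ?thesis by simp
    qed
    define y1 where "y1 = (\<lambda>i\<in>{..<d}. c1 i + \<delta> i)"
    define y2 where "y2 = (\<lambda>i\<in>{..<d}. c2 i + \<delta> i)"
    have "y1 \<in> bx d c1 r1" "y2 \<in> bx d c2 r2" using \<delta> by (auto simp: bx_def y1_def y2_def r_def)
    then have "y1(d := s1) \<in> D" "y2(d := s2) \<in> D" using c1 c2 by (auto simp: E_def)
    then have "lincomb (Suc d) (1 - \<theta>) (y1(d := s1)) \<theta> (y2(d := s2)) \<in> D"
      using Suc.prems(2) \<theta> unfolding convex_in_def by auto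
    moreover have "lincomb (Suc d) (1 - \<theta>) (y1(d := s1)) \<theta> (y2(d := s2)) = x"
    proof
      fix i
      consider "i < d" | "i = d" | "i > d" by linarith
      then show "lincomb (Suc d) (1 - \<theta>) (y1(d := s1)) \<theta> (y2(d := s2)) i = x i"
      proof cases
        case 1
        then show ?thesis by (simp add: lincomb_def y1_def y2_def \<delta>_def algebra_simps)
      next
        case 2
        have "x d = s1 + \<theta> * \<Delta>" using \<Delta> by (simp add: \<theta>_def)
        then show ?thesis using 2 by (simp add: lincomb_def \<Delta>_def algebra_simps)
      next
        case 3
        then show ?thesis using x by (simp add: lincomb_def bx_def PiE_def extensional_def)
      qed
    qed
    ultimately show "x \<in> D" by simp
  qed
  ultimately show ?case using \<rho>0 by blast
qed

text \<open>Dilation about the interior point \<open>c\<close> with ratio \<open>s < 1\<close> maps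
  \<open>D\<close> into its interior and multiplies volumes by \<open>s ^ d\<close>. As
  \<open>s\<close> tends to 1, the interior has at least the measure of \<open>D\<close>.
  Intersecting with boxes about \<open>c\<close>, which the dilation respects, makes the measures
  finite so that they can be subtracted.\<close>

lemma convex_minus_interior_null:
  assumes D: "D \<in> sets (Rd_lborel d)" "convex_in d D" and c: "c \<in> Rd_top d interior_of D"
  shows "D - Rd_top d interior_of D \<in> null_sets (Rd_lborel d)"
proof -
  let ?I = "Rd_top d interior_of D"
  have DRd: "D \<subseteq> Rd d" using sets.sets_into_space[OF D(1)] by (simp add: space_PiM)
  have I[measurable]: "?I \<in> sets (Rd_lborel d)" by (rule open_sets_Rd_lborel) simp
  have cD: "c \<in> D" using c interior_of_subset[of "Rd_top d" D] by (rule rev_subsetD)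
  have bxm[measurable]: "bx d c r \<in> sets (Rd_lborel d)" for r by (rule open_sets_Rd_lborel[OF openin_bx])
  note [measurable] = D(1)
  interpret product_sigma_finite "\<lambda>_::nat. lborel :: real measure" ..
  have fin: "emeasure (Rd_lborel d) (bx d c r) < \<infinity>" for r
  proof -
    have "emeasure lborel {a<..<b} \<noteq> \<top>" for a b :: real
      by (cases "a \<le> b") auto
    then show ?thesis
      unfolding bx_eq_PiE by (subst emeasure_PiM) (auto simp: ennreal_prod_eq_top less_top[symmetric])
  qed
  have null: "(D \<inter> bx d c (real n)) - ?I \<in> null_sets (Rd_lborel d)" for n
  proof -
    let ?B = "D \<inter> bx d c (real n)"
    have B[measurable]: "?B \<in> sets (Rd_lborel d)" by measurable
    have finB: "emeasure (Rd_lborel d) ?B < \<infinity>"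
      by (rule le_less_trans[OF emeasure_mono fin[of n]]) auto
    have finIB: "emeasure (Rd_lborel d) (?I \<inter> ?B) < \<infinity>"
      by (rule le_less_trans[OF emeasure_mono finB]) auto
    have scale: "ennreal (s ^ d) * emeasure (Rd_lborel d) ?B \<le> emeasure (Rd_lborel d) (?I \<inter> ?B)"
      if s: "0 < s" "s < 1" for s
    proof -
      have "ennreal (s ^ d) * emeasure (Rd_lborel d) ?B
          = ennreal (s ^ d) * (\<integral>\<^sup>+y. indicator ?B y \<partial>Rd_lborel d)" by simp
      also have "\<dots> \<le> ennreal (s ^ d) * (\<integral>\<^sup>+y. indicator (?I \<inter> ?B) (\<lambda>i\<in>{..<d}. (1 - s) * c i + s * y i) \<partial>Rd_lborel d)"
      proof (intro mult_left_mono nn_integral_mono)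
        fix y assume "y \<in> space (Rd_lborel d)"
        show "indicator ?B y \<le> (indicator (?I \<inter> ?B) (\<lambda>i\<in>{..<d}. (1 - s) * c i + s * y i) :: ennreal)"
        proof (cases "y \<in> ?B")
          case True
          have eq: "(\<lambda>i\<in>{..<d}. (1 - s) * c i + s * y i) = lincomb d (1 - (1 - s)) y (1 - s) c"
            by (auto simp: lincomb_def)
          have "lincomb d (1 - (1 - s)) y (1 - s) c \<in> ?I"
            by (rule lincomb_interior[OF DRd D(2) _ c]) (use True s in auto)
          moreover have "lincomb d (1 - (1 - s)) y (1 - s) c \<in> bx d c (real n)"
          proof -
            have "\<bar>(s * y i + (1 - s) * c i) - c i\<bar> < real n" if i: "i < d" for i
            proof -
              have "(s * y i + (1 - s) * c i) - c i = s * (y i - c i)" by (simp add: algebra_simps)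
              moreover have "\<bar>y i - c i\<bar> < real n" using True i by (auto simp: bx_def)
              moreover have "s * \<bar>y i - c i\<bar> \<le> 1 * \<bar>y i - c i\<bar>" using s by (intro mult_right_mono) auto
              ultimately show ?thesis using s by (simp add: abs_mult)
            qed
            then show ?thesis by (simp add: bx_def) (simp add: lincomb_def)
          qed
          moreover have "?I \<subseteq> D" by (rule interior_of_subset)
          ultimately show ?thesis unfolding eq by (auto simp: indicator_def)
        qed simp
      qed simp
      also have "\<dots> = (\<integral>\<^sup>+y. indicator (?I \<inter> ?B) y \<partial>Rd_lborel d)"
        by (subst nn_integral_PiM_affine[of "{..<d}" s "indicator (?I \<inter> ?B)" "\<lambda>i. (1 - s) * c i"])
           (use s in auto)
      finally show ?thesis by simp
    qed
    define b where "b = measure (Rd_lborel d) ?B"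
    define e where "e = measure (Rd_lborel d) (?I \<inter> ?B)"
    have be: "emeasure (Rd_lborel d) ?B = ennreal b" "emeasure (Rd_lborel d) (?I \<inter> ?B) = ennreal e"
      unfolding b_def e_def using finB finIB by (simp_all add: emeasure_eq_ennreal_measure)
    have sle: "s ^ d * b \<le> e" if "0 < s" "s < 1" for s
      using scale[OF that] that unfolding be by (simp add: e_def b_def flip: ennreal_mult)
    have "((\<lambda>s. s ^ d * b) \<longlongrightarrow> 1 ^ d * b) (at_left (1::real))" by (intro tendsto_intros)
    then have "1 ^ d * b \<le> e"
    proof (rule tendsto_upperbound)
      show "\<forall>\<^sub>F s in at_left 1. s ^ d * b \<le> e"
        using eventually_at_left_field[of "\<lambda>s. s ^ d * b \<le> e" 1] sle by (auto intro!: exI[of _ 0])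
    qed simp
    then have le: "emeasure (Rd_lborel d) ?B \<le> emeasure (Rd_lborel d) (?I \<inter> ?B)" unfolding be by (simp add: ennreal_leI)
    have "emeasure (Rd_lborel d) (?B - ?I) = emeasure (Rd_lborel d) (?B - ?I \<inter> ?B)"
      by (intro arg_cong2[where f=emeasure]) auto
    also have "\<dots> = emeasure (Rd_lborel d) ?B - emeasure (Rd_lborel d) (?I \<inter> ?B)"
      using finIB by (intro emeasure_Diff) auto
    also have "\<dots> = 0" using le finB by (simp add: diff_eq_0_iff_ennreal less_top)
    finally show ?thesis by (intro null_setsI) auto
  qed
  have "(\<Union>n. (D \<inter> bx d c (real n)) - ?I) \<in> null_sets (Rd_lborel d)"
    by (intro null_sets_UN null)
  moreover have "(\<Union>n. (D \<inter> bx d c (real n)) - ?I) = D - ?I"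
  proof -
    have "\<exists>n. x \<in> bx d c (real n)" if "x \<in> D" for x
    proof -
      obtain n where n: "(\<Sum>i<d. \<bar>x i - c i\<bar>) < real n" using reals_Archimedean2 by blast
      have "\<bar>x i - c i\<bar> < real n" if "i < d" for i
        using member_le_sum[of i "{..<d}" "\<lambda>i. \<bar>x i - c i\<bar>"] that n by simp
      then show ?thesis using that DRd by (auto simp: bx_def)
    qed
    then show ?thesis by blast
  qed
  ultimately show ?thesis by simp
qed

section \<open>Derivatives along segments and strong midpoint convexity\<close>

lemma partial_increment:
  assumes S: "openin (Rd_top d) S" and box: "bx d z r \<subseteq> S" and k: "k < d"
    and D: "\<And>x. x \<in> S \<Longrightarrow> has_partial g (G x) k x"
    and close: "\<And>y. y \<in> bx d z r \<Longrightarrow> \<bar>G y - G z\<bar> \<le> e"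
    and y: "y \<in> bx d z r" "y(k := y k + h) \<in> bx d z r"
  shows "\<bar>g (y(k := y k + h)) - g y - h * G z\<bar> \<le> \<bar>h\<bar> * e"
proof (cases "h = 0")
  case True
  then show ?thesis by simp
next
  case False
  define \<phi> where "\<phi> s = g (y(k := y k + s * h))" for s
  have inbx: "y(k := y k + s * h) \<in> bx d z r" if "0 \<le> s" "s \<le> 1" for s
  proof -
    have "\<bar>y i - z i\<bar> < r" if "i < d" for i using y(1) that by (simp add: bx_def)
    moreover have "\<bar>y k + s * h - z k\<bar> < r"
    proof -
      have a: "\<bar>y k - z k\<bar> < r" using y(1) k by (simp add: bx_def)
      have b: "\<bar>y k + h - z k\<bar> < r" using y(2) k unfolding bx_def by (metis (mono_tags, lifting) fun_upd_same mem_Collect_eq)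
      have eq: "y k + s * h - z k = (1 - s) * (y k - z k) + s * (y k + h - z k)" by (simp add: algebra_simps)
      have "\<bar>y k + s * h - z k\<bar> \<le> (1 - s) * \<bar>y k - z k\<bar> + s * \<bar>y k + h - z k\<bar>"
        unfolding eq using that by (intro order_trans[OF abs_triangle_ineq]) (simp add: abs_mult)
      also have "\<dots> < r" using convex_bound_lt[OF a b, of "1 - s" s] that by simp
      finally show ?thesis .
    qed
    moreover have "y(k := y k + s * h) \<in> Rd d" using y(1) k by (auto simp: bx_def PiE_def extensional_def)
    ultimately show ?thesis by (auto simp: bx_def)
  qed
  have der: "(\<phi> has_real_derivative G (y(k := y k + s * h)) * h) (at s)" if "0 \<le> s" "s \<le> 1" for s
  proof -
    have "has_partial g (G (y(k := y k + s * h))) k (y(k := y k + s * h))" using D inbx[OF that] box by auto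
    then have "((\<lambda>t. g (y(k := t))) has_real_derivative G (y(k := y k + s * h))) (at (y k + s * h))"
      by (simp add: has_partial_def)
    moreover have "((\<lambda>s. y k + s * h) has_real_derivative h) (at s)" by (auto intro!: derivative_eq_intros)
    ultimately show ?thesis unfolding \<phi>_def by (rule DERIV_chain2[where f="\<lambda>t. g (y(k := t))"])
  qed
  obtain s where s: "0 < s" "s < 1" "\<phi> 1 - \<phi> 0 = (1 - 0) * (G (y(k := y k + s * h)) * h)"
    using MVT2[of 0 1 \<phi> "\<lambda>s. G (y(k := y k + s * h)) * h"] der by auto
  have "g (y(k := y k + h)) - g y - h * G z = h * (G (y(k := y k + s * h)) - G z)"
    using s(3) by (simp add: \<phi>_def algebra_simps)
  then show ?thesis using close[OF inbx[of s]] s by (simp add: abs_mult mult_left_mono)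
qed

text \<open>Chain rule along a line for a function with continuous partial derivatives: change the
  coordinates one at a time and apply the mean value theorem to each of them.\<close>

lemma line_derivative:
  assumes S: "openin (Rd_top d) S"
    and D: "\<And>i x. i < d \<Longrightarrow> x \<in> S \<Longrightarrow> has_partial g (G i x) i x"
    and cont: "\<And>i. i < d \<Longrightarrow> continuous_map (subtopology (Rd_top d) S) euclideanreal (G i)"
    and in_S: "(\<lambda>i\<in>{..<d}. x i + s * w i) \<in> S"
  shows "((\<lambda>s. g (\<lambda>i\<in>{..<d}. x i + s * w i)) has_real_derivative
    (\<Sum>i<d. G i (\<lambda>i\<in>{..<d}. x i + s * w i) * w i)) (at s)"
  unfolding has_field_derivative_def has_derivative_at_alt
proof (intro conjI allI impI bounded_linear_mult_right)
  fix e :: real assume e: "0 < e"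
  define z where "z = (\<lambda>i\<in>{..<d}. x i + s * w i)"
  define W where "W = (\<Sum>i<d. \<bar>w i\<bar>)"
  have W0: "W \<ge> 0" by (simp add: W_def sum_nonneg)
  \<comment> \<open>The summand 1 covers the direction \<open>w = 0\<close>, for which
    \<open>W\<close> vanishes.\<close>
  define e' where "e' = e / (1 + W)"
  have e': "e' > 0" using e W0 by (simp add: e'_def)
  have "\<forall>i\<in>{..<d}. \<exists>r>0. bx d z r \<subseteq> S \<and> (\<forall>y\<in>bx d z r. \<bar>G i y - G i z\<bar> < e')"
    using continuous_Rd_box[OF cont S _ e'] in_S by (auto simp: z_def)
  then obtain R where R: "\<And>i. i \<in> {..<d} \<Longrightarrow> R i > (0::real)" 
    "\<And>i. i \<in> {..<d} \<Longrightarrow> bx d z (R i) \<subseteq> S \<and> (\<forall>y\<in>bx d z (R i). \<bar>G i y - G i z\<bar> < e')" by metis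
  obtain r0 where r0: "r0 > 0" "bx d z r0 \<subseteq> S" using S in_S unfolding openin_Rd_iff z_def by blast
  define r where "r = Min (insert r0 (R ` {..<d}))"
  have r: "r > 0" "r \<le> r0" "\<And>i. i < d \<Longrightarrow> r \<le> R i" using R(1) r0 by (auto simp: r_def)
  have close: "\<bar>G i y - G i z\<bar> \<le> e'" if "i < d" "y \<in> bx d z r" for i y
    using R(2)[of i] that r(3)[OF that(1)] bx_mono[of r "R i" d z] by fastforce
  have box: "bx d z r \<subseteq> S" using bx_mono[OF r(2)] r0(2) by blast
  have main: "\<bar>g (\<lambda>i\<in>{..<d}. x i + t * w i) - g z - (t - s) * (\<Sum>i<d. G i z * w i)\<bar> \<le> e * \<bar>t - s\<bar>"
    if t: "\<bar>t - s\<bar> < r / (1 + W)" for t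
  proof -
    define h where "h = t - s"
    define y where "y k = (\<lambda>i\<in>{..<d}. if i < k then z i + h * w i else z i)" for k
    have yin: "y k \<in> bx d z r" for k
    proof -
      have "\<bar>y k i - z i\<bar> < r" if i: "i < d" for i
      proof -
        have "\<bar>y k i - z i\<bar> \<le> \<bar>h\<bar> * \<bar>w i\<bar>" using i by (simp add: y_def abs_mult)
        also have "\<dots> \<le> \<bar>h\<bar> * (1 + W)"
          using member_le_sum[of i "{..<d}" "\<lambda>i. \<bar>w i\<bar>"] i by (intro mult_left_mono) (auto simp: W_def)
        also have "\<dots> < r" using t W0 by (simp add: h_def pos_less_divide_eq)
        finally show ?thesis .
      qed
      then show ?thesis by (simp add: bx_def y_def)
    qed
    have step: "\<bar>g (y (Suc k)) - g (y k) - h * w k * G k z\<bar> \<le> \<bar>h * w k\<bar> * e'" if k: "k < d" for k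
    proof -
      have eq: "y (Suc k) = (y k)(k := y k k + h * w k)"
        using k by (auto simp: y_def fun_eq_iff restrict_def less_Suc_eq)
      show ?thesis unfolding eq
        by (rule partial_increment[OF S box k D[OF k] close[OF k] yin]) (use yin[of "Suc k"] eq in auto)
    qed
    have tele: "(\<Sum>k<d. g (y (Suc k)) - g (y k)) = g (y d) - g (y 0)"
      by (rule sum_lessThan_telescope)
    have yd: "y d = (\<lambda>i\<in>{..<d}. x i + t * w i)" by (auto simp: y_def z_def h_def fun_eq_iff restrict_def algebra_simps)
    have y0: "y 0 = z" by (auto simp: y_def z_def fun_eq_iff restrict_def)
    have "g (\<lambda>i\<in>{..<d}. x i + t * w i) - g z - (t - s) * (\<Sum>i<d. G i z * w i)
        = (\<Sum>k<d. g (y (Suc k)) - g (y k) - h * w k * G k z)"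
      unfolding sum_subtractf[of "\<lambda>k. g (y (Suc k)) - g (y k)"] tele yd y0 h_def[symmetric]
      by (simp add: sum_distrib_left mult_ac)
    also have "\<bar>\<dots>\<bar> \<le> (\<Sum>k<d. \<bar>h * w k\<bar> * e')"
      by (intro order_trans[OF sum_abs] sum_mono step) simp
    also have "\<dots> = \<bar>h\<bar> * (W * e')" by (simp add: W_def abs_mult sum_distrib_left sum_distrib_right mult_ac)
    also have "\<dots> \<le> \<bar>h\<bar> * e"
    proof (rule mult_left_mono)
      have "W * e \<le> (1 + W) * e" using e by simp
      then show "W * e' \<le> e" using W0 by (simp add: e'_def divide_le_eq mult.commute)
    qed simp
    finally show ?thesis by (simp add: h_def mult.commute)
  qed
  show "\<exists>\<delta>>0. \<forall>t. norm (t - s) < \<delta> \<longrightarrow>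
      norm (g (\<lambda>i\<in>{..<d}. x i + t * w i) - g (\<lambda>i\<in>{..<d}. x i + s * w i) -
        (\<Sum>i<d. G i (\<lambda>i\<in>{..<d}. x i + s * w i) * w i) * (t - s)) \<le> e * norm (t - s)"
    using main r(1) W0 unfolding z_def
    by (intro exI[of _ "r / (1 + W)"]) (auto simp: mult.commute)
qed

text \<open>Along the segment, \<open>U\<close> minus \<open>q / 2 * s^2\<close> has nonnegative
  second derivative by the Hessian bound, hence is convex. At the midpoint the subtracted parabola
  lies \<open>q / 8\<close> below its chord.\<close>

lemma strong_midpoint_convexity:
  assumes S: "openin (Rd_top d) S" and C2: "C2_with d S U G H"
    and hess: "\<And>x w. x \<in> S \<Longrightarrow> (\<Sum>i<d. \<Sum>j<d. H i j x * w i * w j) \<ge> \<alpha> * (\<Sum>i<d. (w i)\<^sup>2)"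
    and seg: "\<And>s. 0 \<le> s \<Longrightarrow> s \<le> 1 \<Longrightarrow> lincomb d (1 - s) x s y \<in> S"
    and xy: "x \<in> Rd d" "y \<in> Rd d"
  shows "U (midpt d x y) \<le> (U x + U y) / 2 - \<alpha> * (rdist d x y)\<^sup>2 / 8"
proof -
  define w where "w i = y i - x i" for i
  define pt where "pt s = (\<lambda>i\<in>{..<d}. x i + s * w i)" for s
  have pt_eq: "pt s = lincomb d (1 - s) x s y" for s
    by (auto simp: pt_def w_def lincomb_def fun_eq_iff restrict_def algebra_simps)
  have ptS: "pt s \<in> S" if "s \<in> {0..1}" for s using seg that by (simp add: pt_eq)
  define q where "q = \<alpha> * (\<Sum>i<d. (w i)\<^sup>2)"
  define \<phi> where "\<phi> s = U (pt s) - q / 2 * s\<^sup>2" for s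
  define \<phi>1 where "\<phi>1 s = (\<Sum>i<d. G i (pt s) * w i) - q * s" for s
  define \<phi>2 where "\<phi>2 s = (\<Sum>i<d. (\<Sum>j<d. H i j (pt s) * w j) * w i) - q" for s
  have P: "\<And>i x. i < d \<Longrightarrow> x \<in> S \<Longrightarrow> has_partial U (G i x) i x"
      "\<And>i. i < d \<Longrightarrow> continuous_map (subtopology (Rd_top d) S) euclideanreal (G i)"
      "\<And>i j x. i < d \<Longrightarrow> j < d \<Longrightarrow> x \<in> S \<Longrightarrow> has_partial (G i) (H i j x) j x"
      "\<And>i j. i < d \<Longrightarrow> j < d \<Longrightarrow> continuous_map (subtopology (Rd_top d) S) euclideanreal (H i j)"
    using C2 unfolding C2_with_def by auto
  have d1: "(\<phi> has_real_derivative \<phi>1 s) (at s)" if s: "s \<in> {0..1}" for s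
  proof -
    have "((\<lambda>s. U (pt s)) has_real_derivative (\<Sum>i<d. G i (pt s) * w i)) (at s)"
      unfolding pt_def by (rule line_derivative[OF S P(1,2)]) (use ptS[OF s] in \<open>simp_all add: pt_def\<close>)
    then show ?thesis unfolding \<phi>_def[abs_def] \<phi>1_def by (auto intro!: derivative_eq_intros)
  qed
  have d2: "(\<phi>1 has_real_derivative \<phi>2 s) (at s)" if s: "s \<in> {0..1}" for s
  proof -
    have "((\<lambda>s. G i (pt s)) has_real_derivative (\<Sum>j<d. H i j (pt s) * w j)) (at s)" if i: "i < d" for i
      unfolding pt_def by (rule line_derivative[OF S P(3,4)[OF i]]) (use ptS[OF s] in \<open>simp_all add: pt_def\<close>)
    then have "((\<lambda>s. \<Sum>i<d. G i (pt s) * w i) has_real_derivative (\<Sum>i<d. (\<Sum>j<d. H i j (pt s) * w j) * w i)) (at s)"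
      by (intro DERIV_sum DERIV_cmult_right) auto
    then show ?thesis unfolding \<phi>1_def[abs_def] \<phi>2_def by (rule DERIV_diff) (auto intro!: derivative_eq_intros)
  qed
  have pos: "\<phi>2 s \<ge> 0" if s: "s \<in> {0..1}" for s
    using hess[OF ptS[OF s], of w] unfolding \<phi>2_def q_def by (simp add: sum_distrib_left mult_ac)
  have "convex_on {0..1} \<phi>"
    by (rule f''_ge0_imp_convex[OF _ d1 d2 pos]) auto
  then have "\<phi> ((1 - 1/2) *\<^sub>R 0 + (1/2) *\<^sub>R 1) \<le> (1 - 1/2) * \<phi> 0 + (1/2) * \<phi> 1"
    by (rule convex_onD) auto
  then have *: "\<phi> (1/2) \<le> (\<phi> 0 + \<phi> 1) / 2" by simp
  have "pt 0 = x" "pt 1 = y" "pt (1/2) = midpt d x y"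
    using xy by (auto simp: pt_def w_def midpt_def fun_eq_iff restrict_def PiE_def extensional_def field_simps)
  moreover have "q = \<alpha> * (rdist d x y)\<^sup>2"
    unfolding q_def w_def rdist_commute[of d x y] rdist_sq ..
  ultimately show ?thesis using * by (simp add: \<phi>_def power2_eq_square field_simps)
qed

section \<open>From weak log-concavity to the midpoint condition\<close>

lemma powr_le_one_plus: "0 \<le> t \<Longrightarrow> 0 < \<beta> \<Longrightarrow> \<beta> \<le> 1 \<Longrightarrow> t powr \<beta> \<le> 1 + t" for t \<beta> :: real
proof (cases "t \<le> 1")
  case True
  assume "0 \<le> t" "0 < \<beta>" "\<beta> \<le> 1"
  then have "t powr \<beta> \<le> 1 powr \<beta>" using True by (intro powr_mono2) auto
  then show ?thesis using \<open>0 \<le> t\<close> by simp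
next
  case False
  assume "0 \<le> t" "0 < \<beta>" "\<beta> \<le> 1"
  then have "t powr \<beta> \<le> t powr 1" using False by (intro powr_mono) auto
  then show ?thesis using False by simp
qed

text \<open>\<open>P\<close> is \<open>p\<close> cut off to the interior of its domain: the Hessian bound is available only there, and
  the rest of the convex domain is a null set. The minimizer \<open>m\<close> may lie on the boundary, where \<open>P\<close>
  vanishes, so it is replaced by a nearby interior point \<open>c\<close>.\<close>

lemma weakly_log_concave_reduction:
  assumes wlc: "weakly_log_concave_decomp d \<alpha> \<beta> K p u a" and arg: "is_arg_min u (\<lambda>x. x \<in> Rd d) m"
    and pos: "0 < \<alpha>" "0 < K" "0 < \<beta>" "\<beta> \<le> 1"
  obtains P c where "wlc_density d \<alpha> K P" "AE y in Rd_lborel d. p y = P y"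
    "c \<in> Rd d" "Rd_norm d c \<le> Rd_norm d m + 1"
    "\<And>y. y \<in> Rd d \<Longrightarrow> P y \<le> exp (1 + K + K * rdist d y c) * P c"
proof -
  have pm[measurable]: "p \<in> borel_measurable (Rd_lborel d)"
    and pprob: "prob_space (density (Rd_lborel d) (\<lambda>x. ennreal (p x)))"
    and peq: "\<And>x. x \<in> Rd d \<Longrightarrow> p x = (if u x = \<infinity> then 0 else exp (- real_of_ereal (u x) + a x))"
    and umin: "\<And>x. x \<in> Rd d \<Longrightarrow> u x \<noteq> -\<infinity>"
    and uconv: "\<And>x y s. x \<in> Rd d \<Longrightarrow> y \<in> Rd d \<Longrightarrow> 0 < s \<Longrightarrow> s < 1 \<Longrightarrow>
        u (lincomb d (1 - s) x s y) \<le> ereal (1 - s) * u x + ereal s * u y"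
    and alip: "\<And>x y. x \<in> Rd d \<Longrightarrow> y \<in> Rd d \<Longrightarrow> \<bar>a x - a y\<bar> \<le> K * (rdist d x y) powr \<beta>"
    using wlc unfolding weakly_log_concave_decomp_def convex_ereal_def rdist_def by auto
  define S where "S = Rd_top d interior_of Rd_support d p"
  obtain G H where C2: "C2_with d S (\<lambda>x. real_of_ereal (u x)) G H"
    and hess: "\<And>x w. x \<in> S \<Longrightarrow> (\<Sum>i<d. \<Sum>j<d. H i j x * w i * w j) \<ge> \<alpha> * (\<Sum>i<d. (w i)\<^sup>2)"
    using wlc unfolding weakly_log_concave_decomp_def S_def by auto
  have Sop: "openin (Rd_top d) S" by (simp add: S_def)
  define D where "D = {x \<in> Rd d. p x \<noteq> 0}"
  have DRd: "D \<subseteq> Rd d" by (auto simp: D_def)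
  have Dm[measurable]: "D \<in> sets (Rd_lborel d)"
  proof -
    have "{x \<in> space (Rd_lborel d). p x \<noteq> 0} \<in> sets (Rd_lborel d)" by measurable
    then show ?thesis by (simp add: D_def space_PiM)
  qed
  define U where "U x = real_of_ereal (u x)" for x
  \<comment> \<open>The exponential never vanishes, so the set where \<open>p\<close> is nonzero is
    the effective domain of \<open>u\<close>.\<close>
  have Dfin: "x \<in> D \<longleftrightarrow> x \<in> Rd d \<and> u x \<noteq> \<infinity>" for x by (cases "x \<in> Rd d") (simp_all add: D_def peq)
  have uU: "u x = ereal (U x)" if "x \<in> D" for x
    using that umin[of x] Dfin[of x] unfolding U_def by (cases "u x") auto
  have Uconv: "lincomb d (1 - s) x s y \<in> D" "U (lincomb d (1 - s) x s y) \<le> (1 - s) * U x + s * U y"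
    if "x \<in> D" "y \<in> D" "0 < s" "s < 1" for x y s
  proof -
    have le: "u (lincomb d (1 - s) x s y) \<le> ereal ((1 - s) * U x + s * U y)"
      using uconv[of x y s] that DRd uU by auto
    then have "u (lincomb d (1 - s) x s y) \<noteq> \<infinity>" by auto
    then show *: "lincomb d (1 - s) x s y \<in> D" unfolding Dfin by simp
    show "U (lincomb d (1 - s) x s y) \<le> (1 - s) * U x + s * U y" using le uU[OF *] by simp
  qed
  have conv: "convex_in d D" unfolding convex_in_def using Uconv(1) by auto
  have pint: "(\<integral>\<^sup>+x. ennreal (p x) \<partial>Rd_lborel d) = 1"
    using prob_space.emeasure_space_1[OF pprob] by (simp add: emeasure_density cong: nn_integral_cong)
  have "emeasure (Rd_lborel d) D \<noteq> 0"
  proof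
    assume "emeasure (Rd_lborel d) D = 0"
    then have "D \<in> null_sets (Rd_lborel d)" using Dm by (simp add: null_sets_def)
    then have "AE x in Rd_lborel d. x \<notin> D" by (rule AE_not_in)
    moreover have "AE x in Rd_lborel d. x \<in> Rd d" by (rule AE_I2) (simp add: space_PiM)
    ultimately have "AE x in Rd_lborel d. ennreal (p x) = 0" by eventually_elim (auto simp: D_def)
    then have "(\<integral>\<^sup>+x. ennreal (p x) \<partial>Rd_lborel d) = 0" by (subst nn_integral_0_iff_AE) auto
    then show False using pint by simp
  qed
  then have Dpos: "emeasure (Rd_lborel d) D > 0" by (simp add: zero_less_iff_neq_zero)
  define I where "I = Rd_top d interior_of D"
  obtain c0 r0 where c0: "c0 \<in> Rd d" "0 < r0" "bx d c0 r0 \<subseteq> D"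
    using convex_positive_measure_box[OF Dm conv Dpos] by blast
  have c0I: "c0 \<in> I" unfolding I_def mem_interior_Rd_iff[OF DRd] using c0 bx_center by blast
  have ID: "I \<subseteq> D" unfolding I_def by (rule interior_of_subset)
  \<comment> \<open>The Hessian bound is given on the interior of the support, that is, of the
    closure of \<open>D\<close>; this contains the interior of \<open>D\<close>.\<close>
  have IS: "I \<subseteq> S" unfolding I_def S_def Rd_support_def D_def[symmetric]
    by (rule interior_of_mono) (rule closure_of_subset, use DRd in simp)
  have Im[measurable]: "I \<in> sets (Rd_lborel d)" unfolding I_def by (rule open_sets_Rd_lborel) simp
  have null: "D - I \<in> null_sets (Rd_lborel d)"
    unfolding I_def by (rule convex_minus_interior_null[OF Dm conv]) (use c0I in \<open>simp add: I_def\<close>)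
  define P where "P x = p x * indicator I x" for x
  have Pm: "P \<in> borel_measurable (Rd_lborel d)" unfolding P_def by measurable
  have pexp: "p x = exp (- U x + a x)" if "x \<in> D" for x
    using that peq[of x] DRd Dfin[of x] by (auto simp: U_def)
  have Pexp: "P x = exp (- U x + a x)" if "x \<in> I" for x using that pexp ID by (auto simp: P_def)
  have Pnn: "0 \<le> P x" for x using pexp[of x] ID by (auto simp: P_def indicator_def)
  have AEp: "AE y in Rd_lborel d. p y = P y"
  proof -
    have "AE x in Rd_lborel d. x \<in> Rd d" by (rule AE_I2) (simp add: space_PiM)
    with AE_not_in[OF null] show ?thesis by eventually_elim (auto simp: P_def D_def indicator_def)
  qed
  \<comment> \<open>The Hoelder modulus is replaced by an affine one, uniformly in \<beta>. Each of
    the two half segments costs \<open>K * (1 + r / 2)\<close>, hence the total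
    \<open>2 * K + K * r\<close> in the locale.\<close>
  have amid: "a x + a y \<le> 2 * a (midpt d x y) + (2 * K + K * rdist d x y)" if "x \<in> Rd d" "y \<in> Rd d" for x y
  proof -
    have b: "\<bar>a x - a (midpt d x y)\<bar> \<le> K * (1 + rdist d x y / 2)" "\<bar>a y - a (midpt d x y)\<bar> \<le> K * (1 + rdist d x y / 2)"
    proof -
      have "K * (rdist d x y / 2) powr \<beta> \<le> K * (1 + rdist d x y / 2)"
        using powr_le_one_plus[of "rdist d x y / 2" \<beta>] pos by (intro mult_left_mono) auto
      moreover have "\<bar>a x - a (midpt d x y)\<bar> \<le> K * (rdist d x y / 2) powr \<beta>"
        using alip[of x "midpt d x y"] that by (simp add: rdist_midpt rdist_commute[of d x "midpt d x y"])
      moreover have "\<bar>a y - a (midpt d x y)\<bar> \<le> K * (rdist d x y / 2) powr \<beta>"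
        using alip[of y "midpt d x y"] that by (simp add: rdist_midpt rdist_commute[of d y "midpt d x y"])
      ultimately show "\<bar>a x - a (midpt d x y)\<bar> \<le> K * (1 + rdist d x y / 2)" "\<bar>a y - a (midpt d x y)\<bar> \<le> K * (1 + rdist d x y / 2)"
        by linarith+
    qed
    then have "a x + a y \<le> 2 * a (midpt d x y) + 2 * (K * (1 + rdist d x y / 2))" by linarith
    then show ?thesis by (simp add: algebra_simps)
  qed
  have mid: "P x * P y * exp (\<alpha> * (rdist d x y)\<^sup>2 / 4) \<le> exp (2 * K + K * rdist d x y) * (P (midpt d x y))\<^sup>2"
    if xy: "x \<in> Rd d" "y \<in> Rd d" for x y
  proof (cases "x \<in> I \<and> y \<in> I")
    case False
    then have "P x * P y = 0" by (auto simp: P_def)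
    then show ?thesis by (simp only: mult_zero_left) simp
  next
    case True
    have seg: "lincomb d (1 - s) x s y \<in> I" if "0 \<le> s" "s \<le> 1" for s
    proof -
      consider "s = 0" | "s = 1" | "0 < s" "s < 1" using \<open>0 \<le> s\<close> \<open>s \<le> 1\<close> by linarith
      then show ?thesis
      proof cases
        case 1
        then have "lincomb d (1 - s) x s y = x" using xy by (auto simp: lincomb_def fun_eq_iff restrict_def PiE_def extensional_def)
        then show ?thesis using True by simp
      next
        case 2
        then have "lincomb d (1 - s) x s y = y" using xy by (auto simp: lincomb_def fun_eq_iff restrict_def PiE_def extensional_def)
        then show ?thesis using True by simp
      next
        case 3
        then show ?thesis unfolding I_def using lincomb_interior[OF DRd conv] True ID unfolding I_def by blast
      qed
    qed
    have "midpt d x y = lincomb d (1 - 1/2) x (1/2) y" by (auto simp: midpt_def lincomb_def fun_eq_iff restrict_def)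
    then have mI: "midpt d x y \<in> I" using seg[of "1/2"] by simp
    have "U (midpt d x y) \<le> (U x + U y) / 2 - \<alpha> * (rdist d x y)\<^sup>2 / 8"
      unfolding U_def
      by (rule strong_midpoint_convexity[OF Sop C2 hess _ xy]) (use seg IS in auto)
    then have ineq: "- U x + a x + (- U y + a y) + \<alpha> * (rdist d x y)\<^sup>2 / 4
        \<le> 2 * K + K * rdist d x y + 2 * (- U (midpt d x y) + a (midpt d x y))"
      using amid[OF xy] by (simp add: field_simps)
    show ?thesis
      using True mI ineq by (simp only: Pexp exp_double[symmetric] mult_exp_exp) simp
  qed
  have Pint: "(\<integral>\<^sup>+x. ennreal (P x) \<partial>Rd_lborel d) = 1"
  proof -
    have "(\<integral>\<^sup>+x. ennreal (p x) \<partial>Rd_lborel d) = (\<integral>\<^sup>+x. ennreal (P x) \<partial>Rd_lborel d)"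
      by (rule nn_integral_cong_AE) (use AEp in auto)
    then show ?thesis using pint by simp
  qed
  have loc: "wlc_density d \<alpha> K P"
    by unfold_locales (use pos Pm Pnn mid Pint in auto)
  have mRd: "m \<in> Rd d" and mmin: "\<And>y. y \<in> Rd d \<Longrightarrow> u m \<le> u y"
    using arg unfolding is_arg_min_def by (auto simp: not_less)
  have c0D: "c0 \<in> D" using c0I ID by blast
  have "u m \<le> ereal (U c0)" using mmin[OF c0(1)] unfolding uU[OF c0D] .
  then have "u m \<noteq> \<infinity>" by (metis ereal_less_eq(1) PInfty_neq_ereal(1) top.extremum_uniqueI top_ereal_def)
  then have mD: "m \<in> D" unfolding Dfin using mRd by (rule conjI[rotated])
  have mU: "U m \<le> U y" if "y \<in> D" for y 
  proof -
    have "u m \<le> u y" by (rule mmin) (use that DRd in blast)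
    then show ?thesis unfolding uU[OF that] uU[OF mD] by (simp only: ereal_less_eq)
  qed
  \<comment> \<open>Small enough that moving from \<open>m\<close> towards \<open>c0\<close> by the
    fraction \<open>s\<close> raises \<open>U\<close> by at most 1 and changes the position by at
    most 1; the summand 2 forces \<open>s < 1\<close>.\<close>
  define s where "s = 1 / (2 + (U c0 - U m) + rdist d c0 m)"
  have den: "2 + (U c0 - U m) + rdist d c0 m \<ge> 2" using mU[OF c0D] rdist_nonneg[of d c0 m] by linarith
  have s: "0 < s" "s < 1" using den by (auto simp: s_def)
  have sb: "s * (U c0 - U m) \<le> 1" "s * rdist d c0 m \<le> 1"
    using den mU[OF c0D] by (simp_all add: s_def divide_le_eq)
  define c where "c = lincomb d (1 - s) m s c0"
  have cI: "c \<in> I" unfolding c_def I_def by (rule lincomb_interior[OF DRd conv mD _ s]) (use c0I in \<open>simp add: I_def\<close>)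
  have cU: "U c \<le> U m + 1"
  proof -
    have "U c \<le> (1 - s) * U m + s * U c0" unfolding c_def by (rule Uconv(2)[OF mD c0D s])
    then show ?thesis using sb(1) by (simp add: algebra_simps)
  qed
  have "(rdist d c m)\<^sup>2 = (s * rdist d c0 m)\<^sup>2"
    unfolding power_mult_distrib rdist_sq sum_distrib_left
    by (intro sum.cong) (auto simp: c_def lincomb_def power2_eq_square algebra_simps)
  then have "rdist d c m = s * rdist d c0 m" by (rule power2_eq_imp_eq) (use s in simp_all)
  then have cn: "Rd_norm d c \<le> Rd_norm d m + 1" using Rd_norm_le_rdist[of c d m] sb(2) by linarith
  have dom: "P y \<le> exp (1 + K + K * rdist d y c) * P c" if y: "y \<in> Rd d" for y
  proof (cases "y \<in> I")
    case False
    then have "P y = 0" by (simp add: P_def)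
    then show ?thesis using Pnn[of c] by simp
  next
    case True
    have "\<bar>a y - a c\<bar> \<le> K * (rdist d y c) powr \<beta>" by (rule alip) (use y cI ID DRd in auto)
    also have "\<dots> \<le> K * (1 + rdist d y c)"
      using powr_le_one_plus[of "rdist d y c" \<beta>] pos by (intro mult_left_mono) auto
    finally have "a y \<le> a c + K + K * rdist d y c" by (simp add: algebra_simps)
    moreover have "U m \<le> U y" using True ID mU by blast
    ultimately have "- U y + a y \<le> 1 + K + K * rdist d y c + (- U c + a c)" using cU by linarith
    then show ?thesis using True cI by (simp only: Pexp mult_exp_exp) simp
  qed
  show thesis by (rule that[OF loc AEp _ cn dom]) (use cI ID DRd in auto)
qed

section \<open>The posterior of the signal given the noisy observation\<close>

text \<open>The Gaussian likelihood of the observation \<open>x\<close> given the signal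
  \<open>y\<close>, without its normalizing factor: that factor does not depend on \<open>y\<close>
  and cancels in every posterior quantity.\<close>

definition ker :: "nat \<Rightarrow> real \<Rightarrow> real \<Rightarrow> vec \<Rightarrow> vec \<Rightarrow> real" where
  "ker d f s x y = exp (- (rdist d x (\<lambda>i. f * y i))\<^sup>2 / (2 * s\<^sup>2))"

lemma ker_pos [simp]: "0 < ker d f s x y"
  by (simp add: ker_def)

lemma ker_nonneg [simp]: "0 \<le> ker d f s x y"
  by (simp add: ker_def)

lemma ker_le_1: "ker d f s x y \<le> 1"
  by (simp add: ker_def)

lemma measurable_ker [measurable]:
  "(\<lambda>y. ker d f s x y) \<in> borel_measurable (Rd_lborel d)"
  "(\<lambda>(x, y). ker d f s x y) \<in> borel_measurable (Rd_lborel d \<Otimes>\<^sub>M Rd_lborel d)"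
  unfolding ker_def rdist_def L2_set_def split_beta' by measurable

text \<open>With \<open>u = \<bar>t\<bar> / s\<close> the derivative has absolute value
  \<open>u * exp (- u^2 / 2) / s\<close>, and
  \<open>u \<le> 1 + u^2 / 2 \<le> exp (u^2 / 2)\<close>.\<close>

lemma gauss_lipschitz:
  fixes s t t' :: real
  assumes s: "0 < s"
  shows "\<bar>exp (- t\<^sup>2 / (2 * s\<^sup>2)) - exp (- t'\<^sup>2 / (2 * s\<^sup>2))\<bar> \<le> \<bar>t - t'\<bar> / s"
proof -
  let ?g = "\<lambda>t. exp (- t\<^sup>2 / (2 * s\<^sup>2))"
  have der: "(?g has_real_derivative - t / s\<^sup>2 * ?g t) (at t)" for t
    using s by (auto intro!: derivative_eq_intros simp: field_simps power2_eq_square)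
  have bnd: "\<bar>- t / s\<^sup>2 * ?g t\<bar> \<le> 1 / s" for t
  proof -
    have "\<bar>t\<bar> / s \<le> 1 + (t / s)\<^sup>2 / 2"
    proof -
      have "0 \<le> (\<bar>t\<bar> / s)\<^sup>2 - 2 * (\<bar>t\<bar> / s) + 1"
        using zero_le_power2[of "\<bar>t\<bar> / s - 1"] by (simp add: power2_diff)
      then show ?thesis by (simp add: power_divide)
    qed
    also have "\<dots> \<le> exp ((t / s)\<^sup>2 / 2)" by (rule exp_ge_add_one_self)
    finally have "\<bar>t\<bar> / s * exp (- (t / s)\<^sup>2 / 2) \<le> exp ((t / s)\<^sup>2 / 2) * exp (- (t / s)\<^sup>2 / 2)"
      by (rule mult_right_mono) simp
    then have "\<bar>t\<bar> / s * exp (- (t / s)\<^sup>2 / 2) \<le> 1" unfolding mult_exp_exp by simp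
    moreover have "\<bar>- t / s\<^sup>2 * ?g t\<bar> = (1 / s) * (\<bar>t\<bar> / s * exp (- (t / s)\<^sup>2 / 2))"
      using s by (simp add: abs_mult power_divide power2_eq_square)
    ultimately show ?thesis using s mult_left_mono[of "\<bar>t\<bar> / s * exp (- (t / s)\<^sup>2 / 2)" 1 "1 / s"] by simp
  qed
  have *: "\<bar>?g b - ?g a\<bar> \<le> (b - a) / s" if ab: "a < b" for a b
  proof -
    obtain z where "?g b - ?g a = (b - a) * (- z / s\<^sup>2 * ?g z)"
      using MVT2[OF ab, of ?g "\<lambda>t. - t / s\<^sup>2 * ?g t"] der by auto
    then have "\<bar>?g b - ?g a\<bar> = (b - a) * \<bar>- z / s\<^sup>2 * ?g z\<bar>" using ab by (simp add: abs_mult)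
    also have "\<dots> \<le> (b - a) * (1 / s)" using ab by (intro mult_left_mono bnd) auto
    finally show ?thesis by simp
  qed
  consider "t < t'" | "t = t'" | "t' < t" by linarith
  then show ?thesis
    using *[of t t'] *[of t' t] by cases (auto simp: abs_minus_commute)
qed

lemma ker_lipschitz: "0 < s \<Longrightarrow> \<bar>ker d f s x y - ker d f s x' y\<bar> \<le> rdist d x x' / s"
  unfolding ker_def
  by (rule order_trans[OF gauss_lipschitz]) (auto intro!: divide_right_mono rdist_lipschitz)

lemma rdist_scaled_midpt:
  "(rdist d x (\<lambda>i. f * midpt d y z i))\<^sup>2
    = ((rdist d x (\<lambda>i. f * y i))\<^sup>2 + (rdist d x (\<lambda>i. f * z i))\<^sup>2) / 2 - f\<^sup>2 * (rdist d y z)\<^sup>2 / 4"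
proof -
  have "(x i - f * ((y i + z i) / 2))\<^sup>2
      = ((x i - f * y i)\<^sup>2 + (x i - f * z i)\<^sup>2) / 2 - f\<^sup>2 * (y i - z i)\<^sup>2 / 4" for i
    by (simp add: power2_eq_square field_simps)
  then have "(rdist d x (\<lambda>i. f * midpt d y z i))\<^sup>2
      = (\<Sum>i<d. ((x i - f * y i)\<^sup>2 + (x i - f * z i)\<^sup>2) / 2 - f\<^sup>2 * (y i - z i)\<^sup>2 / 4)"
    unfolding rdist_sq by (intro sum.cong) (auto simp: midpt_def)
  then show ?thesis
    unfolding rdist_sq by (simp add: sum_subtractf sum.distrib sum_divide_distrib[symmetric] sum_distrib_left[symmetric])
qed

text \<open>An equality, since by the parallelogram identity the midpoint deficit of a quadratic
  exponent is exact. It is the source of the curvature \<open>f^2 / s^2\<close> that the observation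
  adds.\<close>

lemma ker_midpt:
  assumes "0 < s"
  shows "ker d f s x y * ker d f s x z * exp (f\<^sup>2 / s\<^sup>2 * (rdist d y z)\<^sup>2 / 4) = (ker d f s x (midpt d y z))\<^sup>2"
  unfolding ker_def mult_exp_exp exp_double[symmetric] rdist_scaled_midpt
  using assms by (simp add: field_simps)

context wlc_density
begin

text \<open>Up to the Gaussian normalizing factor, the density at \<open>x\<close> of the law of the
  observation.\<close>

definition Z :: "real \<Rightarrow> real \<Rightarrow> vec \<Rightarrow> real" where
  "Z f s x = expectation (\<lambda>y. ker d f s x y)"

definition N :: "real \<Rightarrow> real \<Rightarrow> vec \<Rightarrow> nat \<Rightarrow> real" where
  "N f s x i = expectation (\<lambda>y. y i * ker d f s x y)"

lemma integrable_ker: "integrable \<nu> (\<lambda>y. ker d f s x y)"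
  by (rule integrable_const_bound[where B=1]) (auto simp: ker_le_1)

lemma integrable_mult_ker:
  assumes "integrable \<nu> h"
  shows "integrable \<nu> (\<lambda>y. h y * ker d f s x y)"
proof (rule Bochner_Integration.integrable_bound[OF assms])
  have [measurable]: "h \<in> borel_measurable \<nu>" using assms by (rule borel_measurable_integrable)
  show "(\<lambda>y. h y * ker d f s x y) \<in> borel_measurable \<nu>" by measurable
  show "AE y in \<nu>. norm (h y * ker d f s x y) \<le> norm (h y)"
    using ker_le_1 by (auto intro!: mult_left_le simp: abs_mult)
qed

lemma Z_pos: "0 < Z f s x"
proof -
  have "Z f s x \<noteq> 0"
  proof
    assume "Z f s x = 0"
    then have "AE y in \<nu>. ker d f s x y = 0"
      unfolding Z_def by (subst (asm) integral_nonneg_eq_0_iff_AE[OF integrable_ker]) auto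
    then have "AE y in \<nu>. False" by eventually_elim (simp add: ker_def)
    then show False by simp
  qed
  moreover have "0 \<le> Z f s x" unfolding Z_def by simp
  ultimately show ?thesis by simp
qed

text \<open>The Lipschitz bound on the kernel is uniform in \<open>y\<close> and passes to the
  expectation. Continuity in \<open>x\<close> is needed because the velocity is singled out as the
  continuous version of a conditional expectation.\<close>

lemma continuous_ker_expectation:
  assumes h: "integrable \<nu> h" and s: "0 < s"
  shows "continuous_map (Rd_top d) euclideanreal (\<lambda>x. expectation (\<lambda>y. h y * ker d f s x y))"
proof (rule hoelder_imp_continuous[where \<beta>=1])
  let ?C = "expectation (\<lambda>y. \<bar>h y\<bar>) / s + 1"
  have C0: "expectation (\<lambda>y. \<bar>h y\<bar>) / s \<ge> 0" using s by simp
  then show "0 < ?C" by simp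
  fix x x' assume "x \<in> Rd d" "x' \<in> Rd d"
  have pw: "\<bar>h y * ker d f s x y - h y * ker d f s x' y\<bar> \<le> \<bar>h y\<bar> * (rdist d x x' / s)" for y
  proof -
    have "\<bar>h y * ker d f s x y - h y * ker d f s x' y\<bar> = \<bar>h y\<bar> * \<bar>ker d f s x y - ker d f s x' y\<bar>"
      unfolding abs_mult[symmetric] by (rule arg_cong[where f=abs]) (rule right_diff_distrib[symmetric])
    also have "\<dots> \<le> \<bar>h y\<bar> * (rdist d x x' / s)" by (rule mult_left_mono[OF ker_lipschitz[OF s]]) simp
    finally show ?thesis .
  qed
  have iK: "integrable \<nu> (\<lambda>y. \<bar>h y * ker d f s x y - h y * ker d f s x' y\<bar>)"
    by (intro integrable_abs Bochner_Integration.integrable_diff integrable_mult_ker h)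
  have e: "expectation (\<lambda>y. h y * ker d f s x y) - expectation (\<lambda>y. h y * ker d f s x' y)
      = expectation (\<lambda>y. h y * ker d f s x y - h y * ker d f s x' y)"
    using integrable_mult_ker[OF h] by simp
  have "\<bar>expectation (\<lambda>y. h y * ker d f s x y) - expectation (\<lambda>y. h y * ker d f s x' y)\<bar>
      \<le> expectation (\<lambda>y. \<bar>h y * ker d f s x y - h y * ker d f s x' y\<bar>)" unfolding e
    using integral_norm_bound[of \<nu> "\<lambda>y. h y * ker d f s x y - h y * ker d f s x' y"] by simp
  also have "\<dots> \<le> expectation (\<lambda>y. \<bar>h y\<bar> * (rdist d x x' / s))"
    by (rule integral_mono) (use h iK pw in simp_all)
  also have "\<dots> = expectation (\<lambda>y. \<bar>h y\<bar>) / s * rdist d x x'" by simp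
  also have "\<dots> \<le> ?C * (rdist d x x') powr 1" by (simp add: distrib_right)
  finally show "\<bar>expectation (\<lambda>y. h y * ker d f s x y) - expectation (\<lambda>y. h y * ker d f s x' y)\<bar>
      \<le> ?C * (rdist d x x') powr 1" .
qed simp

lemma continuous_Z: "0 < s \<Longrightarrow> continuous_map (Rd_top d) euclideanreal (Z f s)"
  using continuous_ker_expectation[of "\<lambda>_. 1" s f] by (simp add: Z_def[abs_def])

lemma continuous_N: "0 < s \<Longrightarrow> i < d \<Longrightarrow> continuous_map (Rd_top d) euclideanreal (\<lambda>x. N f s x i)"
  using continuous_ker_expectation[OF integrable_component, of i s f] by (simp add: N_def[abs_def])

text \<open>Bayes' rule: the density of the signal given the observation \<open>x\<close>.\<close>

definition Q :: "real \<Rightarrow> real \<Rightarrow> vec \<Rightarrow> vec \<Rightarrow> real" where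
  "Q f s x y = P y * ker d f s x y / Z f s x"

text \<open>Midpoint conditions multiply: the curvatures add, while \<open>K\<close> is unchanged.
  The locale is thus closed under conditioning, and all its estimates hold for the posterior with
  the larger curvature.\<close>

lemma posterior_wlc:
  assumes s: "0 < s"
  shows "wlc_density d (L + f\<^sup>2 / s\<^sup>2) K (Q f s x)"
proof
  show "0 < L + f\<^sup>2 / s\<^sup>2" using L_pos by (simp add: add_pos_nonneg)
  show "0 \<le> K" by (rule K_nonneg)
  show "Q f s x \<in> borel_measurable (Rd_lborel d)" unfolding Q_def by measurable
  show "0 \<le> Q f s x y" for y using Z_pos[of f s x] by (simp add: Q_def P_nonneg)
  show "Q f s x y * Q f s x z * exp ((L + f\<^sup>2 / s\<^sup>2) * (rdist d y z)\<^sup>2 / 4)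
      \<le> exp (2 * K + K * rdist d y z) * (Q f s x (midpt d y z))\<^sup>2" if yz: "y \<in> Rd d" "z \<in> Rd d" for y z
  proof -
    have "exp ((L + f\<^sup>2 / s\<^sup>2) * (rdist d y z)\<^sup>2 / 4)
        = exp (L * (rdist d y z)\<^sup>2 / 4) * exp (f\<^sup>2 / s\<^sup>2 * (rdist d y z)\<^sup>2 / 4)"
      unfolding mult_exp_exp by (simp add: algebra_simps add_divide_distrib)
    then have "Q f s x y * Q f s x z * exp ((L + f\<^sup>2 / s\<^sup>2) * (rdist d y z)\<^sup>2 / 4)
        = (P y * P z * exp (L * (rdist d y z)\<^sup>2 / 4)) *
          (ker d f s x y * ker d f s x z * exp (f\<^sup>2 / s\<^sup>2 * (rdist d y z)\<^sup>2 / 4)) / (Z f s x)\<^sup>2"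
      by (simp add: Q_def power2_eq_square)
    also have "\<dots> \<le> (exp (2 * K + K * rdist d y z) * (P (midpt d y z))\<^sup>2) *
          (ker d f s x y * ker d f s x z * exp (f\<^sup>2 / s\<^sup>2 * (rdist d y z)\<^sup>2 / 4)) / (Z f s x)\<^sup>2"
      by (intro divide_right_mono mult_right_mono P_midpt yz) auto
    also have "\<dots> = exp (2 * K + K * rdist d y z) * (Q f s x (midpt d y z))\<^sup>2"
      unfolding ker_midpt[OF s] by (simp add: Q_def power_divide power_mult_distrib)
    finally show ?thesis .
  qed
  have "(\<integral>\<^sup>+y. ennreal (Q f s x y) \<partial>Rd_lborel d) = (\<integral>\<^sup>+y. ennreal (P y) * ennreal (ker d f s x y / Z f s x) \<partial>Rd_lborel d)"
    using Z_pos[of f s x] by (simp add: Q_def P_nonneg flip: ennreal_mult)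
  also have "\<dots> = (\<integral>\<^sup>+y. ennreal (ker d f s x y / Z f s x) \<partial>\<nu>)"
    unfolding \<nu>_def by (subst nn_integral_density) auto
  also have "\<dots> = ennreal (expectation (\<lambda>y. ker d f s x y / Z f s x))"
    using Z_pos[of f s x] integrable_ker by (intro nn_integral_eq_integral) auto
  also have "\<dots> = 1" using Z_pos[of f s x] by (simp add: Z_def)
  finally show "(\<integral>\<^sup>+y. ennreal (Q f s x y) \<partial>Rd_lborel d) = 1" .
qed

lemma posterior_expectation:
  assumes s: "0 < s" and [measurable]: "h \<in> borel_measurable (Rd_lborel d)"
  shows "integral\<^sup>L (wlc_density.\<nu> d (Q f s x)) h = expectation (\<lambda>y. h y * ker d f s x y) / Z f s x"
proof -
  have "integral\<^sup>L (density (Rd_lborel d) (\<lambda>y. ennreal (Q f s x y))) h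
      = (\<integral>y. Q f s x y * h y \<partial>Rd_lborel d)"
    using Z_pos[of f s x] unfolding Q_def
    by (subst integral_density) (auto simp: P_nonneg)
  also have "\<dots> = (\<integral>y. P y * (h y * ker d f s x y / Z f s x) \<partial>Rd_lborel d)"
    by (simp add: Q_def mult_ac)
  also have "\<dots> = expectation (\<lambda>y. h y * ker d f s x y / Z f s x)"
    unfolding \<nu>_def by (subst integral_density) (auto simp: P_nonneg)
  finally show ?thesis by (simp add: wlc_density.\<nu>_def[OF posterior_wlc[OF s]])
qed

end

section \<open>Joint law of signal and observation, and the formula for the velocity\<close>

lemma sigma_finite_Rd_lborel: "sigma_finite_measure (Rd_lborel d)"
proof -
  interpret product_sigma_finite "\<lambda>_::nat. lborel :: real measure" ..
  show ?thesis by (rule sigma_finite) simp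
qed

lemma std_gaussian_density:
  "std_gaussian d = density (Rd_lborel d) (\<lambda>z. \<Prod>i<d. ennreal (std_normal_density (z i)))"
proof -
  let ?G = "\<lambda>_::nat. density lborel (\<lambda>x. ennreal (std_normal_density x))"
  interpret G: product_sigma_finite ?G
    unfolding product_sigma_finite_def by (intro allI prob_space_imp_sigma_finite prob_space_normal_density) simp
  interpret L: product_sigma_finite "\<lambda>_::nat. lborel :: real measure" ..
  have "density (Rd_lborel d) (\<lambda>z. \<Prod>i<d. ennreal (std_normal_density (z i))) = Pi\<^sub>M {..<d} ?G"
  proof (rule G.PiM_eqI)
    show "sets (density (Rd_lborel d) (\<lambda>z. \<Prod>i<d. ennreal (std_normal_density (z i)))) = sets (Pi\<^sub>M {..<d} ?G)"
      by (simp, intro sets_PiM_cong) auto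
    fix A assume A: "\<And>i. i \<in> {..<d} \<Longrightarrow> A i \<in> sets (?G i)"
    then have A': "\<And>i. i \<in> {..<d} \<Longrightarrow> A i \<in> sets borel" by simp
    have AP[measurable]: "Pi\<^sub>E {..<d} A \<in> sets (Rd_lborel d)" by (rule sets_PiM_I_finite) (use A' in auto)
    have "emeasure (density (Rd_lborel d) (\<lambda>z. \<Prod>i<d. ennreal (std_normal_density (z i)))) (Pi\<^sub>E {..<d} A)
        = (\<integral>\<^sup>+z. (\<Prod>i<d. ennreal (std_normal_density (z i))) * indicator (Pi\<^sub>E {..<d} A) z \<partial>Rd_lborel d)"
      by (rule emeasure_density) measurable
    also have "\<dots> = (\<integral>\<^sup>+z. (\<Prod>i<d. ennreal (std_normal_density (z i)) * indicator (A i) (z i)) \<partial>Rd_lborel d)"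
    proof (rule nn_integral_cong)
      fix z assume z: "z \<in> space (Rd_lborel d)"
      have "(\<Prod>i<d. indicator (A i) (z i)) = (indicator (Pi\<^sub>E {..<d} A) z :: ennreal)"
      proof (cases "z \<in> Pi\<^sub>E {..<d} A")
        case True
        then show ?thesis by (auto simp: PiE_def Pi_def)
      next
        case False
        then obtain i where "i < d" "z i \<notin> A i" using z by (auto simp: PiE_def Pi_def space_PiM)
        then have "(\<Prod>i<d. indicator (A i) (z i)) = (0 :: ennreal)" by (intro prod_zero) (auto intro!: bexI[of _ i])
        then show ?thesis using False by simp
      qed
      then show "(\<Prod>i<d. ennreal (std_normal_density (z i))) * indicator (Pi\<^sub>E {..<d} A) z
          = (\<Prod>i<d. ennreal (std_normal_density (z i)) * indicator (A i) (z i))"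
        by (simp add: prod.distrib)
    qed
    also have "\<dots> = (\<Prod>i<d. \<integral>\<^sup>+x. ennreal (std_normal_density x) * indicator (A i) x \<partial>lborel)"
      by (rule L.product_nn_integral_prod) (use A' in auto)
    also have "\<dots> = (\<Prod>i<d. emeasure (?G i) (A i))"
      by (intro prod.cong refl emeasure_density[symmetric]) (use A' in auto)
    finally show "emeasure (density (Rd_lborel d) (\<lambda>z. \<Prod>i<d. ennreal (std_normal_density (z i)))) (Pi\<^sub>E {..<d} A)
        = (\<Prod>i<d. emeasure (?G i) (A i))" .
  qed simp
  then show ?thesis by (simp add: std_gaussian_def)
qed

lemma std_gaussian_component_integrable:
  assumes i: "i < d"
  shows "integrable (std_gaussian d) (\<lambda>z. z i)"
proof -
  let ?G = "\<lambda>_::nat. density lborel (\<lambda>x. ennreal (std_normal_density x))"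
  have "integrable lborel (\<lambda>x. std_normal_density x * x)"
    using integrable_std_normal_moment[of 1] by simp
  then have "integrable (density lborel (\<lambda>x. ennreal (std_normal_density x))) (\<lambda>x. x)"
    by (subst integrable_density) auto
  also have "density lborel (\<lambda>x. ennreal (std_normal_density x)) = distr (Pi\<^sub>M {..<d} ?G) (?G i) (\<lambda>z. z i)"
    by (rule distr_PiM_component[symmetric]) (use i in \<open>auto intro: prob_space_normal_density\<close>)
  finally show ?thesis
    unfolding std_gaussian_def by (subst (asm) integrable_distr_eq) (use i in auto)
qed

lemma prod_std_normal_density:
  "(\<Prod>i<d. ennreal (std_normal_density (z i))) = ennreal ((1 / sqrt (2 * pi)) ^ d * exp (- (\<Sum>i<d. (z i)\<^sup>2) / 2))"
proof -
  have "(\<Prod>i<d. ennreal (std_normal_density (z i))) = ennreal (\<Prod>i<d. (1 / sqrt (2 * pi)) * exp (- (z i)\<^sup>2 / 2))"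
    by (simp add: prod_ennreal std_normal_density_def)
  also have "(\<Prod>i<d. (1 / sqrt (2 * pi)) * exp (- (z i)\<^sup>2 / 2)) = (1 / sqrt (2 * pi)) ^ d * exp (\<Sum>i<d. - (z i)\<^sup>2 / 2)"
    by (simp only: prod.distrib prod_constant card_lessThan exp_sum[OF finite_lessThan])
  also have "(\<Sum>i<d. - (z i)\<^sup>2 / 2) = - (\<Sum>i<d. (z i)\<^sup>2) / 2"
    by (simp add: sum_negf sum_divide_distrib)
  finally show ?thesis .
qed

lemma open_null_empty:
  assumes U: "openin (Rd_top d) U" and null: "U \<in> null_sets (Rd_lborel d)"
  shows "U = {}"
proof (rule ccontr)
  interpret product_sigma_finite "\<lambda>_::nat. lborel :: real measure" ..
  assume "U \<noteq> {}"
  then obtain x r where r: "r > 0" "bx d x r \<subseteq> U" using U unfolding openin_Rd_iff by blast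
  have "bx d x r \<in> null_sets (Rd_lborel d)"
    by (rule null_sets_subset[OF null _ r(2)]) (rule open_sets_Rd_lborel[OF openin_bx])
  then have "emeasure (Rd_lborel d) (bx d x r) = 0" by auto
  then show False using r(1) unfolding bx_eq_PiE by (subst (asm) emeasure_PiM) auto
qed

lemma measurable_lincomb [measurable]:
  assumes [measurable]: "g \<in> measurable M (Rd_lborel d)" "h \<in> measurable M (Rd_lborel d)"
  shows "(\<lambda>\<omega>. lincomb d r (g \<omega>) s (h \<omega>)) \<in> measurable M (Rd_lborel d)"
proof -
  have [measurable]: "(\<lambda>\<omega>. g \<omega> i) \<in> borel_measurable M" "(\<lambda>\<omega>. h \<omega> i) \<in> borel_measurable M" if "i \<in> {..<d}" for i
    using measurable_compose[OF assms(1) measurable_component_singleton[OF that]]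
      measurable_compose[OF assms(2) measurable_component_singleton[OF that]] by simp_all
  show ?thesis unfolding lincomb_def by (rule measurable_restrict) simp
qed

context wlc_density
begin

text \<open>Substitution \<open>z = (x - f * y) / s\<close>, which turns the standard Gaussian
  density into the kernel and contributes the factor \<open>1 / s ^ d\<close>.\<close>

lemma nn_integral_gaussian_shift:
  assumes s: "0 < s" and y[measurable]: "y \<in> space (Rd_lborel d)"
    and H[measurable]: "H \<in> borel_measurable (Rd_lborel d)"
  shows "(\<integral>\<^sup>+z. H (lincomb d f y s z) \<partial>std_gaussian d)
    = (\<integral>\<^sup>+x. ennreal ((1 / (s * sqrt (2 * pi))) ^ d * ker d f s x y) * H x \<partial>Rd_lborel d)"
proof -
  let ?\<phi> = "\<lambda>z. (\<Prod>i<d. ennreal (std_normal_density (z i)))"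
  have "(\<integral>\<^sup>+z. H (lincomb d f y s z) \<partial>std_gaussian d) = (\<integral>\<^sup>+z. ?\<phi> z * H (lincomb d f y s z) \<partial>Rd_lborel d)"
    unfolding std_gaussian_density by (rule nn_integral_density) measurable
  also have "\<dots> = ennreal ((1 / s) ^ card {..<d}) * (\<integral>\<^sup>+x. ?\<phi> (\<lambda>i\<in>{..<d}. - (f / s) * y i + (1 / s) * x i)
      * H (lincomb d f y s (\<lambda>i\<in>{..<d}. - (f / s) * y i + (1 / s) * x i)) \<partial>Rd_lborel d)"
    by (rule nn_integral_PiM_affine) (use s in simp_all)
  also have "\<dots> = ennreal ((1 / s) ^ d) * (\<integral>\<^sup>+x. ennreal ((1 / sqrt (2 * pi)) ^ d * ker d f s x y) * H x \<partial>Rd_lborel d)"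
  proof -
    have "?\<phi> (\<lambda>i\<in>{..<d}. - (f / s) * y i + (1 / s) * x i) = ennreal ((1 / sqrt (2 * pi)) ^ d * ker d f s x y)" for x
    proof -
      have "(\<Sum>i<d. ((\<lambda>i\<in>{..<d}. - (f / s) * y i + (1 / s) * x i) i)\<^sup>2) = (rdist d x (\<lambda>i. f * y i))\<^sup>2 / s\<^sup>2"
        unfolding rdist_sq sum_divide_distrib power_divide[symmetric]
        by (intro sum.cong) (use s in \<open>simp_all add: diff_divide_distrib\<close>)
      then show ?thesis unfolding prod_std_normal_density by (simp add: ker_def)
    qed
    moreover have "lincomb d f y s (\<lambda>i\<in>{..<d}. - (f / s) * y i + (1 / s) * x i) = x" if "x \<in> Rd d" for x
      using that s by (auto simp: lincomb_def fun_eq_iff restrict_def PiE_def extensional_def field_simps)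
    ultimately show ?thesis
      by (intro arg_cong2[where f="(*)"] nn_integral_cong) (auto simp: space_PiM)
  qed
  also have "\<dots> = (\<integral>\<^sup>+x. ennreal ((1 / s) ^ d) * (ennreal ((1 / sqrt (2 * pi)) ^ d * ker d f s x y) * H x) \<partial>Rd_lborel d)"
    by (rule nn_integral_cmult[symmetric]) measurable
  also have "\<dots> = (\<integral>\<^sup>+x. ennreal ((1 / (s * sqrt (2 * pi))) ^ d * ker d f s x y) * H x \<partial>Rd_lborel d)"
    using s by (intro nn_integral_cong) (simp add: mult.assoc[symmetric] power_mult_distrib power_divide flip: ennreal_mult)
  finally show ?thesis .
qed

text \<open>The reference measure for the second component is \<open>\<nu>\<close>, not Lebesgue
  measure, so that integrating out the signal is an \<open>expectation\<close> and produces
  \<open>Z\<close> and \<open>N\<close> directly.\<close>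

lemma joint_law:
  fixes M :: "'w measure"
  assumes M: "prob_space M" and s: "0 < s"
    and Y[measurable]: "Y \<in> measurable M (Rd_lborel d)" and dY: "distr M (Rd_lborel d) Y = \<nu>"
    and \<xi>[measurable]: "\<xi> \<in> measurable M (Rd_lborel d)" and d\<xi>: "distr M (Rd_lborel d) \<xi> = std_gaussian d"
    and ind: "prob_space.indep_var M (Rd_lborel d) Y (Rd_lborel d) \<xi>"
  shows "distr M (Rd_lborel d \<Otimes>\<^sub>M \<nu>) (\<lambda>\<omega>. (lincomb d f (Y \<omega>) s (\<xi> \<omega>), Y \<omega>))
    = density (Rd_lborel d \<Otimes>\<^sub>M \<nu>) (\<lambda>(x, y). ennreal ((1 / (s * sqrt (2 * pi))) ^ d * ker d f s x y))"
proof (rule measure_eqI)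
  let ?c = "(1 / (s * sqrt (2 * pi))) ^ d"
  interpret M: prob_space M by fact
  interpret R: sigma_finite_measure "Rd_lborel d" by (rule sigma_finite_Rd_lborel)
  interpret RN: pair_sigma_finite "Rd_lborel d" \<nu> ..
  have gprob: "prob_space (std_gaussian d)" unfolding d\<xi>[symmetric] by (rule M.prob_space_distr) simp
  interpret g: prob_space "std_gaussian d" by (rule gprob)
  have gs[measurable_cong]: "sets (std_gaussian d) = sets (Rd_lborel d)" by (simp add: std_gaussian_density)
  have joint: "\<nu> \<Otimes>\<^sub>M std_gaussian d = distr M (Rd_lborel d \<Otimes>\<^sub>M Rd_lborel d) (\<lambda>\<omega>. (Y \<omega>, \<xi> \<omega>))"
    using ind unfolding M.indep_var_distribution_eq dY d\<xi> by simp
  fix A assume "A \<in> sets (distr M (Rd_lborel d \<Otimes>\<^sub>M \<nu>) (\<lambda>\<omega>. (lincomb d f (Y \<omega>) s (\<xi> \<omega>), Y \<omega>)))"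
  then have A0: "A \<in> sets (Rd_lborel d \<Otimes>\<^sub>M \<nu>)" by simp
  then have A[measurable]: "A \<in> sets (Rd_lborel d \<Otimes>\<^sub>M Rd_lborel d)" by (simp cong: sets_pair_measure_cong)
  have "emeasure (distr M (Rd_lborel d \<Otimes>\<^sub>M \<nu>) (\<lambda>\<omega>. (lincomb d f (Y \<omega>) s (\<xi> \<omega>), Y \<omega>))) A
      = (\<integral>\<^sup>+p. indicator A p \<partial>distr M (Rd_lborel d \<Otimes>\<^sub>M \<nu>) (\<lambda>\<omega>. (lincomb d f (Y \<omega>) s (\<xi> \<omega>), Y \<omega>)))"
    by (rule nn_integral_indicator[symmetric]) simp
  also have "\<dots> = (\<integral>\<^sup>+\<omega>. indicator A (lincomb d f (Y \<omega>) s (\<xi> \<omega>), Y \<omega>) \<partial>M)"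
    by (rule nn_integral_distr) measurable
  also have "\<dots> = (\<integral>\<^sup>+p. indicator A (lincomb d f (fst p) s (snd p), fst p)
      \<partial>distr M (Rd_lborel d \<Otimes>\<^sub>M Rd_lborel d) (\<lambda>\<omega>. (Y \<omega>, \<xi> \<omega>)))"
    by (subst nn_integral_distr) measurable
  also have "\<dots> = (\<integral>\<^sup>+y. \<integral>\<^sup>+z. indicator A (lincomb d f y s z, y) \<partial>std_gaussian d \<partial>\<nu>)"
    
  proof -
    have sp: "sets (\<nu> \<Otimes>\<^sub>M std_gaussian d) = sets (Rd_lborel d \<Otimes>\<^sub>M Rd_lborel d)"
      by (rule sets_pair_measure_cong) (simp_all add: gs)
    have "(\<lambda>p. indicator A (lincomb d f (fst p) s (snd p), fst p) :: ennreal) \<in> borel_measurable (Rd_lborel d \<Otimes>\<^sub>M Rd_lborel d)"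
      by measurable
    then have "(\<lambda>p. indicator A (lincomb d f (fst p) s (snd p), fst p) :: ennreal) \<in> borel_measurable (\<nu> \<Otimes>\<^sub>M std_gaussian d)"
      unfolding measurable_cong_sets[OF sp refl] .
    from g.nn_integral_fst[OF this] show ?thesis unfolding joint[symmetric] by simp
  qed
  also have "\<dots> = (\<integral>\<^sup>+y. \<integral>\<^sup>+x. ennreal (?c * ker d f s x y) * indicator A (x, y) \<partial>Rd_lborel d \<partial>\<nu>)"
  proof (rule nn_integral_cong)
    fix y assume "y \<in> space \<nu>"
    then have y: "y \<in> space (Rd_lborel d)" by (simp add: space_PiM)
    then have "(\<lambda>x. indicator A (x, y) :: ennreal) \<in> borel_measurable (Rd_lborel d)" by measurable
    then show "(\<integral>\<^sup>+z. indicator A (lincomb d f y s z, y) \<partial>std_gaussian d)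
        = (\<integral>\<^sup>+x. ennreal (?c * ker d f s x y) * indicator A (x, y) \<partial>Rd_lborel d)"
      by (rule nn_integral_gaussian_shift[OF s y])
  qed
  also have "\<dots> = (\<integral>\<^sup>+p. (case p of (x, y) \<Rightarrow> ennreal (?c * ker d f s x y)) * indicator A p \<partial>(Rd_lborel d \<Otimes>\<^sub>M \<nu>))"
    by (subst RN.nn_integral_snd[symmetric]) (simp_all add: split_beta')
  also have "\<dots> = emeasure (density (Rd_lborel d \<Otimes>\<^sub>M \<nu>) (\<lambda>(x, y). ennreal (?c * ker d f s x y))) A"
    by (rule emeasure_density[symmetric, OF _ A0]) measurable
  finally show "emeasure (distr M (Rd_lborel d \<Otimes>\<^sub>M \<nu>) (\<lambda>\<omega>. (lincomb d f (Y \<omega>) s (\<xi> \<omega>), Y \<omega>))) A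
      = emeasure (density (Rd_lborel d \<Otimes>\<^sub>M \<nu>) (\<lambda>(x, y). ennreal (?c * ker d f s x y))) A" .
qed simp

text \<open>Eliminating the noise by \<open>\<xi> = (X - f * Y) / s\<close> leaves the conditional
  expectation of the signal, which by the joint law is \<open>N / Z\<close> at the observation. The
  identity first holds almost surely; both sides are continuous and the law of the observation
  charges every open set, so it holds at every point.\<close>

lemma velocity_formula:
  fixes M :: "'w measure"
  assumes M: "prob_space M" and s: "0 < s"
    and Y[measurable]: "Y \<in> measurable M (Rd_lborel d)" and dY: "distr M (Rd_lborel d) Y = \<nu>"
    and \<xi>[measurable]: "\<xi> \<in> measurable M (Rd_lborel d)" and d\<xi>: "distr M (Rd_lborel d) \<xi> = std_gaussian d"
    and ind: "prob_space.indep_var M (Rd_lborel d) Y (Rd_lborel d) \<xi>"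
    and ce: "cond_exp_given d M (\<lambda>\<omega>. lincomb d f' (Y \<omega>) s' (\<xi> \<omega>)) (\<lambda>\<omega>. lincomb d f (Y \<omega>) s (\<xi> \<omega>)) v"
    and x: "x \<in> Rd d" and i: "i < d"
  shows "v x i = s' / s * x i + (f' - f * (s' / s)) * (N f s x i / Z f s x)"
proof -
  define c where "c = (1 / (s * sqrt (2 * pi))) ^ d"
  have c: "c > 0" using s by (simp add: c_def)
  define X where "X \<omega> = lincomb d f (Y \<omega>) s (\<xi> \<omega>)" for \<omega>
  have X[measurable]: "X \<in> measurable M (Rd_lborel d)" unfolding X_def by measurable
  interpret M: prob_space M by fact
  interpret R: sigma_finite_measure "Rd_lborel d" by (rule sigma_finite_Rd_lborel)
  interpret RN: pair_sigma_finite "Rd_lborel d" \<nu> ..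
  have J: "distr M (Rd_lborel d \<Otimes>\<^sub>M \<nu>) (\<lambda>\<omega>. (X \<omega>, Y \<omega>))
      = density (Rd_lborel d \<Otimes>\<^sub>M \<nu>) (\<lambda>p. ennreal (c * ker d f s (fst p) (snd p)))"
    using joint_law[OF M s Y dY \<xi> d\<xi> ind, of f] by (simp add: X_def c_def split_beta')
  have XY: "(\<lambda>\<omega>. (X \<omega>, Y \<omega>)) \<in> measurable M (Rd_lborel d \<Otimes>\<^sub>M \<nu>)" by measurable
  have kerm[measurable]: "(\<lambda>p. ker d f s (fst p) (snd p)) \<in> borel_measurable (Rd_lborel d \<Otimes>\<^sub>M \<nu>)"
    using measurable_ker(2)[of d f s] by (simp add: split_beta' cong: measurable_cong_sets)
  have tr: "integrable M (\<lambda>\<omega>. h (X \<omega>, Y \<omega>)) \<longleftrightarrow>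
      integrable (Rd_lborel d \<Otimes>\<^sub>M \<nu>) (\<lambda>p. c * ker d f s (fst p) (snd p) * h p)"
    "(\<integral>\<omega>. h (X \<omega>, Y \<omega>) \<partial>M) = (\<integral>p. c * ker d f s (fst p) (snd p) * h p \<partial>(Rd_lborel d \<Otimes>\<^sub>M \<nu>))"
    if [measurable]: "h \<in> borel_measurable (Rd_lborel d \<Otimes>\<^sub>M \<nu>)" for h :: "vec \<times> vec \<Rightarrow> real"
  proof -
    have "integrable M (\<lambda>\<omega>. h (X \<omega>, Y \<omega>)) \<longleftrightarrow>
        integrable (distr M (Rd_lborel d \<Otimes>\<^sub>M \<nu>) (\<lambda>\<omega>. (X \<omega>, Y \<omega>))) h"
      by (rule integrable_distr_eq[OF XY that, symmetric])
    also have "\<dots> \<longleftrightarrow> integrable (Rd_lborel d \<Otimes>\<^sub>M \<nu>) (\<lambda>p. c * ker d f s (fst p) (snd p) * h p)"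
      unfolding J using c by (subst integrable_density) auto
    finally show "integrable M (\<lambda>\<omega>. h (X \<omega>, Y \<omega>)) \<longleftrightarrow>
      integrable (Rd_lborel d \<Otimes>\<^sub>M \<nu>) (\<lambda>p. c * ker d f s (fst p) (snd p) * h p)" .
    have "(\<integral>\<omega>. h (X \<omega>, Y \<omega>) \<partial>M) = integral\<^sup>L (distr M (Rd_lborel d \<Otimes>\<^sub>M \<nu>) (\<lambda>\<omega>. (X \<omega>, Y \<omega>))) h"
      by (rule integral_distr[OF XY that, symmetric])
    also have "\<dots> = (\<integral>p. c * ker d f s (fst p) (snd p) * h p \<partial>(Rd_lborel d \<Otimes>\<^sub>M \<nu>))"
      unfolding J using c by (subst integral_density) auto
    finally show "(\<integral>\<omega>. h (X \<omega>, Y \<omega>) \<partial>M) = (\<integral>p. c * ker d f s (fst p) (snd p) * h p \<partial>(Rd_lborel d \<Otimes>\<^sub>M \<nu>))" .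
  qed
  define mm where "mm x = N f s x i / Z f s x" for x
  have mm_cont: "continuous_map (Rd_top d) euclideanreal mm"
    unfolding mm_def
    by (intro continuous_map_real_divide continuous_N continuous_Z s i) (use Z_pos[of f s] in \<open>metis less_irrefl\<close>)
  have mm_meas[measurable]: "mm \<in> borel_measurable (Rd_lborel d)" by (rule continuous_imp_measurable_Rd[OF mm_cont])
  have Z_mm: "Z f s x * mm x = N f s x i" for x using Z_pos[of f s x] by (simp add: mm_def)
  have comp[measurable]: "(\<lambda>y. y i) \<in> borel_measurable (Rd_lborel d)" using i by simp
  have comp'[measurable]: "(\<lambda>y. y i) \<in> borel_measurable \<nu>" using comp by simp
  have iY: "integrable M (\<lambda>\<omega>. Y \<omega> i)"
    using integrable_component[OF i] unfolding dY[symmetric] by (subst (asm) integrable_distr_eq) auto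
  have ip: "integrable (Rd_lborel d \<Otimes>\<^sub>M \<nu>) (\<lambda>p. c * ker d f s (fst p) (snd p) * snd p i)"
    using tr(1)[of "\<lambda>p. snd p i"] iY by simp
  \<comment> \<open>Integrability of \<open>mm (X \<omega>)\<close>: the absolute value of
    \<open>Z * mm\<close> is that of \<open>N\<close>, which up to the factor \<open>c\<close> is a
    partial integral of the integrable function in \<open>ip\<close>.\<close>
  have im: "integrable (Rd_lborel d \<Otimes>\<^sub>M \<nu>) (\<lambda>p. c * ker d f s (fst p) (snd p) * mm (fst p))"
  proof (rule RN.Fubini_integrable)
    have "(\<integral>y. norm (c * ker d f s (fst (x, y)) (snd (x, y)) * mm (fst (x, y))) \<partial>\<nu>)
        = \<bar>\<integral>y. c * ker d f s (fst (x, y)) (snd (x, y)) * snd (x, y) i \<partial>\<nu>\<bar>" for x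
    proof -
      have "(\<integral>y. norm (c * ker d f s (fst (x, y)) (snd (x, y)) * mm (fst (x, y))) \<partial>\<nu>)
          = (\<integral>y. (c * \<bar>mm x\<bar>) * ker d f s x y \<partial>\<nu>)"
        using c by (simp add: abs_mult mult_ac)
      also have "\<dots> = c * (Z f s x * \<bar>mm x\<bar>)" by (simp add: Z_def)
      also have "Z f s x * \<bar>mm x\<bar> = \<bar>N f s x i\<bar>" unfolding Z_mm[symmetric] using Z_pos[of f s x] by (simp add: abs_mult)
      also have "c * \<bar>N f s x i\<bar> = \<bar>\<integral>y. c * (y i * ker d f s x y) \<partial>\<nu>\<bar>" using c by (simp add: N_def abs_mult)
      finally show ?thesis by (simp add: mult_ac)
    qed
    moreover have "integrable (Rd_lborel d) (\<lambda>x. \<bar>\<integral>y. c * ker d f s (fst (x, y)) (snd (x, y)) * snd (x, y) i \<partial>\<nu>\<bar>)"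
      by (intro integrable_abs RN.integrable_fst'[OF ip])
    ultimately show "integrable (Rd_lborel d) (\<lambda>x. \<integral>y. norm (c * ker d f s (fst (x, y)) (snd (x, y)) * mm (fst (x, y))) \<partial>\<nu>)"
      by simp
    show "AE x in Rd_lborel d. integrable \<nu> (\<lambda>y. c * ker d f s (fst (x, y)) (snd (x, y)) * mm (fst (x, y)))"
      using integrable_ker by (intro AE_I2) simp
  qed measurable
  have imX: "integrable M (\<lambda>\<omega>. mm (X \<omega>))" using tr(1)[of "\<lambda>p. mm (fst p)"] im by simp
  \<comment> \<open>The defining property of the conditional expectation of \<open>Y\<close> given
    \<open>X\<close>, tested on the event that \<open>X\<close> lies in \<open>B\<close>.\<close>
  have key: "(\<integral>\<omega>. indicator B (X \<omega>) * Y \<omega> i \<partial>M) = (\<integral>\<omega>. indicator B (X \<omega>) * mm (X \<omega>) \<partial>M)"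
    if B[measurable]: "B \<in> sets (Rd_lborel d)" for B
  proof -
    have i1: "integrable (Rd_lborel d \<Otimes>\<^sub>M \<nu>) (\<lambda>p. c * ker d f s (fst p) (snd p) * (indicator B (fst p) * snd p i))"
      by (rule Bochner_Integration.integrable_bound[OF ip]) (auto simp: abs_mult indicator_def)
    have i2: "integrable (Rd_lborel d \<Otimes>\<^sub>M \<nu>) (\<lambda>p. c * ker d f s (fst p) (snd p) * (indicator B (fst p) * mm (fst p)))"
      by (rule Bochner_Integration.integrable_bound[OF im]) (auto simp: abs_mult indicator_def)
    have "(\<integral>\<omega>. indicator B (X \<omega>) * Y \<omega> i \<partial>M)
        = (\<integral>p. c * ker d f s (fst p) (snd p) * (indicator B (fst p) * snd p i) \<partial>(Rd_lborel d \<Otimes>\<^sub>M \<nu>))"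
      using tr(2)[of "\<lambda>p. indicator B (fst p) * snd p i"] by simp
    also have "\<dots> = (\<integral>x. (\<integral>y. c * indicator B x * (y i * ker d f s x y) \<partial>\<nu>) \<partial>Rd_lborel d)"
      unfolding RN.integral_fst'[OF i1, symmetric] by (simp add: mult_ac)
    also have "\<dots> = (\<integral>x. c * indicator B x * N f s x i \<partial>Rd_lborel d)" by (simp add: N_def)
    also have "\<dots> = (\<integral>x. (\<integral>y. c * indicator B x * mm x * ker d f s x y \<partial>\<nu>) \<partial>Rd_lborel d)"
      unfolding Z_mm[symmetric] by (simp add: Z_def mult_ac)
    also have "\<dots> = (\<integral>p. c * ker d f s (fst p) (snd p) * (indicator B (fst p) * mm (fst p)) \<partial>(Rd_lborel d \<Otimes>\<^sub>M \<nu>))"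
      unfolding RN.integral_fst'[OF i2, symmetric] by (simp add: mult_ac)
    also have "\<dots> = (\<integral>\<omega>. indicator B (X \<omega>) * mm (X \<omega>) \<partial>M)"
      using tr(2)[of "\<lambda>p. indicator B (fst p) * mm (fst p)"] by simp
    finally show ?thesis .
  qed
  have i\<xi>: "integrable M (\<lambda>\<omega>. \<xi> \<omega> i)"
    using std_gaussian_component_integrable[OF i] unfolding d\<xi>[symmetric] by (subst (asm) integrable_distr_eq) auto
  have Xi: "X \<omega> i = f * Y \<omega> i + s * \<xi> \<omega> i" for \<omega> using i by (simp add: X_def lincomb_def)
  have iX: "integrable M (\<lambda>\<omega>. X \<omega> i)" unfolding Xi using iY i\<xi> by simp
  define w where "w x = s' / s * x i + (f' - f * (s' / s)) * mm x" for x
  have w_meas[measurable]: "w \<in> borel_measurable (Rd_lborel d)" unfolding w_def by measurable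
  have VV: "lincomb d f' (Y \<omega>) s' (\<xi> \<omega>) i = s' / s * X \<omega> i + (f' - f * (s' / s)) * Y \<omega> i" for \<omega>
    unfolding Xi using i s by (simp add: lincomb_def field_simps)
  define F where "F = vimage_algebra (space M) X (Rd_lborel d)"
  have Xsp: "X \<in> space M \<rightarrow> space (Rd_lborel d)" using X by (rule measurable_space[THEN funcsetI])
  have sF: "sets F = {X -` B \<inter> space M | B. B \<in> sets (Rd_lborel d)}"
    unfolding F_def by (rule sets_vimage_algebra2[OF Xsp])
  interpret F: finite_measure_subalgebra M F
  proof
    show "subalgebra M F" unfolding subalgebra_def sF using X by (auto simp: F_def)
  qed
  have "AE \<omega> in M. real_cond_exp M F (\<lambda>\<omega>. lincomb d f' (Y \<omega>) s' (\<xi> \<omega>) i) \<omega> = w (X \<omega>)"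
  proof (rule F.real_cond_exp_charact)
    show "integrable M (\<lambda>\<omega>. lincomb d f' (Y \<omega>) s' (\<xi> \<omega>) i)" unfolding VV using iX iY by simp
    show "integrable M (\<lambda>\<omega>. w (X \<omega>))" unfolding w_def using iX imX by simp
    have "X \<in> measurable F (Rd_lborel d)" unfolding F_def by (rule measurable_vimage_algebra1[OF Xsp])
    then show "(\<lambda>\<omega>. w (X \<omega>)) \<in> borel_measurable F" by (rule measurable_compose[OF _ w_meas])
    fix A assume "A \<in> sets F"
    then obtain B where B[measurable]: "B \<in> sets (Rd_lborel d)" and A: "A = X -` B \<inter> space M" unfolding sF by auto
    have red: "(\<integral>\<omega>\<in>A. g \<omega> \<partial>M) = (\<integral>\<omega>. indicator B (X \<omega>) * g \<omega> \<partial>M)" for g :: "'w \<Rightarrow> real"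
      unfolding set_lebesgue_integral_def A
      by (intro Bochner_Integration.integral_cong) (auto simp: indicator_def)
    have iB: "integrable M (\<lambda>\<omega>. indicator B (X \<omega>) * g \<omega>)" if "integrable M g" for g :: "'w \<Rightarrow> real"
    proof (rule Bochner_Integration.integrable_bound[OF that])
      have [measurable]: "g \<in> borel_measurable M" using that by (rule borel_measurable_integrable)
      show "(\<lambda>\<omega>. indicator B (X \<omega>) * g \<omega>) \<in> borel_measurable M" by measurable
    qed (auto simp: indicator_def)
    have "(\<integral>\<omega>\<in>A. lincomb d f' (Y \<omega>) s' (\<xi> \<omega>) i \<partial>M)
        = (\<integral>\<omega>. s' / s * (indicator B (X \<omega>) * X \<omega> i) + (f' - f * (s' / s)) * (indicator B (X \<omega>) * Y \<omega> i) \<partial>M)"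
      unfolding red VV by (simp add: algebra_simps)
    also have "\<dots> = s' / s * (\<integral>\<omega>. indicator B (X \<omega>) * X \<omega> i \<partial>M) + (f' - f * (s' / s)) * (\<integral>\<omega>. indicator B (X \<omega>) * Y \<omega> i \<partial>M)"
      using iB[OF iX] iB[OF iY] by simp
    also have "\<dots> = s' / s * (\<integral>\<omega>. indicator B (X \<omega>) * X \<omega> i \<partial>M) + (f' - f * (s' / s)) * (\<integral>\<omega>. indicator B (X \<omega>) * mm (X \<omega>) \<partial>M)"
      by (simp only: key[OF B])
    also have "\<dots> = (\<integral>\<omega>. s' / s * (indicator B (X \<omega>) * X \<omega> i) + (f' - f * (s' / s)) * (indicator B (X \<omega>) * mm (X \<omega>)) \<partial>M)"
      using iB[OF iX] iB[OF imX] by simp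
    also have "\<dots> = (\<integral>\<omega>\<in>A. w (X \<omega>) \<partial>M)" unfolding red w_def by (simp add: algebra_simps)
    finally show "(\<integral>\<omega>\<in>A. lincomb d f' (Y \<omega>) s' (\<xi> \<omega>) i \<partial>M) = (\<integral>\<omega>\<in>A. w (X \<omega>) \<partial>M)" .
  qed
  moreover have "AE \<omega> in M. real_cond_exp M F (\<lambda>\<omega>. lincomb d f' (Y \<omega>) s' (\<xi> \<omega>) i) \<omega> = v (X \<omega>) i"
    using ce i unfolding cond_exp_given_def F_def X_def by auto
  ultimately have vw: "AE \<omega> in M. v (X \<omega>) i = w (X \<omega>)" by eventually_elim simp
  have "continuous_map (Rd_top d) (Rd_top d) v" using ce unfolding cond_exp_given_def by auto
  then have v_cont: "continuous_map (Rd_top d) euclideanreal (\<lambda>x. v x i)"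
    using i unfolding continuous_map_componentwise by auto
  have w_cont: "continuous_map (Rd_top d) euclideanreal w"
    unfolding w_def using i by (intro continuous_intros continuous_map_real_mult continuous_map_product_projection mm_cont) auto
  \<comment> \<open>The exceptional set is open by continuity. The kernel is positive everywhere, so
    an event that \<open>X\<close> almost surely avoids is Lebesgue null, and a null open set is
    empty.\<close>
  define Bad where "Bad = {x \<in> topspace (Rd_top d). v x i - w x \<in> - {0}}"
  have Bad: "openin (Rd_top d) Bad" unfolding Bad_def
    by (rule openin_continuous_map_preimage[OF continuous_map_diff[OF v_cont w_cont]]) auto
  have Badm[measurable]: "Bad \<in> sets (Rd_lborel d)" by (rule open_sets_Rd_lborel[OF Bad])
  have "AE \<omega> in M. X \<omega> \<notin> Bad" using vw by eventually_elim (simp add: Bad_def)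
  then have "AE p in distr M (Rd_lborel d \<Otimes>\<^sub>M \<nu>) (\<lambda>\<omega>. (X \<omega>, Y \<omega>)). fst p \<notin> Bad"
  proof (subst AE_distr_iff[OF XY])
    show "{p \<in> space (Rd_lborel d \<Otimes>\<^sub>M \<nu>). fst p \<notin> Bad} \<in> sets (Rd_lborel d \<Otimes>\<^sub>M \<nu>)" by measurable
  qed auto
  then have "AE p in Rd_lborel d \<Otimes>\<^sub>M \<nu>. fst p \<notin> Bad"
    unfolding J using c by (subst (asm) AE_density) auto
  then have "AE x in Rd_lborel d. AE y in \<nu>. x \<notin> Bad" using RN.AE_pair by fastforce
  then have "AE x in Rd_lborel d. x \<notin> Bad" by (simp add: AE_const)
  then have "Bad \<in> null_sets (Rd_lborel d)"
    using Badm by (simp add: AE_iff_null_sets)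
  then have "Bad = {}" by (rule open_null_empty[OF Bad])
  then have "v x i - w x = 0" using x by (auto simp: Bad_def)
  then show ?thesis by (simp add: w_def mm_def)
qed

end

section \<open>Time derivative of the posterior mean\<close>

text \<open>The mean value theorem bounds the difference quotients by \<open>w\<close> on the whole
  interval, so dominated convergence applies along every sequence tending to \<open>t\<close>, once
  an initial segment outside the interval is dropped.\<close>

lemma has_real_derivative_integral:
  fixes \<phi> \<psi> :: "real \<Rightarrow> 'a \<Rightarrow> real"
  assumes t: "a < t" "t < b"
    and int: "\<And>s. a < s \<Longrightarrow> s < b \<Longrightarrow> integrable M (\<phi> s)"
    and der: "\<And>s y. a < s \<Longrightarrow> s < b \<Longrightarrow> y \<in> space M \<Longrightarrow> ((\<lambda>s. \<phi> s y) has_real_derivative \<psi> s y) (at s)"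
    and bnd: "\<And>s y. a < s \<Longrightarrow> s < b \<Longrightarrow> y \<in> space M \<Longrightarrow> \<bar>\<psi> s y\<bar> \<le> w y"
    and w: "integrable M w" and \<psi>m: "\<psi> t \<in> borel_measurable M"
  shows "((\<lambda>s. \<integral>y. \<phi> s y \<partial>M) has_real_derivative (\<integral>y. \<psi> t y \<partial>M)) (at t)"
  unfolding has_field_derivative_iff tendsto_at_iff_sequentially
proof (intro allI impI)
  fix X :: "nat \<Rightarrow> real" assume Xt: "\<forall>i. X i \<in> UNIV - {t}" and X: "X \<longlonglongrightarrow> t"
  have "eventually (\<lambda>n. a < X n \<and> X n < b) sequentially"
    using order_tendstoD[OF X] t by (auto intro: eventually_conj)
  then obtain n0 where n0: "\<And>n. n \<ge> n0 \<Longrightarrow> a < X n \<and> X n < b" unfolding eventually_sequentially by auto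
  define Y where "Y n = X (n + n0)" for n
  have Y: "a < Y n" "Y n < b" "Y n \<noteq> t" for n using n0[of "n + n0"] Xt by (auto simp: Y_def)
  have Ylim: "Y \<longlonglongrightarrow> t" unfolding Y_def using X by (rule LIMSEQ_ignore_initial_segment)
  have "(\<lambda>n. \<integral>y. (\<phi> (Y n) y - \<phi> t y) / (Y n - t) \<partial>M) \<longlonglongrightarrow> (\<integral>y. \<psi> t y \<partial>M)"
  proof (rule integral_dominated_convergence[where w=w])
    show "(\<lambda>y. (\<phi> (Y n) y - \<phi> t y) / (Y n - t)) \<in> borel_measurable M" for n
      using borel_measurable_integrable[OF int[OF Y(1,2)]] borel_measurable_integrable[OF int[OF t]] by measurable
    show "AE y in M. (\<lambda>n. (\<phi> (Y n) y - \<phi> t y) / (Y n - t)) \<longlonglongrightarrow> \<psi> t y"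
    proof (rule AE_I2)
      fix y assume "y \<in> space M"
      from der[OF t this, unfolded has_field_derivative_iff tendsto_at_iff_sequentially, rule_format, of Y] Y Ylim
      show "(\<lambda>n. (\<phi> (Y n) y - \<phi> t y) / (Y n - t)) \<longlonglongrightarrow> \<psi> t y" by (simp add: o_def)
    qed
    show "AE y in M. norm ((\<phi> (Y n) y - \<phi> t y) / (Y n - t)) \<le> w y" for n
    proof (rule AE_I2)
      fix y assume y: "y \<in> space M"
      have "\<bar>\<phi> q y - \<phi> p y\<bar> \<le> w y * (q - p)" if pq: "a < p" "p < q" "q < b" for p q
      proof -
        obtain z where z: "p < z" "z < q" "\<phi> q y - \<phi> p y = (q - p) * \<psi> z y"
          using MVT2[OF pq(2), of "\<lambda>s. \<phi> s y" "\<lambda>s. \<psi> s y"] der[OF _ _ y] pq by auto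
        then show ?thesis using bnd[of z y] y pq by (simp add: abs_mult mult.commute mult_left_mono)
      qed
      from this[of t "Y n"] this[of "Y n" t]
      have "\<bar>\<phi> (Y n) y - \<phi> t y\<bar> \<le> w y * \<bar>Y n - t\<bar>"
        using Y[of n] t by (cases "t < Y n") (auto simp: abs_minus_commute)
      then show "norm ((\<phi> (Y n) y - \<phi> t y) / (Y n - t)) \<le> w y"
        using Y(3)[of n] by (simp add: abs_divide pos_divide_le_eq)
    qed
  qed (use w \<psi>m in auto)
  moreover have "(\<integral>y. (\<phi> (Y n) y - \<phi> t y) / (Y n - t) \<partial>M)
      = ((\<integral>y. \<phi> (Y n) y \<partial>M) - (\<integral>y. \<phi> t y \<partial>M)) / (Y n - t)" for n
    using int[OF Y(1,2)] int[OF t] by simp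
  ultimately have "(\<lambda>n. ((\<integral>y. \<phi> (X (n + n0)) y \<partial>M) - (\<integral>y. \<phi> t y \<partial>M)) / (X (n + n0) - t)) \<longlonglongrightarrow> (\<integral>y. \<psi> t y \<partial>M)"
    by (simp only: Y_def)
  then show "((\<lambda>s. ((\<integral>y. \<phi> s y \<partial>M) - (\<integral>y. \<phi> t y \<partial>M)) / (s - t)) \<circ> X) \<longlonglongrightarrow> (\<integral>y. \<psi> t y \<partial>M)"
    unfolding o_def by (rule LIMSEQ_offset)
qed

text \<open>Here the score is the time derivative of the log-likelihood
  \<open>- |x - f y|^2 / (2 s^2)\<close>, not its gradient in \<open>x\<close>; \<open>f'\<close>
  and \<open>s'\<close> are the time derivatives of \<open>f\<close> and \<open>s\<close>.\<close>

definition score :: "nat \<Rightarrow> real \<Rightarrow> real \<Rightarrow> real \<Rightarrow> real \<Rightarrow> vec \<Rightarrow> vec \<Rightarrow> real" where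
  "score d f f' s s' x y = s' / s ^ 3 * (\<Sum>i<d. (x i - f * y i)\<^sup>2) + f' / s\<^sup>2 * (\<Sum>i<d. (x i - f * y i) * y i)"

lemma measurable_score [measurable]: "(\<lambda>y. score d f f' s s' x y) \<in> borel_measurable (Rd_lborel d)"
  unfolding score_def by measurable

lemma ker_derivative:
  assumes f: "(f has_real_derivative f') (at t)" and s: "(s has_real_derivative s') (at t)" and pos: "0 < s t"
  shows "((\<lambda>t. ker d (f t) (s t) x y) has_real_derivative score d (f t) f' (s t) s' x y * ker d (f t) (s t) x y) (at t)"
proof -
  define R where "R t = (\<Sum>i<d. (x i - f t * y i)\<^sup>2)" for t
  define I where "I = (\<Sum>i<d. (x i - f t * y i) * y i)"
  have dR: "(R has_real_derivative - 2 * f' * I) (at t)"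
  proof -
    have "((\<lambda>t. (x i - f t * y i)\<^sup>2) has_real_derivative - 2 * f' * ((x i - f t * y i) * y i)) (at t)" for i
      by (rule derivative_eq_intros f refl | simp add: algebra_simps)+
    then show ?thesis unfolding R_def[abs_def] I_def sum_distrib_left by (intro DERIV_sum) auto
  qed
  have "((\<lambda>t. - R t / (2 * (s t)\<^sup>2)) has_real_derivative s' / (s t) ^ 3 * R t + f' / (s t)\<^sup>2 * I) (at t)"
    using pos by (auto intro!: derivative_eq_intros dR s simp: field_simps power2_eq_square power3_eq_cube)
  then have "((\<lambda>t. exp (- R t / (2 * (s t)\<^sup>2))) has_real_derivative
      exp (- R t / (2 * (s t)\<^sup>2)) * (s' / (s t) ^ 3 * R t + f' / (s t)\<^sup>2 * I)) (at t)"
    by (rule DERIV_fun_exp)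
  then show ?thesis
    unfolding ker_def rdist_sq score_def R_def[symmetric] I_def[symmetric] by (simp add: mult.commute)
qed

text \<open>A crude majorant, polynomial in \<open>y\<close> and degenerate for small
  \<open>b\<close>. It serves domination and integrability only; the quantitative estimates go
  through \<open>score_expansion\<close>.\<close>

lemma score_bound:
  assumes "\<bar>f\<bar> \<le> 1" "\<bar>f'\<bar> \<le> B" "\<bar>s'\<bar> \<le> B" "0 < b" "b \<le> s"
  shows "\<bar>score d f f' s s' x y\<bar> \<le> (B / b ^ 3 + B / b\<^sup>2) * (1 + Rd_norm d x)\<^sup>2 * (1 + Rd_norm d y)\<^sup>2"
proof -
  define n where "n = (1 + Rd_norm d x) * (1 + Rd_norm d y)"
  have B0: "B \<ge> 0" using assms by linarith
  have fy: "Rd_norm d (\<lambda>i. f * y i) \<le> Rd_norm d y"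
  proof -
    have "Rd_norm d (\<lambda>i. f * y i) = \<bar>f\<bar> * Rd_norm d y"
      using L2_set_right_distrib[of "\<bar>f\<bar>" y "{..<d}"] by (simp add: L2_set_def power_mult_distrib)
    also have "\<dots> \<le> 1 * Rd_norm d y" using assms by (intro mult_right_mono) auto
    finally show ?thesis by simp
  qed
  have "rdist d x (\<lambda>i. f * y i) \<le> Rd_norm d x + Rd_norm d (\<lambda>i. f * y i)"
    using rdist_triangle[of d x "\<lambda>i. f * y i" "\<lambda>_. 0"] by (simp add: rdist_zero rdist_commute[of d "\<lambda>_. 0"])
  then have r: "rdist d x (\<lambda>i. f * y i) \<le> Rd_norm d x + Rd_norm d y" using fy by linarith
  have rn: "rdist d x (\<lambda>i. f * y i) \<le> n"
  proof -
    have "0 \<le> Rd_norm d x * Rd_norm d y" by simp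
    moreover have "n = 1 + Rd_norm d x + Rd_norm d y + Rd_norm d x * Rd_norm d y" by (simp add: n_def algebra_simps)
    ultimately show ?thesis using r by linarith
  qed
  have yn: "Rd_norm d y \<le> n"
  proof -
    have "0 \<le> Rd_norm d x * Rd_norm d y" by simp
    moreover have "n = 1 + Rd_norm d x + Rd_norm d y + Rd_norm d x * Rd_norm d y" by (simp add: n_def algebra_simps)
    moreover have "0 \<le> Rd_norm d x" by simp
    ultimately show ?thesis by linarith
  qed
  have n0: "n \<ge> 0" by (simp add: n_def)
  have p1: "\<bar>s' / s ^ 3 * (\<Sum>i<d. (x i - f * y i)\<^sup>2)\<bar> \<le> B / b ^ 3 * n\<^sup>2"
  proof -
    have "\<bar>s' / s ^ 3\<bar> \<le> B / b ^ 3"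
      unfolding abs_divide using assms B0 by (intro frac_le) (auto intro!: power_mono simp: power_abs)
    moreover have "(\<Sum>i<d. (x i - f * y i)\<^sup>2) \<le> n\<^sup>2"
      using power_mono[OF rn, of 2] by (simp add: rdist_sq)
    moreover have "0 \<le> (\<Sum>i<d. (x i - f * y i)\<^sup>2)" by (simp add: sum_nonneg)
    ultimately show ?thesis unfolding abs_mult using B0 assms by (intro mult_mono) auto
  qed
  have p2: "\<bar>f' / s\<^sup>2 * (\<Sum>i<d. (x i - f * y i) * y i)\<bar> \<le> B / b\<^sup>2 * n\<^sup>2"
  proof -
    have "\<bar>f' / s\<^sup>2\<bar> \<le> B / b\<^sup>2"
      unfolding abs_divide using assms B0 by (intro frac_le) (auto intro!: power_mono)
    moreover have "\<bar>\<Sum>i<d. (x i - f * y i) * y i\<bar> \<le> n\<^sup>2"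
    proof -
      have "\<bar>\<Sum>i<d. (x i - f * y i) * y i\<bar> \<le> rdist d x (\<lambda>i. f * y i) * Rd_norm d y"
        using inner_le_norm[of "\<lambda>i. x i - f * y i" y d] by (simp add: rdist_def)
      also have "\<dots> \<le> n * n" using rn yn n0 by (intro mult_mono) auto
      finally show ?thesis by (simp add: power2_eq_square)
    qed
    ultimately show ?thesis unfolding abs_mult using B0 assms by (intro mult_mono) auto
  qed
  have "\<bar>score d f f' s s' x y\<bar> \<le> B / b ^ 3 * n\<^sup>2 + B / b\<^sup>2 * n\<^sup>2"
    unfolding score_def using p1 p2 by linarith
  also have "\<dots> = (B / b ^ 3 + B / b\<^sup>2) * n\<^sup>2" by (simp only: distrib_right)
  finally show ?thesis unfolding n_def power_mult_distrib by (simp only: mult.assoc)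
qed

text \<open>Expansion of the quadratic polynomial about \<open>m\<close>, in the form constant plus
  multiple of the squared distance plus linear functional that
  \<open>quadratic_covariance_bound\<close> accepts when \<open>m\<close> is the posterior
  mean.\<close>

lemma score_expansion:
  assumes s: "0 < s"
  shows "score d f f' s s' x y = score d f f' s s' x m
    + (s' / s * f\<^sup>2 - f' * f) / s\<^sup>2 * (rdist d y m)\<^sup>2
    + (\<Sum>i<d. ((- 2 * (s' / s) * f * (x i - f * m i) + f' * (x i - 2 * f * m i)) / s\<^sup>2) * (y i - m i))"
proof -
  have "s' / s ^ 3 * (x i - f * y i)\<^sup>2 + f' / s\<^sup>2 * ((x i - f * y i) * y i)
      = s' / s ^ 3 * (x i - f * m i)\<^sup>2 + f' / s\<^sup>2 * ((x i - f * m i) * m i)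
        + (s' / s * f\<^sup>2 - f' * f) / s\<^sup>2 * (y i - m i)\<^sup>2
        + ((- 2 * (s' / s) * f * (x i - f * m i) + f' * (x i - 2 * f * m i)) / s\<^sup>2) * (y i - m i)" for i
    using s by (simp add: field_simps power2_eq_square power3_eq_cube)
  then have "(\<Sum>i<d. s' / s ^ 3 * (x i - f * y i)\<^sup>2 + f' / s\<^sup>2 * ((x i - f * y i) * y i))
      = (\<Sum>i<d. s' / s ^ 3 * (x i - f * m i)\<^sup>2 + f' / s\<^sup>2 * ((x i - f * m i) * m i)
        + (s' / s * f\<^sup>2 - f' * f) / s\<^sup>2 * (y i - m i)\<^sup>2
        + ((- 2 * (s' / s) * f * (x i - f * m i) + f' * (x i - 2 * f * m i)) / s\<^sup>2) * (y i - m i))"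
    by simp
  then show ?thesis
    unfolding score_def rdist_sq sum_distrib_left sum.distrib .
qed

section \<open>Bounds on the posterior mean, its time derivative and the velocity\<close>

lemma Rd_norm_scale: "Rd_norm d (\<lambda>i. r * x i) = \<bar>r\<bar> * Rd_norm d x"
  using L2_set_right_distrib[of "\<bar>r\<bar>" x "{..<d}"] by (simp add: L2_set_def power_mult_distrib)

lemma Rd_norm_add: "Rd_norm d (\<lambda>i. x i + y i) \<le> Rd_norm d x + Rd_norm d y"
  by (rule L2_set_triangle_ineq)

text \<open>Bounds \<open>c1\<close> for every curvature at least \<open>L\<close>, because
  \<open>(K + sqrt L)^2 / L = (K / sqrt L + 1)^2\<close> decreases in \<open>L\<close>.\<close>

definition conc_const :: "real \<Rightarrow> real \<Rightarrow> real" where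
  "conc_const L K = exp (2 * K + (K / sqrt L + 1)\<^sup>2)"

text \<open>The three summands are the norm of the near-maximizer, the root mean square distance to
  it under the prior curvature, and the cost of its poor fit to the observation.
  \<open>\<Theta>\<close> bounds \<open>1 / (s^2 * L)\<close> for the posterior curvature.\<close>

definition mean_const :: "real \<Rightarrow> real \<Rightarrow> real \<Rightarrow> real \<Rightarrow> real" where
  "mean_const L K B \<Theta> = B + sqrt (16 / L * (4 * K\<^sup>2 / L + 2 * K + 2)) + 2 * sqrt \<Theta> * (1 + B)"

text \<open>The overall \<open>\<Theta>\<close> is the factor \<open>1 / s^2\<close> of the score
  times the decay of the covariance. The first summand stems from the quadratic part of the score,
  the second from its linear part.\<close>

definition deriv_const :: "real \<Rightarrow> real \<Rightarrow> real \<Rightarrow> real \<Rightarrow> real" where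
  "deriv_const L K B \<Theta> = \<Theta> * (111 * (conc_const L K)\<^sup>2 / sqrt L + 16 * conc_const L K * (1 + mean_const L K B \<Theta>))"

lemma split_quadratic_term:
  "16 / M * (a + (b + r\<^sup>2 / (2 * s\<^sup>2)) / 2) = 16 / M * (a + b / 2) + 4 * (1 / s\<^sup>2 / M) * r\<^sup>2"
  if "0 < M" "0 < s" for M a b r s :: real
  using that by (simp add: field_simps)

context wlc_density
begin

definition postmean :: "real \<Rightarrow> real \<Rightarrow> vec \<Rightarrow> nat \<Rightarrow> real" where
  "postmean f s x i = N f s x i / Z f s x"

lemma postmean_eq_mean:
  assumes "0 < s" "i < d"
  shows "postmean f s x i = wlc_density.mean d (Q f s x) i"
proof -
  interpret post: wlc_density d "L + f\<^sup>2 / s\<^sup>2" K "Q f s x" by (rule posterior_wlc) fact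
  have "(\<lambda>y. y i) \<in> borel_measurable (Rd_lborel d)" using assms by simp
  then show ?thesis using assms posterior_expectation[of s "\<lambda>y. y i" f x]
    by (simp add: post.mean_def postmean_def N_def)
qed

text \<open>On a compact subinterval around \<open>t\<close>, \<open>\<sigma>\<close> is bounded
  below and both time derivatives are bounded by continuity, so the score has a majorant of
  quadratic growth in \<open>y\<close>, integrable even after multiplication by
  \<open>h\<close>.\<close>

lemma ker_expectation_derivative:
  fixes f \<sigma> f' \<sigma>' :: "real \<Rightarrow> real"
  assumes t: "0 < t" "t < 1"
    and f: "\<And>s. 0 < s \<Longrightarrow> s < 1 \<Longrightarrow> (f has_real_derivative f' s) (at s)" "continuous_on {0<..<1} f'"
    and \<sigma>: "\<And>s. 0 < s \<Longrightarrow> s < 1 \<Longrightarrow> (\<sigma> has_real_derivative \<sigma>' s) (at s)" "continuous_on {0<..<1} \<sigma>'"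
    and \<sigma>pos: "\<And>s. 0 < s \<Longrightarrow> s < 1 \<Longrightarrow> 0 < \<sigma> s" and f1: "\<And>s. 0 < s \<Longrightarrow> s < 1 \<Longrightarrow> \<bar>f s\<bar> \<le> 1"
    and h[measurable]: "h \<in> borel_measurable (Rd_lborel d)" and hb: "\<And>y. y \<in> Rd d \<Longrightarrow> \<bar>h y\<bar> \<le> 1 + Rd_norm d y"
  shows "((\<lambda>s. expectation (\<lambda>y. h y * ker d (f s) (\<sigma> s) x y)) has_real_derivative
    expectation (\<lambda>y. h y * (score d (f t) (f' t) (\<sigma> t) (\<sigma>' t) x y * ker d (f t) (\<sigma> t) x y))) (at t)"
proof -
  define a where "a = t / 2"
  define b where "b = (t + 1) / 2"
  have ab: "0 < a" "a < t" "t < b" "b < 1" using t by (auto simp: a_def b_def)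
  have sub: "{a..b} \<subseteq> {0<..<1}" using ab by auto
  have bdd: "\<exists>B. \<forall>s\<in>{a..b}. \<bar>g s\<bar> \<le> B" if "continuous_on {0<..<1} g" for g :: "real \<Rightarrow> real"
    using compact_imp_bounded[OF compact_continuous_image[OF continuous_on_subset[OF that sub] compact_Icc]]
    unfolding bounded_iff by auto
  obtain B1 where B1: "\<And>s. s \<in> {a..b} \<Longrightarrow> \<bar>f' s\<bar> \<le> B1" using bdd[OF f(2)] by blast
  obtain B2 where B2: "\<And>s. s \<in> {a..b} \<Longrightarrow> \<bar>\<sigma>' s\<bar> \<le> B2" using bdd[OF \<sigma>(2)] by blast
  have \<sigma>c: "continuous_on {a..b} \<sigma>"
    using DERIV_isCont[OF \<sigma>(1)] sub by (intro continuous_at_imp_continuous_on) auto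
  obtain s0 where s0: "s0 \<in> {a..b}" "\<And>s. s \<in> {a..b} \<Longrightarrow> \<sigma> s0 \<le> \<sigma> s"
    using continuous_attains_inf[of "{a..b}" \<sigma>] \<sigma>c ab by auto
  have s0p: "\<sigma> s0 > 0" using \<sigma>pos[of s0] s0(1) sub by auto
  define B where "B = max B1 B2"
  define CC where "CC = (B / (\<sigma> s0) ^ 3 + B / (\<sigma> s0)\<^sup>2) * (1 + Rd_norm d x)\<^sup>2"
  show ?thesis
  proof (rule has_real_derivative_integral[OF ab(2,3), where w="\<lambda>y. \<bar>h y\<bar> * (CC * (1 + Rd_norm d y)\<^sup>2)"])
    show "integrable \<nu> (\<lambda>y. h y * ker d (f s) (\<sigma> s) x y)" for s
      by (rule integrable_mult_ker, rule integrable_poly[where C=1 and k=1]) (use hb in auto)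
    show "integrable \<nu> (\<lambda>y. \<bar>h y\<bar> * (CC * (1 + Rd_norm d y)\<^sup>2))"
    proof (rule integrable_poly[where C="\<bar>CC\<bar>" and k=3])
      fix y assume y: "y \<in> Rd d"
      have "\<bar>\<bar>h y\<bar> * (CC * (1 + Rd_norm d y)\<^sup>2)\<bar> = \<bar>h y\<bar> * (\<bar>CC\<bar> * (1 + Rd_norm d y)\<^sup>2)"
        by (simp add: abs_mult)
      also have "\<dots> \<le> (1 + Rd_norm d y) * (\<bar>CC\<bar> * (1 + Rd_norm d y)\<^sup>2)"
        by (intro mult_right_mono hb y) auto
      also have "\<dots> = \<bar>CC\<bar> * (1 + Rd_norm d y) ^ 3" by (simp add: power3_eq_cube power2_eq_square)
      finally show "\<bar>\<bar>h y\<bar> * (CC * (1 + Rd_norm d y)\<^sup>2)\<bar> \<le> \<bar>CC\<bar> * (1 + Rd_norm d y) ^ 3" .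
    qed measurable
    fix s y assume s: "a < s" "s < b" and y: "y \<in> space \<nu>"
    have s': "0 < s" "s < 1" "s \<in> {a..b}" using s ab by auto
    show "((\<lambda>s. h y * ker d (f s) (\<sigma> s) x y) has_real_derivative
        h y * (score d (f s) (f' s) (\<sigma> s) (\<sigma>' s) x y * ker d (f s) (\<sigma> s) x y)) (at s)"
      by (intro DERIV_cmult ker_derivative f \<sigma> \<sigma>pos s')
    have "\<bar>score d (f s) (f' s) (\<sigma> s) (\<sigma>' s) x y\<bar> \<le> CC * (1 + Rd_norm d y)\<^sup>2"
      unfolding CC_def
      by (rule score_bound) (use f1 s' B1[of s] B2[of s] s0 s0p in \<open>auto simp: B_def\<close>)
    then have "\<bar>score d (f s) (f' s) (\<sigma> s) (\<sigma>' s) x y\<bar> * ker d (f s) (\<sigma> s) x y \<le> CC * (1 + Rd_norm d y)\<^sup>2 * 1"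
      by (intro mult_mono) (auto simp: ker_le_1)
    then show "\<bar>h y * (score d (f s) (f' s) (\<sigma> s) (\<sigma>' s) x y * ker d (f s) (\<sigma> s) x y)\<bar> \<le> \<bar>h y\<bar> * (CC * (1 + Rd_norm d y)\<^sup>2)"
      by (simp add: abs_mult mult_left_mono)
  qed (measurable)
qed

lemma integrable_score:
  assumes [measurable]: "h \<in> borel_measurable (Rd_lborel d)" and hb: "\<And>y. y \<in> Rd d \<Longrightarrow> \<bar>h y\<bar> \<le> 1 + Rd_norm d y"
    and "\<bar>f\<bar> \<le> 1" "0 < s"
  shows "integrable \<nu> (\<lambda>y. h y * score d f f' s s' x y)"
proof (rule integrable_poly[where C="(max \<bar>f'\<bar> \<bar>s'\<bar> / s ^ 3 + max \<bar>f'\<bar> \<bar>s'\<bar> / s\<^sup>2) * (1 + Rd_norm d x)\<^sup>2" and k=3])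
  fix y assume y: "y \<in> Rd d"
  have "\<bar>h y * score d f f' s s' x y\<bar> \<le> (1 + Rd_norm d y) *
      ((max \<bar>f'\<bar> \<bar>s'\<bar> / s ^ 3 + max \<bar>f'\<bar> \<bar>s'\<bar> / s\<^sup>2) * (1 + Rd_norm d x)\<^sup>2 * (1 + Rd_norm d y)\<^sup>2)"
    unfolding abs_mult by (intro mult_mono hb y score_bound) (use assms in auto)
  also have "\<dots> = (max \<bar>f'\<bar> \<bar>s'\<bar> / s ^ 3 + max \<bar>f'\<bar> \<bar>s'\<bar> / s\<^sup>2) * (1 + Rd_norm d x)\<^sup>2 * (1 + Rd_norm d y) ^ 3"
    by (simp add: power3_eq_cube power2_eq_square)
  finally show "\<bar>h y * score d f f' s s' x y\<bar> \<le> (max \<bar>f'\<bar> \<bar>s'\<bar> / s ^ 3 + max \<bar>f'\<bar> \<bar>s'\<bar> / s\<^sup>2) * (1 + Rd_norm d x)\<^sup>2 * (1 + Rd_norm d y) ^ 3" .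
qed measurable

text \<open>The quotient rule for \<open>N / Z\<close> yields the posterior covariance of the
  coordinate with the score.\<close>

lemma postmean_derivative:
  fixes f \<sigma> f' \<sigma>' :: "real \<Rightarrow> real"
  assumes t: "0 < t" "t < 1"
    and f: "\<And>s. 0 < s \<Longrightarrow> s < 1 \<Longrightarrow> (f has_real_derivative f' s) (at s)" "continuous_on {0<..<1} f'"
    and \<sigma>: "\<And>s. 0 < s \<Longrightarrow> s < 1 \<Longrightarrow> (\<sigma> has_real_derivative \<sigma>' s) (at s)" "continuous_on {0<..<1} \<sigma>'"
    and \<sigma>pos: "\<And>s. 0 < s \<Longrightarrow> s < 1 \<Longrightarrow> 0 < \<sigma> s" and f1: "\<And>s. 0 < s \<Longrightarrow> s < 1 \<Longrightarrow> \<bar>f s\<bar> \<le> 1"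
    and i: "i < d"
  shows "((\<lambda>s. postmean (f s) (\<sigma> s) x i) has_real_derivative
    (\<integral>y. (y i - wlc_density.mean d (Q (f t) (\<sigma> t) x) i) * score d (f t) (f' t) (\<sigma> t) (\<sigma>' t) x y
      \<partial>wlc_density.\<nu> d (Q (f t) (\<sigma> t) x))) (at t)"
proof -
  define S where "S y = score d (f t) (f' t) (\<sigma> t) (\<sigma>' t) x y" for y
  have Sm[measurable]: "S \<in> borel_measurable (Rd_lborel d)" unfolding S_def by measurable
  have \<sigma>t: "0 < \<sigma> t" by (rule \<sigma>pos[OF t])
  have comp[measurable]: "(\<lambda>y. y i) \<in> borel_measurable (Rd_lborel d)" using i by simp
  have cb: "\<bar>y i\<bar> \<le> 1 + Rd_norm d y" for y using abs_component_le_norm[OF i, of y] by linarith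
  interpret post: wlc_density d "L + (f t)\<^sup>2 / (\<sigma> t)\<^sup>2" K "Q (f t) (\<sigma> t) x" by (rule posterior_wlc[OF \<sigma>t])
  let ?Z = "Z (f t) (\<sigma> t) x" and ?N = "N (f t) (\<sigma> t) x i"
  let ?k = "ker d (f t) (\<sigma> t) x"
  have dZ: "((\<lambda>s. Z (f s) (\<sigma> s) x) has_real_derivative expectation (\<lambda>y. S y * ?k y)) (at t)"
    using ker_expectation_derivative[OF t f \<sigma> \<sigma>pos f1, of "\<lambda>_. 1" x] by (simp add: Z_def S_def)
  have dN: "((\<lambda>s. N (f s) (\<sigma> s) x i) has_real_derivative expectation (\<lambda>y. y i * (S y * ?k y))) (at t)"
    using ker_expectation_derivative[OF t f \<sigma> \<sigma>pos f1, of "\<lambda>y. y i" x] cb by (simp add: N_def S_def)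
  have Zp: "?Z \<noteq> 0" using Z_pos[of "f t" "\<sigma> t" x] by simp
  have ES: "integral\<^sup>L post.\<nu> S = expectation (\<lambda>y. S y * ?k y) / ?Z"
    by (rule posterior_expectation[OF \<sigma>t Sm])
  have EyS: "integral\<^sup>L post.\<nu> (\<lambda>y. y i * S y) = expectation (\<lambda>y. y i * (S y * ?k y)) / ?Z"
    using posterior_expectation[OF \<sigma>t, of "\<lambda>y. y i * S y" "f t" x] by (simp add: mult.assoc)
  have mean: "post.mean i = ?N / ?Z"
    using postmean_eq_mean[OF \<sigma>t i, of "f t" x] by (simp add: postmean_def)
  have iS: "integrable post.\<nu> S" "integrable post.\<nu> (\<lambda>y. y i * S y)"
    using post.integrable_score[of "\<lambda>_. 1" "f t" "\<sigma> t" "f' t" "\<sigma>' t" x]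
      post.integrable_score[of "\<lambda>y. y i" "f t" "\<sigma> t" "f' t" "\<sigma>' t" x] f1[OF t] \<sigma>t cb
    unfolding S_def[abs_def] by simp_all
  have "((\<lambda>s. postmean (f s) (\<sigma> s) x i) has_real_derivative
      (expectation (\<lambda>y. y i * (S y * ?k y)) * ?Z - ?N * expectation (\<lambda>y. S y * ?k y)) / (?Z * ?Z)) (at t)"
    unfolding postmean_def by (rule DERIV_divide[OF dN dZ Zp])
  also have "(expectation (\<lambda>y. y i * (S y * ?k y)) * ?Z - ?N * expectation (\<lambda>y. S y * ?k y)) / (?Z * ?Z)
      = integral\<^sup>L post.\<nu> (\<lambda>y. y i * S y) - post.mean i * integral\<^sup>L post.\<nu> S"
    unfolding ES EyS mean using Zp by (simp add: field_simps)
  also have "\<dots> = (\<integral>y. (y i - post.mean i) * S y \<partial>post.\<nu>)"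
    unfolding left_diff_distrib using iS by simp
  finally show ?thesis by (simp add: S_def)
qed

text \<open>The kernel is at most 1 everywhere and equals \<open>exp (- r^2 / (2 * s^2))\<close> at
  \<open>c\<close>, where \<open>r\<close> is the distance of \<open>x\<close> to
  \<open>f * c\<close>. So \<open>c\<close> stays a near-maximizer of the posterior, at that
  additional cost in the exponent.\<close>

lemma near_maximum_posterior:
  assumes s: "0 < s" and dom: "\<And>y. y \<in> Rd d \<Longrightarrow> P y \<le> exp (q + K * rdist d y c) * P c" and y: "y \<in> Rd d"
  shows "Q f s x y \<le> exp (q + (rdist d x (\<lambda>i. f * c i))\<^sup>2 / (2 * s\<^sup>2) + K * rdist d y c) * Q f s x c"
proof -
  let ?q = "(rdist d x (\<lambda>i. f * c i))\<^sup>2 / (2 * s\<^sup>2)"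
  have "ker d f s x c * exp ?q = 1" by (simp add: ker_def mult_exp_exp)
  then have k: "ker d f s x y \<le> exp ?q * ker d f s x c" using ker_le_1 by (simp add: mult.commute)
  have "P y * ker d f s x y \<le> (exp (q + K * rdist d y c) * P c) * (exp ?q * ker d f s x c)"
    by (intro mult_mono dom y k) (auto simp: P_nonneg)
  also have "\<dots> = exp (q + ?q + K * rdist d y c) * (P c * ker d f s x c)"
    by (simp add: exp_add mult_ac)
  finally show ?thesis unfolding Q_def using Z_pos[of f s x] by (simp add: divide_right_mono)
qed

text \<open>The mean lies close to the near-maximizer \<open>c\<close> of the prior. Its cost
  \<open>r^2 / (2 * s^2)\<close> as a near-maximizer of the posterior blows up for small
  \<open>s\<close>, but it is divided by the posterior curvature, which leaves
  \<open>4 * \<Theta> * r^2\<close>.\<close>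

lemma postmean_bound:
  assumes d: "1 \<le> d" and s: "0 < s" and f1: "\<bar>f\<bar> \<le> 1"
    and c: "c \<in> Rd d" and cB: "Rd_norm d c \<le> B * sqrt d"
    and dom: "\<And>y. y \<in> Rd d \<Longrightarrow> P y \<le> exp (1 + K + K * rdist d y c) * P c"
    and \<Theta>: "1 / s\<^sup>2 \<le> \<Theta> * (L + f\<^sup>2 / s\<^sup>2)"
  shows "Rd_norm d (postmean f s x) \<le> mean_const L K B \<Theta> * (sqrt d + Rd_norm d x)"
proof -
  let ?L = "L + f\<^sup>2 / s\<^sup>2"
  interpret post: wlc_density d ?L K "Q f s x" by (rule posterior_wlc[OF s])
  have LL: "L \<le> ?L" "0 < ?L" using L_pos by (simp_all add: add_pos_nonneg)
  have sd: "1 \<le> sqrt d" using d by simp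
  define r where "r = rdist d x (\<lambda>i. f * c i)"
  define n where "n = sqrt d + Rd_norm d x"
  have B0: "0 \<le> B" using cB sd by (smt (verit) L2_set_nonneg mult_neg_pos)
  have \<Theta>0: "0 \<le> \<Theta>"
  proof (rule ccontr)
    assume "\<not> 0 \<le> \<Theta>"
    then have "\<Theta> * ?L < 0" using LL by (simp add: mult_neg_pos)
    moreover have "0 < 1 / s\<^sup>2" using s by simp
    ultimately show False using \<Theta> by linarith
  qed
  have xc: "Rd_norm d x + Rd_norm d c \<le> (1 + B) * n"
  proof -
    have "Rd_norm d x + Rd_norm d c \<le> Rd_norm d x + B * sqrt d" using cB by simp
    also have "\<dots> \<le> (1 + B) * n" using B0 by (simp add: n_def algebra_simps)
    finally show ?thesis .
  qed
  have "r \<le> Rd_norm d x + Rd_norm d (\<lambda>i. f * c i)"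
    unfolding r_def using rdist_triangle[of d x "\<lambda>i. f * c i" "\<lambda>_. 0"] 
      by (simp add: rdist_def) (metis L2_set_triangle_ineq rdist_def rdist_triangle rdist_zero rdist_commute add.commute)
  also have "Rd_norm d (\<lambda>i. f * c i) \<le> Rd_norm d c"
    unfolding Rd_norm_scale using f1 by (intro mult_left_le_one_le) auto
  finally have r: "r \<le> (1 + B) * n" using xc by linarith
  have "(rdist d post.mean c)\<^sup>2 \<le> 16 / ?L * (d + 4 * K\<^sup>2 / ?L + K + (1 + K + r\<^sup>2 / (2 * s\<^sup>2)) / 2)"
    unfolding r_def by (rule post.mean_distance_to_near_maximum[OF c near_maximum_posterior[OF s dom]])
  also have "\<dots> = 16 / ?L * (d + 4 * K\<^sup>2 / ?L + K + (1 + K) / 2) + 4 * (1 / s\<^sup>2 / ?L) * r\<^sup>2"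
    using split_quadratic_term[OF LL(2) s, of "d + 4 * K\<^sup>2 / ?L + K" "1 + K" r] by (simp only: add.assoc)
  also have "\<dots> \<le> 16 / L * (4 * K\<^sup>2 / L + 2 * K + 2) * d + 4 * \<Theta> * r\<^sup>2"
  proof (rule add_mono)
    have "4 * K\<^sup>2 / ?L \<le> 4 * K\<^sup>2 / L" using LL L_pos by (intro divide_left_mono) auto
    also have "\<dots> \<le> 4 * K\<^sup>2 / L * d" using mult_left_mono[of 1 "real d" "4 * K\<^sup>2 / L"] d L_pos by simp
    finally have a1: "4 * K\<^sup>2 / ?L \<le> 4 * K\<^sup>2 / L * d" .
    have a2: "K + (1 + K) / 2 \<le> (2 * K + 1) * d"
    proof -
      have "K + (1 + K) / 2 \<le> (2 * K + 1) * 1" using K_nonneg by simp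
      also have "\<dots> \<le> (2 * K + 1) * d" using d K_nonneg by (intro mult_left_mono) auto
      finally show ?thesis .
    qed
    have "d + 4 * K\<^sup>2 / ?L + K + (1 + K) / 2 \<le> (4 * K\<^sup>2 / L + 2 * K + 2) * d"
      using a1 a2 by (simp add: algebra_simps)
    moreover have "16 / ?L \<le> 16 / L" using LL L_pos by (intro divide_left_mono) auto
    ultimately have "16 / ?L * (d + 4 * K\<^sup>2 / ?L + K + (1 + K) / 2) \<le> 16 / L * ((4 * K\<^sup>2 / L + 2 * K + 2) * d)"
      using LL L_pos K_nonneg by (intro mult_mono) auto
    then show "16 / ?L * (d + 4 * K\<^sup>2 / ?L + K + (1 + K) / 2) \<le> 16 / L * (4 * K\<^sup>2 / L + 2 * K + 2) * d"
      by (simp only: mult.assoc)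
    have "1 / s\<^sup>2 / ?L \<le> \<Theta>" using \<Theta> LL by (simp only: pos_divide_le_eq)
    then show "4 * (1 / s\<^sup>2 / ?L) * r\<^sup>2 \<le> 4 * \<Theta> * r\<^sup>2" by (intro mult_right_mono) auto
  qed
  also have "\<dots> \<le> (sqrt (16 / L * (4 * K\<^sup>2 / L + 2 * K + 2)) * sqrt d + 2 * sqrt \<Theta> * r)\<^sup>2"
  proof -
    let ?u = "sqrt (16 / L * (4 * K\<^sup>2 / L + 2 * K + 2)) * sqrt d" and ?v = "2 * sqrt \<Theta> * r"
    have "?u\<^sup>2 = 16 / L * (4 * K\<^sup>2 / L + 2 * K + 2) * d" "?v\<^sup>2 = 4 * \<Theta> * r\<^sup>2"
      using L_pos K_nonneg \<Theta>0 by (simp_all add: power_mult_distrib)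
    moreover have "0 \<le> 2 * ?u * ?v" using L_pos K_nonneg \<Theta>0 by (simp add: r_def)
    ultimately show ?thesis unfolding power2_sum by linarith
  qed
  finally have "rdist d post.mean c \<le> sqrt (16 / L * (4 * K\<^sup>2 / L + 2 * K + 2)) * sqrt d + 2 * sqrt \<Theta> * r"
    by (rule power2_le_imp_le) (use L_pos K_nonneg \<Theta>0 in \<open>simp add: r_def\<close>)
  also have "\<dots> \<le> sqrt (16 / L * (4 * K\<^sup>2 / L + 2 * K + 2)) * n + 2 * sqrt \<Theta> * ((1 + B) * n)"
    using r L_pos K_nonneg \<Theta>0 by (intro add_mono mult_left_mono) (auto simp: n_def)
  finally have "rdist d post.mean c \<le> sqrt (16 / L * (4 * K\<^sup>2 / L + 2 * K + 2)) * n + 2 * sqrt \<Theta> * ((1 + B) * n)" .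
  moreover have "Rd_norm d c \<le> B * n" using cB B0 by (simp add: n_def algebra_simps add_increasing2)
  ultimately have "Rd_norm d post.mean \<le> B * n + sqrt (16 / L * (4 * K\<^sup>2 / L + 2 * K + 2)) * n + 2 * sqrt \<Theta> * ((1 + B) * n)"
    using Rd_norm_le_rdist[of post.mean d c] by linarith
  moreover have "Rd_norm d (postmean f s x) = Rd_norm d post.mean"
    by (rule L2_set_cong) (use postmean_eq_mean[OF s] in auto)
  ultimately show ?thesis by (simp add: mean_const_def n_def algebra_simps)
qed


text \<open>Duality: \<open>D\<close> is tested against itself, so its squared norm is the
  covariance of a single linear functional with the score. Bounding the coordinates one by one would
  lose a factor \<open>sqrt d\<close>.\<close>

lemma postmean_derivative_bound:
  fixes f f' s s' :: real and x :: vec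
  assumes d: "1 \<le> d" and s: "0 < s" and f1: "\<bar>f\<bar> \<le> 1"
    and c: "c \<in> Rd d" and cB: "Rd_norm d c \<le> B * sqrt d"
    and dom: "\<And>y. y \<in> Rd d \<Longrightarrow> P y \<le> exp (1 + K + K * rdist d y c) * P c"
    and \<Theta>: "1 / s\<^sup>2 \<le> \<Theta> * (L + f\<^sup>2 / s\<^sup>2)"
  defines "D \<equiv> \<lambda>i. \<integral>y. (y i - wlc_density.mean d (Q f s x) i) * score d f f' s s' x y \<partial>wlc_density.\<nu> d (Q f s x)"
  shows "Rd_norm d D \<le> deriv_const L K B \<Theta> * (\<bar>s' / s\<bar> + \<bar>f'\<bar>) * (sqrt d + Rd_norm d x)"
proof -
  let ?L = "L + f\<^sup>2 / s\<^sup>2"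
  interpret post: wlc_density d ?L K "Q f s x" by (rule posterior_wlc[OF s])
  have LL: "L \<le> ?L" "0 < ?L" using L_pos by (simp_all add: add_pos_nonneg)
  have pm: "Rd_norm d post.mean \<le> mean_const L K B \<Theta> * (sqrt d + Rd_norm d x)"
  proof -
    have "Rd_norm d (postmean f s x) = Rd_norm d post.mean"
      by (rule L2_set_cong) (use postmean_eq_mean[OF s] in auto)
    then show ?thesis using postmean_bound[OF d s f1 c cB dom \<Theta>, of x] by simp
  qed
  define S where "S y = score d f f' s s' x y" for y
  have Sm[measurable]: "S \<in> borel_measurable (Rd_lborel d)" unfolding S_def[abs_def] by measurable
  define G where "G = \<bar>s' / s\<bar> + \<bar>f'\<bar>"
  define n where "n = sqrt d + Rd_norm d x"
  define \<kappa> where "\<kappa> = conc_const L K"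
  define k2 where "k2 = (s' / s * f\<^sup>2 - f' * f) / s\<^sup>2"
  define w where "w i = (- 2 * (s' / s) * f * (x i - f * post.mean i) + f' * (x i - 2 * f * post.mean i)) / s\<^sup>2" for i
  have G0: "0 \<le> G" by (simp add: G_def)
  have f2: "f\<^sup>2 \<le> 1" using f1 by (simp add: abs_square_le_1)
  have k2: "\<bar>k2\<bar> \<le> G / s\<^sup>2"
  proof -
    have "\<bar>s' / s * f\<^sup>2 - f' * f\<bar> \<le> \<bar>s' / s\<bar> * f\<^sup>2 + \<bar>f'\<bar> * \<bar>f\<bar>"
      using abs_triangle_ineq4[of "s' / s * f\<^sup>2" "f' * f"] by (simp add: abs_mult)
    also have "\<dots> \<le> \<bar>s' / s\<bar> * 1 + \<bar>f'\<bar> * 1" using f1 f2 by (intro add_mono mult_left_mono) auto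
    finally show ?thesis unfolding k2_def abs_divide using s by (simp add: G_def divide_right_mono)
  qed
  have w: "Rd_norm d w \<le> 2 * G / s\<^sup>2 * (Rd_norm d x + Rd_norm d post.mean)"
  proof -
    define a where "a = (- 2 * (s' / s) * f + f') / s\<^sup>2"
    define b where "b = (2 * (s' / s) * f\<^sup>2 - 2 * f * f') / s\<^sup>2"
    have "w = (\<lambda>i. a * x i + b * post.mean i)"
      using s by (auto simp: w_def a_def b_def field_simps power2_eq_square)
    then have "Rd_norm d w \<le> \<bar>a\<bar> * Rd_norm d x + \<bar>b\<bar> * Rd_norm d post.mean"
      using Rd_norm_add[where d=d and x="\<lambda>i. a * x i" and y="\<lambda>i. b * post.mean i"] by (simp add: Rd_norm_scale)
    also have "\<bar>a\<bar> \<le> 2 * G / s\<^sup>2"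
    proof -
      have "\<bar>- 2 * (s' / s) * f + f'\<bar> \<le> 2 * \<bar>s' / s\<bar> * \<bar>f\<bar> + \<bar>f'\<bar>"
        using abs_triangle_ineq[of "- 2 * (s' / s) * f" f'] by (simp add: abs_mult)
      also have "\<dots> \<le> 2 * \<bar>s' / s\<bar> * 1 + 2 * \<bar>f'\<bar>" using f1 by (intro add_mono mult_left_mono) auto
      finally show ?thesis unfolding a_def abs_divide using s by (simp add: G_def divide_right_mono)
    qed
    also have "\<bar>b\<bar> \<le> 2 * G / s\<^sup>2"
    proof -
      have "\<bar>2 * (s' / s) * f\<^sup>2 - 2 * f * f'\<bar> \<le> 2 * \<bar>s' / s\<bar> * f\<^sup>2 + 2 * \<bar>f'\<bar> * \<bar>f\<bar>"
        using abs_triangle_ineq4[of "2 * (s' / s) * f\<^sup>2" "2 * f * f'"] by (simp add: abs_mult mult_ac)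
      also have "\<dots> \<le> 2 * \<bar>s' / s\<bar> * 1 + 2 * \<bar>f'\<bar> * 1" using f1 f2 by (intro add_mono mult_left_mono) auto
      finally show ?thesis unfolding b_def abs_divide using s by (simp add: G_def divide_right_mono)
    qed
    finally show ?thesis by (simp add: distrib_left mult_right_mono)
  qed
  define T where "T = \<bar>k2\<bar> * (111 * post.c1\<^sup>2 * sqrt d / (?L * sqrt ?L)) + 8 * post.c1 / ?L * Rd_norm d w"
  have cov: "\<bar>\<integral>y. (\<Sum>i<d. D i * (y i - post.mean i)) * S y \<partial>post.\<nu>\<bar> \<le> Rd_norm d D * T"
    unfolding T_def
    by (rule post.quadratic_covariance_bound[OF d, where ?k0.0="score d f f' s s' x post.mean"])
       (unfold S_def k2_def w_def, rule score_expansion[OF s])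
  have iS: "integrable post.\<nu> (\<lambda>y. D i * ((y i - post.mean i) * S y))" if i: "i < d" for i
  proof -
    have "\<bar>y i\<bar> \<le> 1 + Rd_norm d y" for y using abs_component_le_norm[OF i, of y] by linarith
    then have "integrable post.\<nu> S" "integrable post.\<nu> (\<lambda>y. y i * S y)"
      using post.integrable_score[of "\<lambda>_. 1" f s f' s' x] post.integrable_score[of "\<lambda>y. y i" f s f' s' x] f1 s i
      unfolding S_def[abs_def] by simp_all
    then show ?thesis by (simp add: left_diff_distrib)
  qed
  have "(Rd_norm d D)\<^sup>2 = (\<Sum>i<d. D i * D i)" unfolding Rd_norm_sq by (simp only: power2_eq_square)
  also have "\<dots> = (\<Sum>i<d. \<integral>y. D i * ((y i - post.mean i) * S y) \<partial>post.\<nu>)"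
    by (simp add: D_def S_def)
  also have "\<dots> = (\<integral>y. (\<Sum>i<d. D i * ((y i - post.mean i) * S y)) \<partial>post.\<nu>)"
    by (rule Bochner_Integration.integral_sum[symmetric]) (use iS in auto)
  also have "\<dots> = (\<integral>y. (\<Sum>i<d. D i * (y i - post.mean i)) * S y \<partial>post.\<nu>)"
    by (simp add: sum_distrib_right mult.assoc)
  finally have "Rd_norm d D * Rd_norm d D \<le> Rd_norm d D * T" using cov by (simp add: power2_eq_square)
  then have "Rd_norm d D \<le> T"
  proof (cases "Rd_norm d D = 0")
    case True
    have "0 \<le> T" unfolding T_def using LL post.c1_ge_1 by simp
    then show ?thesis using True by simp
  next
    case False
    then have "0 < Rd_norm d D" by (simp add: less_le)
    with \<open>Rd_norm d D * Rd_norm d D \<le> Rd_norm d D * T\<close> show ?thesis by simp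
  qed
  also have "T \<le> G * \<Theta> * (111 * \<kappa>\<^sup>2 / sqrt L * n + 16 * \<kappa> * ((1 + mean_const L K B \<Theta>) * n))"
  proof -
    have \<Theta>': "1 / s\<^sup>2 / ?L \<le> \<Theta>" using \<Theta> LL by (simp only: pos_divide_le_eq)
    have "0 \<le> 1 / s\<^sup>2 / ?L" using LL by simp
    then have \<Theta>0: "0 \<le> \<Theta>" using \<Theta>' by linarith
    have c1: "post.c1 \<le> \<kappa>"
    proof -
      have "(K + sqrt ?L)\<^sup>2 / ?L = (K / sqrt ?L + 1)\<^sup>2"
      proof -
        have "K / sqrt ?L + 1 = (K + sqrt ?L) / sqrt ?L" using LL by (simp add: add_divide_distrib)
        then show ?thesis using LL by (simp add: power_divide)
      qed
      also have "\<dots> \<le> (K / sqrt L + 1)\<^sup>2"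
      proof (rule power_mono)
        have "K / sqrt ?L \<le> K / sqrt L" using LL L_pos K_nonneg by (intro divide_left_mono) auto
        then show "K / sqrt ?L + 1 \<le> K / sqrt L + 1" by simp
      qed (use K_nonneg LL in simp)
      finally show ?thesis by (simp add: post.c1_def \<kappa>_def conc_const_def)
    qed
    have c10: "0 \<le> post.c1" using post.c1_ge_1 by simp
    have n1: "sqrt d \<le> n" by (simp add: n_def)
    have n2: "Rd_norm d x + Rd_norm d post.mean \<le> (1 + mean_const L K B \<Theta>) * n"
    proof -
      have "Rd_norm d x \<le> n" by (simp add: n_def)
      then have "Rd_norm d x + Rd_norm d post.mean \<le> n + mean_const L K B \<Theta> * n"
        using pm unfolding n_def by (rule add_mono)
      then show ?thesis by (simp only: distrib_right mult_1)
    qed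
    have sq: "111 * post.c1\<^sup>2 * sqrt d / sqrt ?L \<le> 111 * \<kappa>\<^sup>2 / sqrt L * n"
    proof -
      have "111 * post.c1\<^sup>2 * sqrt d / sqrt ?L \<le> 111 * \<kappa>\<^sup>2 * n / sqrt L"
        using c1 c10 n1 LL L_pos by (intro frac_le mult_mono power_mono) (auto simp: n_def)
      then show ?thesis by simp
    qed
    \<comment> \<open>One factor \<open>1 / s^2\<close> of the score is paired with one inverse of
      the posterior curvature and bounded by \<open>\<Theta>\<close>; the remaining inverse square
      root is compared with that of the prior curvature.\<close>
    have "\<bar>k2\<bar> * (111 * post.c1\<^sup>2 * sqrt d / (?L * sqrt ?L)) \<le> G / s\<^sup>2 * (111 * post.c1\<^sup>2 * sqrt d / (?L * sqrt ?L))"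
      using k2 LL c10 by (intro mult_right_mono) auto
    also have "\<dots> = G * (1 / s\<^sup>2 / ?L) * (111 * post.c1\<^sup>2 * sqrt d / sqrt ?L)" by simp
    also have "\<dots> \<le> G * \<Theta> * (111 * \<kappa>\<^sup>2 / sqrt L * n)"
      using \<Theta>' G0 sq c10 LL \<Theta>0 by (intro mult_mono mult_left_mono) auto
    finally have t1: "\<bar>k2\<bar> * (111 * post.c1\<^sup>2 * sqrt d / (?L * sqrt ?L)) \<le> G * \<Theta> * (111 * \<kappa>\<^sup>2 / sqrt L * n)" .
    have "8 * post.c1 / ?L * Rd_norm d w \<le> 8 * post.c1 / ?L * (2 * G / s\<^sup>2 * (Rd_norm d x + Rd_norm d post.mean))"
      using w LL c10 by (intro mult_left_mono) auto
    also have "\<dots> = G * (1 / s\<^sup>2 / ?L) * (16 * post.c1 * (Rd_norm d x + Rd_norm d post.mean))"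
      by (simp add: mult_ac)
    also have "\<dots> \<le> G * \<Theta> * (16 * \<kappa> * ((1 + mean_const L K B \<Theta>) * n))"
      using \<Theta>' G0 c1 n2 c10 LL \<Theta>0 by (intro mult_mono mult_left_mono) auto
    finally have t2: "8 * post.c1 / ?L * Rd_norm d w \<le> G * \<Theta> * (16 * \<kappa> * ((1 + mean_const L K B \<Theta>) * n))" .
    show ?thesis unfolding T_def distrib_left using t1 t2 by (rule add_mono)
  qed
  also have "\<dots> = deriv_const L K B \<Theta> * G * n"
    by (simp add: deriv_const_def \<kappa>_def algebra_simps)
  finally show ?thesis by (simp add: G_def n_def)
qed

lemma mean_const_nonneg: "0 \<le> B \<Longrightarrow> 0 \<le> \<Theta> \<Longrightarrow> 0 \<le> mean_const L K B \<Theta>"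
  using L_pos K_nonneg by (simp add: mean_const_def)

lemma deriv_const_nonneg: "0 \<le> B \<Longrightarrow> 0 \<le> \<Theta> \<Longrightarrow> 0 \<le> deriv_const L K B \<Theta>"
  using L_pos mean_const_nonneg[of B \<Theta>] by (simp add: deriv_const_def conc_const_def)

text \<open>Product rule for the velocity formula. The second derivatives already have order
  \<open>1 / (1 - t)^2\<close>; in the last term the coefficient and the derivative of the posterior
  mean each contribute one order, which explains \<open>(F + G1)^2\<close> in front of
  \<open>deriv_const\<close>.\<close>

lemma velocity_derivative_bound:
  fixes f \<sigma> f' \<sigma>' :: "real \<Rightarrow> real" and v :: "real \<Rightarrow> vec \<Rightarrow> vec"
  assumes d: "1 \<le> d" and t: "0 < t" "t < 1"
    and c: "c \<in> Rd d" and cB: "Rd_norm d c \<le> B * sqrt d" and B0: "0 \<le> B"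
    and dom: "\<And>y. y \<in> Rd d \<Longrightarrow> P y \<le> exp (1 + K + K * rdist d y c) * P c"
    and f: "\<And>s. 0 < s \<Longrightarrow> s < 1 \<Longrightarrow> (f has_real_derivative f' s) (at s)" "continuous_on {0<..<1} f'"
    and \<sigma>: "\<And>s. 0 < s \<Longrightarrow> s < 1 \<Longrightarrow> (\<sigma> has_real_derivative \<sigma>' s) (at s)" "continuous_on {0<..<1} \<sigma>'"
    and \<sigma>pos: "\<And>s. 0 < s \<Longrightarrow> s < 1 \<Longrightarrow> 0 < \<sigma> s" and f1: "\<And>s. 0 < s \<Longrightarrow> s < 1 \<Longrightarrow> \<bar>f s\<bar> \<le> 1"
    and \<Theta>: "1 / (\<sigma> t)\<^sup>2 \<le> \<Theta> * (L + (f t)\<^sup>2 / (\<sigma> t)\<^sup>2)" and \<Theta>0: "0 \<le> \<Theta>"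
    and v: "\<And>s i. 0 < s \<Longrightarrow> s < 1 \<Longrightarrow> i < d \<Longrightarrow>
      v s x i = \<sigma>' s / \<sigma> s * x i + (f' s - f s * (\<sigma>' s / \<sigma> s)) * postmean (f s) (\<sigma> s) x i"
    and f2: "(f' has_real_derivative f2) (at t)"
    and g2: "((\<lambda>s. \<sigma>' s / \<sigma> s) has_real_derivative g2) (at t)"
    and bf: "\<bar>f' t\<bar> \<le> F / (1 - t)" "\<bar>f2\<bar> \<le> F / (1 - t)\<^sup>2"
    and bg: "\<bar>\<sigma>' t / \<sigma> t\<bar> \<le> G1 / (1 - t)" "\<bar>g2\<bar> \<le> G2 / (1 - t)\<^sup>2"
  shows "\<exists>D. (\<forall>i<d. ((\<lambda>s. v s x i) has_real_derivative D i) (at t)) \<and>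
    Rd_norm d D \<le> (G2 + (F + F * G1 + G2) * mean_const L K B \<Theta> + (F + G1)\<^sup>2 * deriv_const L K B \<Theta>)
      / (1 - t)\<^sup>2 * (sqrt d + Rd_norm d x)"
proof -
  define u where "u = 1 - t"
  have u: "0 < u" using t by (simp add: u_def)
  define n where "n = sqrt d + Rd_norm d x"
  define g where "g = \<sigma>' t / \<sigma> t"
  define m where "m = postmean (f t) (\<sigma> t) x"
  define Dm where "Dm i = (\<integral>y. (y i - wlc_density.mean d (Q (f t) (\<sigma> t) x) i) * score d (f t) (f' t) (\<sigma> t) (\<sigma>' t) x y
      \<partial>wlc_density.\<nu> d (Q (f t) (\<sigma> t) x))" for i
  define D where "D i = g2 * x i + ((f2 - (f' t * g + f t * g2)) * m i + (f' t - f t * g) * Dm i)" for i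
  have dm: "((\<lambda>s. postmean (f s) (\<sigma> s) x i) has_real_derivative Dm i) (at t)" if "i < d" for i
    unfolding Dm_def by (rule postmean_derivative[OF t f \<sigma> \<sigma>pos f1 that])
  have der: "((\<lambda>s. v s x i) has_real_derivative D i) (at t)" if i: "i < d" for i
  proof -
    have "((\<lambda>s. \<sigma>' s / \<sigma> s * x i + (f' s - f s * (\<sigma>' s / \<sigma> s)) * postmean (f s) (\<sigma> s) x i) has_real_derivative
        g2 * x i + ((f2 - (f' t * (\<sigma>' t / \<sigma> t) + g2 * f t)) * postmean (f t) (\<sigma> t) x i
          + Dm i * (f' t - f t * (\<sigma>' t / \<sigma> t)))) (at t)"
      by (intro DERIV_add DERIV_cmult_right DERIV_mult DERIV_diff dm i f(1) t f2 g2)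
    then have "((\<lambda>s. \<sigma>' s / \<sigma> s * x i + (f' s - f s * (\<sigma>' s / \<sigma> s)) * postmean (f s) (\<sigma> s) x i) has_real_derivative D i) (at t)"
      by (simp add: D_def g_def m_def mult.commute)
    then show ?thesis
      by (rule has_field_derivative_transform_within_open[of _ _ _ "{0<..<1}"]) (use t v i in auto)
  qed
  have mb: "Rd_norm d m \<le> mean_const L K B \<Theta> * n"
    unfolding m_def n_def by (rule postmean_bound[OF d \<sigma>pos[OF t] f1[OF t] c cB dom \<Theta>])
  have Dmb: "Rd_norm d Dm \<le> deriv_const L K B \<Theta> * (\<bar>g\<bar> + \<bar>f' t\<bar>) * n"
    unfolding Dm_def n_def g_def by (rule postmean_derivative_bound[OF d \<sigma>pos[OF t] f1[OF t] c cB dom \<Theta>])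
  define mc where "mc = mean_const L K B \<Theta>"
  define dc where "dc = deriv_const L K B \<Theta>"
  have nn: "0 \<le> mc" "0 \<le> dc" "0 \<le> n"
    unfolding mc_def dc_def n_def using mean_const_nonneg[OF B0 \<Theta>0] deriv_const_nonneg[OF B0 \<Theta>0] by auto
  have F0: "0 \<le> F / u" "0 \<le> G1 / u" "0 \<le> F / u\<^sup>2" "0 \<le> G2 / u\<^sup>2"
    using bf bg unfolding u_def by linarith+
  have a1: "\<bar>f2 - (f' t * g + f t * g2)\<bar> \<le> (F + F * G1 + G2) / u\<^sup>2"
  proof -
    have "\<bar>f2 - (f' t * g + f t * g2)\<bar> \<le> \<bar>f2\<bar> + (\<bar>f' t\<bar> * \<bar>g\<bar> + \<bar>f t\<bar> * \<bar>g2\<bar>)"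
      unfolding abs_mult[symmetric] by linarith
    also have "\<dots> \<le> F / u\<^sup>2 + (F / u * (G1 / u) + 1 * (G2 / u\<^sup>2))"
      using bf bg f1[OF t] F0 unfolding u_def g_def by (intro add_mono mult_mono) auto
    also have "\<dots> = (F + F * G1 + G2) / u\<^sup>2" by (simp add: add_divide_distrib power2_eq_square)
    finally show ?thesis .
  qed
  have a2: "\<bar>f' t - f t * g\<bar> \<le> (F + G1) / u"
  proof -
    have "\<bar>f' t - f t * g\<bar> \<le> \<bar>f' t\<bar> + \<bar>f t\<bar> * \<bar>g\<bar>"
      unfolding abs_mult[symmetric] by linarith
    also have "\<dots> \<le> F / u + 1 * (G1 / u)"
      using bf bg f1[OF t] F0 unfolding u_def g_def by (intro add_mono mult_mono) auto
    finally show ?thesis by (simp add: add_divide_distrib)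
  qed
  have a3: "Rd_norm d Dm \<le> dc * ((F + G1) / u) * n"
  proof -
    have "\<bar>g\<bar> + \<bar>f' t\<bar> \<le> (F + G1) / u"
      using bf(1) bg(1) unfolding u_def g_def by (simp add: add_divide_distrib)
    then have "dc * (\<bar>g\<bar> + \<bar>f' t\<bar>) * n \<le> dc * ((F + G1) / u) * n"
      using nn by (intro mult_right_mono mult_left_mono) auto
    then show ?thesis using Dmb by (simp add: dc_def)
  qed
  have "Rd_norm d D \<le> Rd_norm d (\<lambda>i. g2 * x i) + (Rd_norm d (\<lambda>i. (f2 - (f' t * g + f t * g2)) * m i) + Rd_norm d (\<lambda>i. (f' t - f t * g) * Dm i))"
    unfolding D_def[abs_def] by (rule order_trans[OF Rd_norm_add add_left_mono[OF Rd_norm_add]])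
  also have "\<dots> = \<bar>g2\<bar> * Rd_norm d x + (\<bar>f2 - (f' t * g + f t * g2)\<bar> * Rd_norm d m + \<bar>f' t - f t * g\<bar> * Rd_norm d Dm)"
    by (simp only: Rd_norm_scale)
  also have "\<dots> \<le> G2 / u\<^sup>2 * n + ((F + F * G1 + G2) / u\<^sup>2 * (mc * n) + (F + G1) / u * (dc * ((F + G1) / u) * n))"
  proof (intro add_mono mult_mono a1 a2 a3)
    show "\<bar>g2\<bar> \<le> G2 / u\<^sup>2" using bg by (simp add: u_def)
    show "Rd_norm d m \<le> mc * n" using mb by (simp add: mc_def)
    show "0 \<le> (F + F * G1 + G2) / u\<^sup>2" using a1 by linarith
    show "0 \<le> (F + G1) / u" using a2 by linarith
  qed (use F0 nn in \<open>auto simp: n_def\<close>)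
  also have "\<dots> = (G2 + (F + F * G1 + G2) * mc + (F + G1)\<^sup>2 * dc) / u\<^sup>2 * n"
    using u by (simp add: power2_eq_square field_simps)
  finally show ?thesis using der by (auto simp: u_def n_def mc_def dc_def intro!: exI[of _ D])
qed

end

section \<open>The schedule and the final estimate\<close>

text \<open>Over a null set the essential supremum would be minus infinity. Nonnegativity is what
  allows a bound on a sum of such norms to be used for each summand.\<close>

lemma Linf_norm_nonneg:
  assumes "a < b"
  shows "0 \<le> Linf_norm {a..<b} g"
proof (rule ccontr)
  assume neg: "\<not> 0 \<le> Linf_norm {a..<b} g"
  have "AE t in lebesgue_on {a..<b}. ereal \<bar>g t\<bar> \<le> Linf_norm {a..<b} g"
    unfolding Linf_norm_def by (rule esssup_AE)
  then have "AE t in lebesgue_on {a..<b}. False"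
  proof eventually_elim
    fix t assume "ereal \<bar>g t\<bar> \<le> Linf_norm {a..<b} g"
    moreover have "0 \<le> ereal \<bar>g t\<bar>" by simp
    ultimately have "0 \<le> Linf_norm {a..<b} g" by (rule order_trans[rotated])
    then show False using neg by simp
  qed
  then have "emeasure (lebesgue_on {a..<b}) (space (lebesgue_on {a..<b})) = 0"
    using emeasure_eq_0_AE[of "\<lambda>_. True" "lebesgue_on {a..<b}"] by (simp only: simp_thms Collect_mem_eq)
  then show False using assms by (simp add: emeasure_restrict_space)
qed

lemma Linf_norm_AE:
  assumes "Linf_norm {a..<b} g \<le> ereal A"
  shows "AE t in lborel. t \<in> {a..<b} \<longrightarrow> \<bar>g t\<bar> \<le> A"
proof -
  have "AE t in lebesgue_on {a..<b}. ereal \<bar>g t\<bar> \<le> Linf_norm {a..<b} g"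
    unfolding Linf_norm_def by (rule esssup_AE)
  then have "AE t in lebesgue_on {a..<b}. \<bar>g t\<bar> \<le> A"
  proof eventually_elim
    fix t assume "ereal \<bar>g t\<bar> \<le> Linf_norm {a..<b} g"
    then have "ereal \<bar>g t\<bar> \<le> ereal A" using assms by (rule order_trans)
    then show "\<bar>g t\<bar> \<le> A" by simp
  qed
  then have "AE t in lebesgue. t \<in> {a..<b} \<longrightarrow> \<bar>g t\<bar> \<le> A"
    by (subst (asm) AE_restrict_space_iff) auto
  then show ?thesis by (simp add: AE_completion_iff)
qed

lemma one_sided_to_at:
  fixes g :: "real \<Rightarrow> real"
  assumes "(g has_real_derivative D) (at s within {a..<b})" "a < s" "s < b"
  shows "(g has_real_derivative D) (at s)"
proof -
  have "(g has_real_derivative D) (at s within {a<..<b})" by (rule DERIV_subset[OF assms(1)]) auto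
  then show ?thesis using assms by (simp add: at_within_open[of s "{a<..<b}"])
qed

lemma log_quotient:
  "(- p * (w / q) * l + l' * w) / (w * l) = - p / q + l' / l"
  if "w \<noteq> 0" "q \<noteq> 0" "l \<noteq> 0" for p w q l l' :: real
  using that by (simp add: field_simps)

text \<open>Passing to the logarithmic derivative cancels the power itself, so for every exponent
  \<open>p\<close> the only singular terms are \<open>p / (1 - t)\<close> and, after one more
  derivative, \<open>p / (1 - t)^2\<close>.\<close>

lemma log_derivative_of_power_schedule:
  fixes \<sigma> l l' l'' :: "real \<Rightarrow> real"
  assumes l: "C2_on_with {t0..<1} l l' l''" and eq: "\<And>s. s \<in> {t0..<1} \<Longrightarrow> \<sigma> s = (1 - s) powr p * l s"
    and lpos: "\<And>s. s \<in> {t0..<1} \<Longrightarrow> 0 < l s" and t: "t0 < t" "t < 1"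
  shows "deriv \<sigma> t / \<sigma> t = - p / (1 - t) + l' t / l t"
    "((\<lambda>s. deriv \<sigma> s / \<sigma> s) has_real_derivative - p / (1 - t)\<^sup>2 + (l'' t / l t - (l' t / l t)\<^sup>2)) (at t)"
proof -
  have dl: "(l has_real_derivative l' s) (at s)" "(l' has_real_derivative l'' s) (at s)" if "t0 < s" "s < 1" for s
    using l that unfolding C2_on_with_def by (auto intro: one_sided_to_at)
  have log: "deriv \<sigma> s / \<sigma> s = - p / (1 - s) + l' s / l s" if s: "t0 < s" "s < 1" for s
  proof -
    have ls: "0 < l s" using lpos[of s] s by simp
    have "((\<lambda>s. (1 - s) powr p) has_real_derivative p * (1 - s) powr (p - 1) * (- 1)) (at s)"
      by (rule DERIV_chain'[where g="\<lambda>z. z powr p" and f="\<lambda>s. 1 - s", OF _ has_real_derivative_powr, THEN DERIV_cong])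
         (use s in \<open>auto intro!: derivative_eq_intros\<close>)
    from DERIV_mult[OF this dl(1)[OF s]]
    have "((\<lambda>s. (1 - s) powr p * l s) has_real_derivative
        p * (1 - s) powr (p - 1) * (- 1) * l s + l' s * (1 - s) powr p) (at s)" .
    then have "(\<sigma> has_real_derivative p * (1 - s) powr (p - 1) * (- 1) * l s + l' s * (1 - s) powr p) (at s)"
      by (rule has_field_derivative_transform_within_open[of _ _ _ "{t0<..<1}"]) (use s eq in auto)
    then have "deriv \<sigma> s = - p * (1 - s) powr (p - 1) * l s + l' s * (1 - s) powr p"
      by (auto dest!: DERIV_imp_deriv)
    moreover have "(1 - s) powr (p - 1) = (1 - s) powr p / (1 - s)"
      using s by (simp add: powr_diff)
    moreover have "\<sigma> s = (1 - s) powr p * l s" using eq s by simp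
    ultimately have "deriv \<sigma> s / \<sigma> s = (- p * ((1 - s) powr p / (1 - s)) * l s + l' s * (1 - s) powr p) / ((1 - s) powr p * l s)"
      by simp
    also have "\<dots> = - p / (1 - s) + l' s / l s"
      by (rule log_quotient) (use s ls in auto)
    finally show ?thesis .
  qed
  show "deriv \<sigma> t / \<sigma> t = - p / (1 - t) + l' t / l t" by (rule log[OF t])
  have lt: "l t \<noteq> 0" using lpos[of t] t by simp
  have "((\<lambda>s. - p / (1 - s) + l' s / l s) has_real_derivative
      - p / (1 - t)\<^sup>2 + (l'' t / l t - (l' t / l t)\<^sup>2)) (at t)"
    using t lt dl[OF t] by (auto intro!: derivative_eq_intros simp: field_simps power2_eq_square)
  then show "((\<lambda>s. deriv \<sigma> s / \<sigma> s) has_real_derivative - p / (1 - t)\<^sup>2 + (l'' t / l t - (l' t / l t)\<^sup>2)) (at t)"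
    by (rule has_field_derivative_transform_within_open[of _ _ _ "{t0<..<1}"]) (use t log in auto)
qed

lemma le_divide_le_one: "a \<le> a / u" "a \<le> a / u\<^sup>2" "a / u \<le> a / u\<^sup>2" if "0 \<le> a" "0 < u" "u \<le> 1" for a u :: real
proof -
  have u2: "u\<^sup>2 \<le> u" using that by (simp add: power2_eq_square mult_left_le)
  have "a / 1 \<le> a / u" "a / u \<le> a / u\<^sup>2"
    by (rule divide_left_mono; use that u2 in simp)+
  then show "a \<le> a / u" "a \<le> a / u\<^sup>2" "a / u \<le> a / u\<^sup>2" by auto
qed

text \<open>The null set consists of times where a second derivative or one of the almost everywhere
  bounds fails; it does not depend on \<open>x\<close>. In \<open>\<Theta>\<close> one summand
  serves each side of \<open>t0\<close>. In \<open>G2\<close>, \<open>A^2\<close> bounds the second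
  derivative over the function and \<open>A^4\<close> the squared logarithmic derivative, of
  \<open>\<sigma>\<close> before \<open>t0\<close> and of \<open>l\<close> after it.\<close>

lemma velocity_time_derivative_ae:
  fixes \<alpha> \<beta> K A p ft0 t0 :: real and f \<sigma> :: "real \<Rightarrow> real" and M :: "'w measure"
  assumes pos: "0 < \<alpha>" "0 < K" "0 < \<beta>" "\<beta> \<le> 1" "0 < p" "1 \<le> A" and d: "1 \<le> d"
    and wlc: "weakly_log_concave_decomp d \<alpha> \<beta> K pstar u a" and arg: "is_arg_min u (\<lambda>x. x \<in> Rd d) m"
    and f01: "C1_ae f" and fmono: "strict_mono_on {0..1} f" and f0: "f 0 = 0"
    and M: "prob_space M" and Y: "distributed M (Rd_lborel d) Y (\<lambda>x. ennreal (pstar x))"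
    and \<xi>: "\<xi> \<in> measurable M (Rd_lborel d)" "distr M (Rd_lborel d) \<xi> = std_gaussian d"
    and ind: "prob_space.indep_var M (Rd_lborel d) Y (Rd_lborel d) \<xi>"
    and vel: "velocity_field d M Y \<xi> f \<sigma> v"
    and t0: "0 < t0" "t0 < 1" "f t0 = ft0" and C2: "C2_ae f" "C2_ae \<sigma>"
    and \<sigma>pos: "\<forall>t\<in>{0<..<1}. 0 < \<sigma> t"
    and l: "C2_on_with {t0..<1} l l' l''"
    and \<sigma>l: "\<forall>t\<in>{t0..<1}. \<sigma> t = (1 - t) powr p * l t \<and> 1 / A \<le> l t \<and> l t \<le> A"
    and Ll: "Linf_norm {t0..<1} l' + Linf_norm {t0..<1} l'' \<le> ereal A"
    and Lf: "Linf_norm {t0..<1} (deriv f) + Linf_norm {t0..<1} (deriv (deriv f))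
      + ereal (Rd_norm d m / sqrt (real d)) \<le> ereal A"
    and early: "AE t in lborel. t \<in> {0<..t0} \<longrightarrow>
       1 / \<sigma> t + \<bar>deriv \<sigma> t\<bar> + \<bar>deriv (deriv \<sigma>) t\<bar> + \<bar>deriv f t\<bar> + \<bar>deriv (deriv f) t\<bar> \<le> A"
  defines "G1 \<equiv> p + A\<^sup>2" and "G2 \<equiv> p + A\<^sup>2 + A ^ 4" and "\<Theta> \<equiv> A\<^sup>2 / \<alpha> + 1 / ft0\<^sup>2"
  shows "AE t in lborel. t \<in> {0<..<1} \<longrightarrow> (\<forall>x\<in>Rd d. \<exists>D.
     (\<forall>i<d. ((\<lambda>s. v s x i) has_real_derivative D i) (at t)) \<and>
     Rd_norm d D \<le> (G2 + (A + A * G1 + G2) * mean_const \<alpha> K (A + 1) \<Theta> + (A + G1)\<^sup>2 * deriv_const \<alpha> K (A + 1) \<Theta>)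
       / (1 - t)\<^sup>2 * (sqrt (real d) + Rd_norm d x))"
proof -
  obtain P c where W: "wlc_density d \<alpha> K P" and AEP: "AE y in Rd_lborel d. pstar y = P y"
    and c: "c \<in> Rd d" and cm: "Rd_norm d c \<le> Rd_norm d m + 1"
    and dom: "\<And>y. y \<in> Rd d \<Longrightarrow> P y \<le> exp (1 + K + K * rdist d y c) * P c"
    using weakly_log_concave_reduction[OF wlc arg pos(1-4)] by blast
  interpret W: wlc_density d \<alpha> K P by (rule W)
  have Ym: "Y \<in> measurable M (Rd_lborel d)" using Y by (rule distributed_measurable)
  have pm: "pstar \<in> borel_measurable (Rd_lborel d)" using wlc by (simp add: weakly_log_concave_decomp_def)
  have "distr M (Rd_lborel d) Y = density (Rd_lborel d) (\<lambda>x. ennreal (pstar x))"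
    using Y by (rule distributed_distr_eq_density)
  also have "\<dots> = W.\<nu>" unfolding W.\<nu>_def by (rule density_cong) (use pm AEP in auto)
  finally have dY: "distr M (Rd_lborel d) Y = W.\<nu>" .
  have L0: "0 \<le> Linf_norm {t0..<1} g" for g by (rule Linf_norm_nonneg[OF t0(2)])
  have "Linf_norm {t0..<1} l' \<le> Linf_norm {t0..<1} l' + Linf_norm {t0..<1} l''"
    "Linf_norm {t0..<1} l'' \<le> Linf_norm {t0..<1} l' + Linf_norm {t0..<1} l''"
    using add_left_mono[OF L0[of l''], of "Linf_norm {t0..<1} l'"] add_right_mono[OF L0[of l'], of "Linf_norm {t0..<1} l''"] by simp_all
  then have Al: "AE t in lborel. t \<in> {t0..<1} \<longrightarrow> \<bar>l' t\<bar> \<le> A" "AE t in lborel. t \<in> {t0..<1} \<longrightarrow> \<bar>l'' t\<bar> \<le> A"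
    using Linf_norm_AE[OF order_trans[OF _ Ll]] by blast+
  define R where "R = ereal (Rd_norm d m / sqrt (real d))"
  define F1 where "F1 = Linf_norm {t0..<1} (deriv f)"
  define F2 where "F2 = Linf_norm {t0..<1} (deriv (deriv f))"
  have R0: "0 \<le> R" "0 \<le> F1" "0 \<le> F2" using d L0 by (auto simp: R_def F1_def F2_def)
  have sumF: "F1 + F2 + R \<le> ereal A" using Lf by (simp add: R_def F1_def F2_def)
  have "F1 \<le> F1 + F2 + R" "F2 \<le> F1 + F2 + R" "R \<le> F1 + F2 + R"
    using R0 by (auto intro: add_increasing add_increasing2)
  then have le: "F1 \<le> ereal A" "F2 \<le> ereal A" "R \<le> ereal A" using sumF by (auto elim: order_trans)
  have Af: "AE t in lborel. t \<in> {t0..<1} \<longrightarrow> \<bar>deriv f t\<bar> \<le> A" "AE t in lborel. t \<in> {t0..<1} \<longrightarrow> \<bar>deriv (deriv f) t\<bar> \<le> A"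
    using Linf_norm_AE[OF le(1)[unfolded F1_def]] Linf_norm_AE[OF le(2)[unfolded F2_def]] by blast+
  have sd: "1 \<le> sqrt d" using d by simp
  have "Rd_norm d m \<le> A * sqrt d" using le(3) sd by (simp add: R_def divide_le_eq)
  \<comment> \<open>The unit displacement between the minimizer and the near-maximizer is absorbed
    by \<open>sqrt d\<close>, as \<open>d\<close> is at least 1.\<close>
  then have cB: "Rd_norm d c \<le> (A + 1) * sqrt d" unfolding distrib_right using cm sd by linarith
  have df: "(f has_real_derivative deriv f s) (at s)" "(\<sigma> has_real_derivative deriv \<sigma> s) (at s)" if "0 < s" "s < 1" for s
    using C2 that unfolding C2_ae_def by (auto simp: DERIV_deriv_iff_real_differentiable)
  have cf: "continuous_on {0<..<1} (deriv f)" "continuous_on {0<..<1} (deriv \<sigma>)"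
    using C2 unfolding C2_ae_def by auto
  have f1: "\<bar>f s\<bar> \<le> 1" if "0 < s" "s < 1" for s
  proof -
    have "f s \<in> f ` {0..1}" using that by auto
    then have "f s \<in> {0..1}" using f01 unfolding C1_ae_def by blast
    then show ?thesis by auto
  qed
  have sp: "0 < \<sigma> s" if "0 < s" "s < 1" for s using \<sigma>pos that by auto
  have vf: "v s x i = deriv \<sigma> s / \<sigma> s * x i + (deriv f s - f s * (deriv \<sigma> s / \<sigma> s)) * W.postmean (f s) (\<sigma> s) x i"
    if "0 < s" "s < 1" "i < d" "x \<in> Rd d" for s x i
    unfolding W.postmean_def
  proof (rule W.velocity_formula[OF M sp[OF that(1,2)] Ym dY \<xi> ind _ that(4,3)])
    show "cond_exp_given d M (\<lambda>\<omega>. lincomb d (deriv f s) (Y \<omega>) (deriv \<sigma> s) (\<xi> \<omega>))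
        (\<lambda>\<omega>. lincomb d (f s) (Y \<omega>) (\<sigma> s) (\<xi> \<omega>)) (v s)"
      using vel that unfolding velocity_field_def by auto
  qed
  have ft0: "0 < ft0" using strict_mono_onD[OF fmono, of 0 t0] t0 f0 by auto
  have \<Theta>0: "0 \<le> \<Theta>" using pos by (simp add: \<Theta>_def)
  have A0: "0 \<le> A" using pos by simp
  obtain Nf where Nf: "Nf \<in> null_sets lborel" "\<And>t. t \<in> {0<..<1} - Nf \<Longrightarrow> deriv f differentiable at t"
    using C2(1) unfolding C2_ae_def by blast
  obtain Ns where Ns: "Ns \<in> null_sets lborel" "\<And>t. t \<in> {0<..<1} - Ns \<Longrightarrow> deriv \<sigma> differentiable at t"
    using C2(2) unfolding C2_ae_def by blast
  show ?thesis
    using AE_not_in[OF Nf(1)] AE_not_in[OF Ns(1)] Al Af early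
  proof eventually_elim
    fix t assume tN: "t \<notin> Nf" "t \<notin> Ns"
      and tl: "t \<in> {t0..<1} \<longrightarrow> \<bar>l' t\<bar> \<le> A" "t \<in> {t0..<1} \<longrightarrow> \<bar>l'' t\<bar> \<le> A"
      and tf: "t \<in> {t0..<1} \<longrightarrow> \<bar>deriv f t\<bar> \<le> A" "t \<in> {t0..<1} \<longrightarrow> \<bar>deriv (deriv f) t\<bar> \<le> A"
      and te: "t \<in> {0<..t0} \<longrightarrow> 1 / \<sigma> t + \<bar>deriv \<sigma> t\<bar> + \<bar>deriv (deriv \<sigma>) t\<bar> + \<bar>deriv f t\<bar> + \<bar>deriv (deriv f) t\<bar> \<le> A"
    show "t \<in> {0<..<1} \<longrightarrow> (\<forall>x\<in>Rd d. \<exists>D.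
       (\<forall>i<d. ((\<lambda>s. v s x i) has_real_derivative D i) (at t)) \<and>
       Rd_norm d D \<le> (G2 + (A + A * G1 + G2) * mean_const \<alpha> K (A + 1) \<Theta> + (A + G1)\<^sup>2 * deriv_const \<alpha> K (A + 1) \<Theta>)
         / (1 - t)\<^sup>2 * (sqrt (real d) + Rd_norm d x))"
    proof (intro impI ballI)
      assume "t \<in> {0<..<1}"
      then have t: "0 < t" "t < 1" by auto
      fix x assume x: "x \<in> Rd d"
      have u: "0 < 1 - t" "1 - t \<le> 1" using t by auto
      have st: "0 < \<sigma> t" by (rule sp[OF t])
      have f2: "(deriv f has_real_derivative deriv (deriv f) t) (at t)"
        using Nf(2)[of t] tN t by (simp add: DERIV_deriv_iff_real_differentiable)
      have s2: "(deriv \<sigma> has_real_derivative deriv (deriv \<sigma>) t) (at t)"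
        using Ns(2)[of t] tN t by (simp add: DERIV_deriv_iff_real_differentiable)
      have "\<bar>deriv f t\<bar> \<le> A \<and> \<bar>deriv (deriv f) t\<bar> \<le> A \<and> 1 / (\<sigma> t)\<^sup>2 \<le> \<Theta> * (\<alpha> + (f t)\<^sup>2 / (\<sigma> t)\<^sup>2) \<and>
        \<bar>deriv \<sigma> t / \<sigma> t\<bar> \<le> G1 / (1 - t) \<and>
        (\<exists>g2. ((\<lambda>s. deriv \<sigma> s / \<sigma> s) has_real_derivative g2) (at t) \<and> \<bar>g2\<bar> \<le> G2 / (1 - t)\<^sup>2)"
      proof (cases "t \<le> t0")
        case True
        have e: "1 / \<sigma> t + \<bar>deriv \<sigma> t\<bar> + \<bar>deriv (deriv \<sigma>) t\<bar> + \<bar>deriv f t\<bar> + \<bar>deriv (deriv f) t\<bar> \<le> A"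
          using te True t by simp
        have is0: "0 < 1 / \<sigma> t" using st by simp
        have b: "1 / \<sigma> t \<le> A" "\<bar>deriv \<sigma> t\<bar> \<le> A" "\<bar>deriv (deriv \<sigma>) t\<bar> \<le> A" "\<bar>deriv f t\<bar> \<le> A" "\<bar>deriv (deriv f) t\<bar> \<le> A"
          using e is0 by linarith+
        have q: "\<bar>z / \<sigma> t\<bar> \<le> A\<^sup>2" if "\<bar>z\<bar> \<le> A" for z
        proof -
          have "\<bar>z / \<sigma> t\<bar> = \<bar>z\<bar> * (1 / \<sigma> t)" using st by simp
          also have "\<dots> \<le> A * A" using that b(1) is0 by (intro mult_mono) auto
          finally show ?thesis by (simp add: power2_eq_square)
        qed
        have "1 / (\<sigma> t)\<^sup>2 \<le> A\<^sup>2" using power_mono[OF b(1), of 2] is0 by (simp add: power_one_over)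
        also have "\<dots> = A\<^sup>2 / \<alpha> * \<alpha>" using pos by simp
        also have "\<dots> \<le> \<Theta> * (\<alpha> + (f t)\<^sup>2 / (\<sigma> t)\<^sup>2)"
          using pos by (intro mult_mono) (auto simp: \<Theta>_def)
        finally have th: "1 / (\<sigma> t)\<^sup>2 \<le> \<Theta> * (\<alpha> + (f t)\<^sup>2 / (\<sigma> t)\<^sup>2)" .
        have "\<bar>deriv \<sigma> t / \<sigma> t\<bar> \<le> G1" using q[OF b(2)] pos by (simp add: G1_def)
        also have "\<dots> \<le> G1 / (1 - t)" by (rule le_divide_le_one) (use u pos in \<open>auto simp: G1_def\<close>)
        finally have g: "\<bar>deriv \<sigma> t / \<sigma> t\<bar> \<le> G1 / (1 - t)" .
        define g2 where "g2 = deriv (deriv \<sigma>) t / \<sigma> t - (deriv \<sigma> t / \<sigma> t)\<^sup>2"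
        have dg: "((\<lambda>s. deriv \<sigma> s / \<sigma> s) has_real_derivative g2) (at t)"
        proof (rule DERIV_cong[OF DERIV_divide[OF s2 df(2)[OF t]]])
          show "\<sigma> t \<noteq> 0" using st by simp
          show "(deriv (deriv \<sigma>) t * \<sigma> t - deriv \<sigma> t * deriv \<sigma> t) / (\<sigma> t * \<sigma> t) = g2"
            using st by (simp add: g2_def field_simps power2_eq_square)
        qed
        have "\<bar>g2\<bar> \<le> \<bar>deriv (deriv \<sigma>) t / \<sigma> t\<bar> + \<bar>deriv \<sigma> t / \<sigma> t\<bar>\<^sup>2"
          unfolding g2_def power_abs[symmetric] by (rule abs_triangle_ineq4)
        also have "\<dots> \<le> A\<^sup>2 + (A\<^sup>2)\<^sup>2" by (intro add_mono power_mono q b) auto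
        also have "\<dots> \<le> G2" using pos by (simp add: G2_def)
        also have "\<dots> \<le> G2 / (1 - t)\<^sup>2" by (rule le_divide_le_one) (use u pos in \<open>auto simp: G2_def\<close>)
        finally show ?thesis using b th g dg by blast
      next
        case False
        then have t': "t0 < t" "t \<in> {t0..<1}" using t by auto
        have lt: "1 / A \<le> l t" "0 < l t" using \<sigma>l t' pos by (auto intro: less_le_trans[of 0 "1 / A"])
        have lp: "0 < l s" if "s \<in> {t0..<1}" for s
        proof -
          have "0 < 1 / A" using pos by simp
          also have "1 / A \<le> l s" using \<sigma>l that by auto
          finally show ?thesis .
        qed
        have il: "1 / l t \<le> A" using lt pos by (simp add: divide_le_eq mult.commute)
        have q: "\<bar>z / l t\<bar> \<le> A\<^sup>2" if "\<bar>z\<bar> \<le> A" for z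
        proof -
          have "\<bar>z / l t\<bar> = \<bar>z\<bar> * (1 / l t)" using lt by simp
          also have "\<dots> \<le> A * A" using that il lt by (intro mult_mono) auto
          finally show ?thesis by (simp add: power2_eq_square)
        qed
        have eqs: "\<sigma> s = (1 - s) powr p * l s" if "s \<in> {t0..<1}" for s using \<sigma>l that by auto
        note ld = log_derivative_of_power_schedule[OF l eqs lp t'(1) t(2)]
        have l1: "\<bar>l' t / l t\<bar> \<le> A\<^sup>2" "\<bar>l'' t / l t\<bar> \<le> A\<^sup>2" using q tl t' by auto
        have "deriv \<sigma> t / \<sigma> t = - p / (1 - t) + l' t / l t" by (rule ld(1))
        moreover have "\<bar>- p / (1 - t)\<bar> = p / (1 - t)" using pos u by simp
        ultimately have "\<bar>deriv \<sigma> t / \<sigma> t\<bar> \<le> p / (1 - t) + A\<^sup>2"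
          using l1(1) abs_triangle_ineq[of "- p / (1 - t)" "l' t / l t"] by linarith
        also have "\<dots> \<le> p / (1 - t) + A\<^sup>2 / (1 - t)" using le_divide_le_one(1)[of "A\<^sup>2" "1 - t"] u by simp
        finally have g: "\<bar>deriv \<sigma> t / \<sigma> t\<bar> \<le> G1 / (1 - t)" by (simp add: G1_def add_divide_distrib)
        define g2 where "g2 = - p / (1 - t)\<^sup>2 + (l'' t / l t - (l' t / l t)\<^sup>2)"
        have dg: "((\<lambda>s. deriv \<sigma> s / \<sigma> s) has_real_derivative g2) (at t)" unfolding g2_def by (rule ld(2))
        have "\<bar>g2\<bar> \<le> \<bar>- p / (1 - t)\<^sup>2\<bar> + (\<bar>l'' t / l t\<bar> + \<bar>l' t / l t\<bar>\<^sup>2)"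
          unfolding g2_def power_abs[symmetric]
          by (rule order_trans[OF abs_triangle_ineq add_left_mono[OF abs_triangle_ineq4]])
        also have "\<dots> \<le> p / (1 - t)\<^sup>2 + (A\<^sup>2 + (A\<^sup>2)\<^sup>2)"
          using pos by (intro add_mono power_mono l1) auto
        also have "\<dots> \<le> p / (1 - t)\<^sup>2 + (A\<^sup>2 + (A\<^sup>2)\<^sup>2) / (1 - t)\<^sup>2"
          by (intro add_left_mono le_divide_le_one(2)) (use u in auto)
        also have "\<dots> = G2 / (1 - t)\<^sup>2" by (simp add: G2_def add_divide_distrib)
        finally have g2b: "\<bar>g2\<bar> \<le> G2 / (1 - t)\<^sup>2" .
        \<comment> \<open>After \<open>t0\<close> the noise may vanish at any rate, and monotonicity
          of the signal level bounds \<open>1 / (s^2 * L)\<close> instead.\<close>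
        have "ft0 < f t" using strict_mono_onD[OF fmono, of t0 t] t0 t t' by auto
        then have "ft0\<^sup>2 \<le> (f t)\<^sup>2" using ft0 by (intro power_mono) auto
        then have "1 / (\<sigma> t)\<^sup>2 \<le> 1 / ft0\<^sup>2 * ((f t)\<^sup>2 / (\<sigma> t)\<^sup>2)"
          using ft0 st by (simp add: field_simps)
        also have "\<dots> \<le> \<Theta> * (\<alpha> + (f t)\<^sup>2 / (\<sigma> t)\<^sup>2)"
          using pos by (intro mult_mono) (auto simp: \<Theta>_def)
        finally have th: "1 / (\<sigma> t)\<^sup>2 \<le> \<Theta> * (\<alpha> + (f t)\<^sup>2 / (\<sigma> t)\<^sup>2)" .
        show ?thesis using tf t' th g dg g2b by blast
      qed
      then obtain g2 where b: "\<bar>deriv f t\<bar> \<le> A" "\<bar>deriv (deriv f) t\<bar> \<le> A"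
        "1 / (\<sigma> t)\<^sup>2 \<le> \<Theta> * (\<alpha> + (f t)\<^sup>2 / (\<sigma> t)\<^sup>2)" "\<bar>deriv \<sigma> t / \<sigma> t\<bar> \<le> G1 / (1 - t)"
        "((\<lambda>s. deriv \<sigma> s / \<sigma> s) has_real_derivative g2) (at t)" "\<bar>g2\<bar> \<le> G2 / (1 - t)\<^sup>2" by blast
      have bf: "\<bar>deriv f t\<bar> \<le> A / (1 - t)" "\<bar>deriv (deriv f) t\<bar> \<le> A / (1 - t)\<^sup>2"
        using b(1,2) le_divide_le_one[OF A0 u] by linarith+
      show "\<exists>D. (\<forall>i<d. ((\<lambda>s. v s x i) has_real_derivative D i) (at t)) \<and>
       Rd_norm d D \<le> (G2 + (A + A * G1 + G2) * mean_const \<alpha> K (A + 1) \<Theta> + (A + G1)\<^sup>2 * deriv_const \<alpha> K (A + 1) \<Theta>)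
         / (1 - t)\<^sup>2 * (sqrt (real d) + Rd_norm d x)"
        by (rule W.velocity_derivative_bound[OF d t c cB _ dom df(1) cf(1) df(2) cf(2) sp f1 b(3) \<Theta>0 vf f2 b(5) bf b(4,6)])
           (use A0 x in auto)
    qed
  qed
qed

theorem corollary8:
  fixes \<alpha> \<beta> K \<gamma> A p ft0 :: real
  assumes "0 < \<alpha>" and "0 < K" and "0 < \<beta>" and "\<beta> \<le> 1"
    and "0 < \<gamma>" and "\<gamma> < 1" and "0 < p" and "1 \<le> A"
  shows "\<exists>C>0. \<forall>(d::nat) pstar u a m (f::real \<Rightarrow> real) (\<sigma>::real \<Rightarrow> real) (t0::real)
      (M::'w measure) Y \<xi> v.
    1 \<le> d \<and>
    weakly_log_concave_decomp d \<alpha> \<beta> K pstar u a \<and>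
    is_arg_min u (\<lambda>x. x \<in> Rd d) m \<and>
    C1_ae f \<and> strict_mono_on {0..1} f \<and> f 0 = 0 \<and> f 1 = 1 \<and>
    C1_ae \<sigma> \<and> strict_antimono_on {0..1} \<sigma> \<and> \<sigma> 0 = 1 \<and> \<sigma> 1 = 0 \<and>
    \<gamma> \<le> min (\<sigma> (1/2)) (f (1/2)) \<and> (f (1 - \<gamma>))\<^sup>2 \<ge> \<sigma> (1 - \<gamma>) \<and>
    prob_space M \<and>
    distributed M (Rd_lborel d) Y (\<lambda>x. ennreal (pstar x)) \<and>
    \<xi> \<in> measurable M (Rd_lborel d) \<and> distr M (Rd_lborel d) \<xi> = std_gaussian d \<and>
    prob_space.indep_var M (Rd_lborel d) Y (Rd_lborel d) \<xi> \<and>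
    velocity_field d M Y \<xi> f \<sigma> v \<and>
    0 < t0 \<and> t0 < 1 \<and> f t0 = ft0 \<and>
    C2_ae f \<and> C2_ae \<sigma> \<and> (\<forall>t\<in>{0<..<1}. 0 < \<sigma> t) \<and>
    (\<exists>l l' l''. C2_on_with {t0..<1} l l' l'' \<and>
       (\<forall>t\<in>{t0..<1}. \<sigma> t = (1 - t) powr p * l t \<and> 1 / A \<le> l t \<and> l t \<le> A) \<and>
       Linf_norm {t0..<1} l' + Linf_norm {t0..<1} l'' \<le> ereal A) \<and>
    Linf_norm {t0..<1} (deriv f) + Linf_norm {t0..<1} (deriv (deriv f))
      + ereal (Rd_norm d m / sqrt (real d)) \<le> ereal A \<and>
    (AE t in lborel. t \<in> {0<..t0} \<longrightarrow>
       1 / \<sigma> t + \<bar>deriv \<sigma> t\<bar> + \<bar>deriv (deriv \<sigma>) t\<bar> + \<bar>deriv f t\<bar> + \<bar>deriv (deriv f) t\<bar> \<le> A)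
    \<longrightarrow>
    (AE t in lborel. t \<in> {0<..<1} \<longrightarrow>
       (\<forall>x\<in>Rd d. \<exists>D::vec.
          (\<forall>i<d. ((\<lambda>s. v s x i) has_real_derivative D i) (at t)) \<and>
          Rd_norm d D \<le> C / (1 - t)\<^sup>2 * (sqrt (real d) + Rd_norm d x)))"
proof -
  define G1 where "G1 = p + A\<^sup>2"
  define G2 where "G2 = p + A\<^sup>2 + A ^ 4"
  define \<Theta> where "\<Theta> = A\<^sup>2 / \<alpha> + 1 / ft0\<^sup>2"
  define C where "C = G2 + (A + A * G1 + G2) * mean_const \<alpha> K (A + 1) \<Theta> + (A + G1)\<^sup>2 * deriv_const \<alpha> K (A + 1) \<Theta>"
  have G: "0 < G1" "0 < G2" "0 \<le> \<Theta>" using assms by (simp_all add: G1_def G2_def \<Theta>_def add_pos_nonneg)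
  have mc: "0 \<le> mean_const \<alpha> K (A + 1) \<Theta>" using assms G by (simp add: mean_const_def)
  then have dc: "0 \<le> deriv_const \<alpha> K (A + 1) \<Theta>" using assms G by (simp add: deriv_const_def conc_const_def)
  have "0 < C" unfolding C_def using G mc dc assms by (simp add: add_pos_nonneg)
  show ?thesis
  proof (rule exI[of _ C], intro conjI allI impI)
    show "0 < C" by fact
  qed (unfold C_def G1_def G2_def \<Theta>_def, elim exE conjE,
    rule velocity_time_derivative_ae[OF assms(1,2,3,4,7,8)]; assumption)
qed

end
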